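(* Let $n$ be a natural number and $p$ a prime with $p\geq n$. Let $\mathcal{E}_p^n$ be a set of representatives of the isomorphism classes of groups of order $p^n$ and exponent $p$. For $E\in\mathcal{E}_p^n$, let $N_E$ be the set of group endomorphisms $\sigma:E\to E$ such that $\mathrm{Im}\,\sigma\subseteq Z(E)$ and $\sigma^n$ is the trivial endomorphism (sending all of $E$ to the identity). The group $\mathrm{Aut}(E)$ acts on $N_E$ by conjugation, and for $\phi\in N_E$ let $\phi^{\mathrm{Aut}(E)}$ denote its orbit. Then the number of isomorphism classes of groups of order $p^n$ whose derived subgroup has exponent dividing $p$ equals $$\sum_{E\in\mathcal{E}_p^n}\ \sum_{\phi\in N_E}\frac{1}{\lvert\phi^{\mathrm{Aut}(E)}\rvert}.$$
   Context: $Z(E)$ is the centre of $E$; $\sigma^n$ denotes the $n$-fold composite of $\sigma$. *)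

theory Defs
  imports Complex_Main "HOL-Computational_Algebra.Primes" "HOL-Algebra.Generated_Groups"
begin

definition grp_center :: "('a, 'b) monoid_scheme \<Rightarrow> 'a set" where
  "grp_center G = {z \<in> carrier G. \<forall>x \<in> carrier G. z \<otimes>\<^bsub>G\<^esub> x = x \<otimes>\<^bsub>G\<^esub> z}"

definition exp_divides :: "('a, 'b) monoid_scheme \<Rightarrow> 'a set \<Rightarrow> nat \<Rightarrow> bool" where
  "exp_divides G S p \<longleftrightarrow> (\<forall>x \<in> S. x [^]\<^bsub>G\<^esub> p = \<one>\<^bsub>G\<^esub>)"

definition order_exp_p :: "('a, 'b) monoid_scheme \<Rightarrow> nat \<Rightarrow> nat \<Rightarrow> bool" where
  "order_exp_p G m p \<longleftrightarrow> group G \<and> finite (carrier G) \<and> card (carrier G) = m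
      \<and> exp_divides G (carrier G) p"

text \<open>Canonical carrier for groups of order m: the type nat, carrier {..<m}.
  Every group of order m is isomorphic to one of these.\<close>
definition groups_on :: "nat \<Rightarrow> nat monoid set" where
  "groups_on m = {G. group G \<and> carrier G = {..<m}}"

definition num_iso_classes :: "nat \<Rightarrow> (nat monoid \<Rightarrow> bool) \<Rightarrow> nat" where
  "num_iso_classes m P =
     card ({G \<in> groups_on m. P G} // {(G, H). G \<in> groups_on m \<and> H \<in> groups_on m \<and> G \<cong> H})"

definition N_set :: "('a, 'b) monoid_scheme \<Rightarrow> nat \<Rightarrow> ('a \<Rightarrow> 'a) set" where
  "N_set E n = {\<sigma> \<in> hom E E. \<sigma> \<in> extensional (carrier E)
      \<and> \<sigma> ` carrier E \<subseteq> grp_center E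
      \<and> (\<forall>x \<in> carrier E. (\<sigma> ^^ n) x = \<one>\<^bsub>E\<^esub>)}"

definition aut_orbit :: "('a, 'b) monoid_scheme \<Rightarrow> ('a \<Rightarrow> 'a) \<Rightarrow> ('a \<Rightarrow> 'a) set" where
  "aut_orbit E \<phi> = {restrict (\<alpha> \<circ> \<phi> \<circ> inv_into (carrier E) \<alpha>) (carrier E) | \<alpha>. \<alpha> \<in> iso E E}"

end

theory Submission
  imports Defs "HOL-Algebra.Group_Action" "HOL-Algebra.Multiplicative_Group"
begin

text \<open>
  Both sides count isomorphism classes of pairs \<open>(G, \<phi>)\<close>, where \<open>G\<close> has order \<open>p ^ n\<close> and \<open>\<phi>\<close> is a
  nilpotent endomorphism of \<open>G\<close> with central image such that \<open>x ^ p = \<phi>(x) ^ e\<close>. For \<open>e = 0\<close> these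
  are the pairs \<open>(E, \<phi>)\<close> on the right. For \<open>e = 1\<close> the map \<open>\<phi>\<close> is the \<open>p\<close>-th power map, and for
  \<open>n \<le> p\<close> it is a central endomorphism as soon as \<open>G'\<close> has exponent dividing \<open>p\<close>, because the
  nilpotency class of \<open>G\<close> is less than \<open>p\<close> (the case of the Hall-Petrescu formula where all binomial
  coefficients that occur are divisible by \<open>p\<close>).

  To pass between \<open>e = 1\<close> and \<open>e = 0\<close>, regard \<open>G/G'\<close> as a module over \<open>\<int>[t]/(p - e t)\<close>, with \<open>t\<close> acting as
  \<open>\<phi>\<close>, and choose a Jordan basis. It presents \<open>G/G'\<close> as \<open>M/(p - e t)M\<close> for a free abelian group \<open>M\<close> with
  a nilpotent operator \<open>t\<close> that does not depend on \<open>e\<close>. In the fibre product \<open>F\<close> of \<open>G\<close> and \<open>M\<close> over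
  \<open>G/G'\<close> the elements \<open>x ^ p \<phi>(x) ^ (-e')\<close> form a central subgroup, and the quotient of \<open>F\<close> by it is a
  pair with \<open>e\<close> replaced by \<open>e'\<close>. The two pairs are linked by a bijection that preserves
  commutators and \<open>\<phi>\<close> and that is multiplicative modulo the image of \<open>\<phi>\<close>. Conversely, a Jordan basis
  allows one to straighten such a bijection between two pairs with the same \<open>e\<close> into an isomorphism.
  So being linked is a bijection between the isomorphism classes for \<open>e = 1\<close> and those for \<open>e = 0\<close>.
\<close>

section \<open>Polynomial sequences in filtered groups\<close>

text \<open>The link between the types \<open>e = 1\<close> and \<open>e = 0\<close> depends on a
  Jordan basis and a choice of digits, and singles out no canonical partner. Rigidity makes the
  choices harmless: two pairs of one type that are linked to a common pair are linked to each other,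
  hence isomorphic. So it is enough that linkage is symmetric and transitive and that each pair has
  some partner of the other type.

  The obstacle is carrying. For every e the classes of M/(p - e t)M have the vectors with entries 0,
  ..., p - 1 as normal forms, which yields the bijection, but adding two normal forms produces a
  carry (p - e t)w. Read with e' in place of e, it is off by (e - e') t w, an element of the image
  of the operator. This is why a link is multiplicative only modulo that image. The defect can be
  removed because the operator is nilpotent: a homomorphism that commutes with the operators and
  agrees with a bijection modulo the image is still onto.

  The reciprocal orbit sizes in the sum only serve to count orbits.\<close>

definition gcom :: "('a, 'b) monoid_scheme \<Rightarrow> 'a \<Rightarrow> 'a \<Rightarrow> 'a" where
  "gcom G x y = x \<otimes>\<^bsub>G\<^esub> y \<otimes>\<^bsub>G\<^esub> inv\<^bsub>G\<^esub> x \<otimes>\<^bsub>G\<^esub> inv\<^bsub>G\<^esub> y"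

context group
begin

lemma l_cancel_inv: "x \<in> carrier G \<Longrightarrow> y \<in> carrier G \<Longrightarrow> inv x \<otimes> (x \<otimes> y) = y"
  by (simp add: m_assoc [symmetric])

lemma r_cancel_inv: "x \<in> carrier G \<Longrightarrow> y \<in> carrier G \<Longrightarrow> x \<otimes> (inv x \<otimes> y) = y"
  by (simp add: m_assoc [symmetric])

text \<open>With the default rules for inverses these rewrite to right-nested reduced words, so
  identities of free groups are proved by simplification.\<close>

lemmas word_simps = m_assoc inv_mult_group l_cancel_inv r_cancel_inv

lemma gcom_closed [simp, intro]: "x \<in> carrier G \<Longrightarrow> y \<in> carrier G \<Longrightarrow> gcom G x y \<in> carrier G"
  by (simp add: gcom_def)

lemma gcom_mult: "x \<in> carrier G \<Longrightarrow> y \<in> carrier G \<Longrightarrow> gcom G x y \<otimes> (y \<otimes> x) = x \<otimes> y"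
  by (simp add: gcom_def word_simps)

lemma gcom_eq_one_iff: "x \<in> carrier G \<Longrightarrow> y \<in> carrier G \<Longrightarrow> gcom G x y = \<one> \<longleftrightarrow> x \<otimes> y = y \<otimes> x"
  by (metis gcom_mult gcom_closed m_closed r_cancel_one)

lemma inv_gcom: "x \<in> carrier G \<Longrightarrow> y \<in> carrier G \<Longrightarrow> inv (gcom G x y) = gcom G y x"
  by (simp add: gcom_def word_simps)

lemma gcom_in_derived: "x \<in> carrier G \<Longrightarrow> y \<in> carrier G \<Longrightarrow> gcom G x y \<in> derived G (carrier G)"
  unfolding derived_def gcom_def by (rule generate.incl) blast

lemma subgroup_nat_pow_closed: "subgroup H G \<Longrightarrow> x \<in> H \<Longrightarrow> x [^] (k::nat) \<in> H"
  by (induction k) (auto simp: subgroup.one_closed subgroup.m_closed)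

lemma subgroup_int_pow_closed:
  assumes "subgroup H G" "x \<in> H" shows "x [^] (k::int) \<in> H"
  using subgroup_nat_pow_closed [OF assms] subgroup.m_inv_closed [OF assms(1)]
  unfolding int_pow_def2 by presburger

end

text \<open>Degrees start at 0 so that they add under commutators. Taking i = 0 in
  \<open>filt_gcom\<close> says that \<open>F 0\<close> normalises every \<open>F j\<close>.\<close>

locale filtered_group = group G for G (structure) +
  fixes F :: "nat \<Rightarrow> 'a set"
  assumes filt_subgroup: "subgroup (F i) G"
    and filt_dec: "F (Suc i) \<subseteq> F i"
    and filt_gcom: "x \<in> F i \<Longrightarrow> y \<in> F j \<Longrightarrow> gcom G x y \<in> F (i + j)"
begin

lemma filt_mono: "i \<le> j \<Longrightarrow> F j \<subseteq> F i"
  using lift_Suc_antimono_le [of F i j] filt_dec by blast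

lemma filt_carrier: "x \<in> F i \<Longrightarrow> x \<in> carrier G"
  using subgroup.mem_carrier [OF filt_subgroup] by blast

text \<open>
  These are Leibman's polynomial sequences: for \<open>i \<le> t\<close> the \<open>i\<close>-th differences take values in \<open>F (j + i)\<close>.
  Unlike the sequences \<open>k \<mapsto> x [^] k\<close>, they form a group.
\<close>

primrec poly_seq :: "nat \<Rightarrow> nat \<Rightarrow> (nat \<Rightarrow> 'a) set" where
  "poly_seq 0 j = {f. \<forall>k. f k \<in> F j}"
| "poly_seq (Suc t) j = {f. (\<forall>k. f k \<in> F j) \<and> (\<lambda>k. f (Suc k) \<otimes> inv (f k)) \<in> poly_seq t (Suc j)}"

lemma poly_seq_value: "f \<in> poly_seq t j \<Longrightarrow> f k \<in> F j"
  by (cases t) auto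

lemma poly_seq_carrier: "f \<in> poly_seq t j \<Longrightarrow> f k \<in> carrier G"
  using poly_seq_value filt_carrier by blast

lemma poly_seq_Suc: "poly_seq (Suc t) j \<subseteq> poly_seq t j"
proof (induction t arbitrary: j)
  case (Suc t)
  show ?case
  proof
    fix f assume "f \<in> poly_seq (Suc (Suc t)) j"
    then have "\<forall>k. f k \<in> F j" and "(\<lambda>k. f (Suc k) \<otimes> inv (f k)) \<in> poly_seq (Suc t) (Suc j)"
      by simp_all
    then show "f \<in> poly_seq (Suc t) j" using Suc.IH [of "Suc j"] by (simp del: poly_seq.simps(2) add: poly_seq.simps(2) [of t j] subset_iff)
  qed
qed auto

lemma poly_seq_mono: "i \<le> j \<Longrightarrow> f \<in> poly_seq t j \<Longrightarrow> f \<in> poly_seq t i"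
proof (induction t arbitrary: i j f)
  case 0
  then show ?case using filt_mono [of i j] by auto
next
  case (Suc t)
  have "(\<lambda>k. f (Suc k) \<otimes> inv (f k)) \<in> poly_seq t (Suc i)"
    by (rule Suc.IH [of _ "Suc j"]) (use Suc.prems in auto)
  then show ?case using Suc.prems filt_mono [of i j] by auto
qed

text \<open>The Lazard-Leibman theorem. Differences of a product, an inverse or a commutator are
  words in the sequences, their differences \<open>u\<close>, \<open>v\<close> and commutators of
  these. Levels add under commutators, so each factor lies one level deeper and has one difference
  less to check. The three claims feed each other, hence the joint induction on
  \<open>t\<close>.\<close>

lemma poly_seq_closed:
  shows "f \<in> poly_seq t j \<Longrightarrow> g \<in> poly_seq t j \<Longrightarrow> (\<lambda>k. f k \<otimes> g k) \<in> poly_seq t j"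
    and "f \<in> poly_seq t j \<Longrightarrow> (\<lambda>k. inv (f k)) \<in> poly_seq t j"
    and "f \<in> poly_seq t i \<Longrightarrow> g \<in> poly_seq t j \<Longrightarrow> (\<lambda>k. gcom G (f k) (g k)) \<in> poly_seq t (i + j)"
proof (induction t arbitrary: f g i j)
  case 0
  {
    case 1 then show ?case using subgroup.m_closed [OF filt_subgroup] by auto
  next
    case 2 then show ?case using subgroup.m_inv_closed [OF filt_subgroup] by auto
  next
    case 3 then show ?case using filt_gcom by auto
  }
next
  case (Suc t)
  {
    case 1
    define u where "u = (\<lambda>k. f (Suc k) \<otimes> inv (f k))"
    define v where "v = (\<lambda>k. g (Suc k) \<otimes> inv (g k))"
    have c: "f k \<in> carrier G" "g k \<in> carrier G" for k
      using 1 poly_seq_carrier by blast+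
    have uv: "u \<in> poly_seq t (Suc j)" "v \<in> poly_seq t (Suc j)" "f \<in> poly_seq t j"
      using 1 poly_seq_Suc by (auto simp: u_def v_def)
    have "(\<lambda>k. gcom G (f k) (v k)) \<in> poly_seq t (Suc j)"
      by (rule poly_seq_mono [OF _ Suc.IH(3) [OF uv(3,2)]]) simp
    then have "(\<lambda>k. (u k \<otimes> gcom G (f k) (v k)) \<otimes> v k) \<in> poly_seq t (Suc j)"
      using uv Suc.IH(1) by blast
    also have "(\<lambda>k. (u k \<otimes> gcom G (f k) (v k)) \<otimes> v k)
        = (\<lambda>k. (f (Suc k) \<otimes> g (Suc k)) \<otimes> inv (f k \<otimes> g k))"
      using c by (intro ext) (simp add: u_def v_def gcom_def word_simps)
    finally show ?case using 1 subgroup.m_closed [OF filt_subgroup] by auto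
  next
    case 2
    define u where "u = (\<lambda>k. f (Suc k) \<otimes> inv (f k))"
    have c: "f k \<in> carrier G" for k
      using 2 poly_seq_carrier by blast
    have u: "u \<in> poly_seq t (Suc j)" "f \<in> poly_seq t j"
      using 2 poly_seq_Suc by (auto simp: u_def)
    have i: "(\<lambda>k. inv (u k)) \<in> poly_seq t (Suc j)" "(\<lambda>k. inv (f k)) \<in> poly_seq t j"
      using u Suc.IH(2) by auto
    have "(\<lambda>k. gcom G (inv (f k)) (inv (u k))) \<in> poly_seq t (Suc j)"
      by (rule poly_seq_mono [OF _ Suc.IH(3) [OF i(2,1)]]) simp
    then have "(\<lambda>k. gcom G (inv (f k)) (inv (u k)) \<otimes> inv (u k)) \<in> poly_seq t (Suc j)"
      using i Suc.IH(1) by blast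
    also have "(\<lambda>k. gcom G (inv (f k)) (inv (u k)) \<otimes> inv (u k))
        = (\<lambda>k. inv (f (Suc k)) \<otimes> inv (inv (f k)))"
      using c by (intro ext) (simp add: u_def gcom_def word_simps)
    finally show ?case using 2 subgroup.m_inv_closed [OF filt_subgroup] by auto
  next
    case 3
    define u where "u = (\<lambda>k. f (Suc k) \<otimes> inv (f k))"
    define v where "v = (\<lambda>k. g (Suc k) \<otimes> inv (g k))"
    define h where "h = (\<lambda>k. gcom G (f k) (g k))"
    \<comment> \<open>With f(k+1) = u f, g(k+1) = v g and h = [f, g], the product rules for
      commutators give [u f, v g] = a (v u) h (v u)^-1 b. Writing the conjugate as [v u, h] h and
      moving h past b leaves a [v u, h] [h, b] b h, so the difference is this word without its last
      letter.\<close>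
    define a where "a = (\<lambda>k. gcom G (u k \<otimes> f k) (v k))"
    define b0 where "b0 = (\<lambda>k. gcom G (u k) (g k))"
    define b where "b = (\<lambda>k. gcom G (v k) (b0 k) \<otimes> b0 k)"
    have c: "f k \<in> carrier G" "g k \<in> carrier G" for k
      using 3 poly_seq_carrier by blast+
    have cuv: "u k \<in> carrier G" "v k \<in> carrier G" for k
      using c by (auto simp: u_def v_def)
    have uv: "u \<in> poly_seq t (Suc i)" "v \<in> poly_seq t (Suc j)"
        "f \<in> poly_seq t i" "g \<in> poly_seq t j"
      using 3 poly_seq_Suc by (auto simp: u_def v_def)
    have hP: "h \<in> poly_seq t (i + j)" unfolding h_def by (rule Suc.IH(3) [OF uv(3,4)])
    have "(\<lambda>k. u k \<otimes> f k) \<in> poly_seq t i"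
      by (rule Suc.IH(1) [OF poly_seq_mono [OF _ uv(1)] uv(3)]) simp
    then have aP: "a \<in> poly_seq t (Suc (i + j))"
      unfolding a_def using Suc.IH(3) [OF _ uv(2)] by fastforce
    have b0P: "b0 \<in> poly_seq t (Suc (i + j))"
      unfolding b0_def using Suc.IH(3) [OF uv(1,4)] by simp
    have "(\<lambda>k. gcom G (v k) (b0 k)) \<in> poly_seq t (Suc (i + j))"
      by (rule poly_seq_mono [OF _ Suc.IH(3) [OF uv(2) b0P]]) simp
    then have bP: "b \<in> poly_seq t (Suc (i + j))"
      unfolding b_def using Suc.IH(1) b0P by blast
    have hb: "(\<lambda>k. gcom G (h k) (b k)) \<in> poly_seq t (Suc (i + j))"
      by (rule poly_seq_mono [OF _ Suc.IH(3) [OF hP bP]]) simp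
    have "(\<lambda>k. v k \<otimes> u k) \<in> poly_seq t 1"
      by (rule Suc.IH(1) [OF poly_seq_mono [OF _ uv(2)] poly_seq_mono [OF _ uv(1)]]) auto
    then have "(\<lambda>k. gcom G (v k \<otimes> u k) (h k)) \<in> poly_seq t (Suc (i + j))"
      using Suc.IH(3) [OF _ hP] by fastforce
    then have "(\<lambda>k. ((a k \<otimes> gcom G (v k \<otimes> u k) (h k)) \<otimes> gcom G (h k) (b k)) \<otimes> b k)
        \<in> poly_seq t (Suc (i + j))"
      using aP hb bP Suc.IH(1) by blast
    also have "(\<lambda>k. ((a k \<otimes> gcom G (v k \<otimes> u k) (h k)) \<otimes> gcom G (h k) (b k)) \<otimes> b k)
        = (\<lambda>k. gcom G (f (Suc k)) (g (Suc k)) \<otimes> inv (gcom G (f k) (g k)))"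
    proof
      fix k
      have eq: "f (Suc k) = u k \<otimes> f k" "g (Suc k) = v k \<otimes> g k"
        using c by (auto simp: u_def v_def word_simps)
      show "((a k \<otimes> gcom G (v k \<otimes> u k) (h k)) \<otimes> gcom G (h k) (b k)) \<otimes> b k
        = gcom G (f (Suc k)) (g (Suc k)) \<otimes> inv (gcom G (f k) (g k))"
        unfolding eq a_def b_def b0_def h_def using c [of k] cuv [of k]
        by (simp add: gcom_def word_simps)
    qed
    finally show ?case using 3 filt_gcom by auto
  }
qed

lemma poly_seq_const: "x \<in> F j \<Longrightarrow> (\<lambda>k. x) \<in> poly_seq t j"
proof (induction t arbitrary: x j)
  case (Suc t)
  then show ?case
    using subgroup.one_closed [OF filt_subgroup] filt_carrier [OF Suc.prems] by simp
qed simp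

text \<open>Pascal's rule: the exponent k choose (m + 1) has difference k choose m, so each
  difference uses up one of the m spare levels of \<open>x\<close>.\<close>

lemma poly_seq_binomial: "x \<in> F (j + m) \<Longrightarrow> (\<lambda>k. x [^] (k choose m)) \<in> poly_seq t j"
proof (induction m arbitrary: j t)
  case 0
  then show ?case using poly_seq_const filt_carrier [OF 0] by simp
next
  case (Suc m)
  have x: "x \<in> carrier G" and xj: "x \<in> F j"
    using Suc.prems filt_carrier filt_mono [of j "j + Suc m"] by auto
  have mem: "x [^] (k choose Suc m) \<in> F j" for k
    by (rule subgroup_nat_pow_closed [OF filt_subgroup xj])
  show ?case
  proof (cases t)
    case 0
    then show ?thesis using mem by simp
  next
    case (Suc t')
    have "x [^] (Suc k choose Suc m) \<otimes> inv (x [^] (k choose Suc m)) = x [^] (k choose m)" for k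
      using x by (simp add: nat_pow_mult [symmetric] m_assoc)
    then show ?thesis
      using Suc Suc.IH [of "Suc j" t'] Suc.prems mem by simp
  qed
qed

text \<open>When the values at 0, ..., m - 1 are trivial, the value at m is the m-th difference at
  0.\<close>

lemma poly_seq_vanish:
  "f \<in> poly_seq t j \<Longrightarrow> m \<le> t \<Longrightarrow> (\<And>k. k < m \<Longrightarrow> f k = \<one>) \<Longrightarrow> f m \<in> F (j + m)"
proof (induction m arbitrary: f t j)
  case 0
  then show ?case using poly_seq_value by auto
next
  case (Suc m)
  obtain t' where t: "t = Suc t'" using Suc.prems by (cases t) auto
  define u where "u = (\<lambda>k. f (Suc k) \<otimes> inv (f k))"
  have c: "f k \<in> carrier G" for k using Suc.prems poly_seq_carrier by blast
  have "u m \<in> F (Suc j + m)"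
  proof (rule Suc.IH)
    show "u \<in> poly_seq t' (Suc j)" using Suc.prems by (simp add: t u_def)
    show "m \<le> t'" using Suc.prems t by simp
    show "u k = \<one>" if "k < m" for k using Suc.prems(3) that by (simp add: u_def)
  qed
  moreover have "u m = f (Suc m)" using Suc.prems(3) [of m] c by (simp add: u_def)
  ultimately show ?case by simp
qed

text \<open>Newton expansion of y^-k x^-k (x y)^k, as in the Hall-Petrescu formula: the coefficient
  belonging to k choose m lies in \<open>F m\<close>. At k = p the terms with 2 \<le> m < p vanish
  because p divides p choose m and \<open>F 2\<close> has exponent dividing p; what remains lies in
  the trivial group \<open>F p\<close>.\<close>

lemma pow_mult_prime:
  assumes "prime p" and F1: "F 1 = carrier G" and Fp: "F p = {\<one>}"
    and F2: "\<And>x. x \<in> F 2 \<Longrightarrow> x [^] p = \<one>"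
    and x: "x \<in> carrier G" and y: "y \<in> carrier G"
  shows "(x \<otimes> y) [^] p = x [^] p \<otimes> y [^] p"
proof -
  have pw: "(\<lambda>k. z [^] k) \<in> poly_seq t 0" if "z \<in> carrier G" for z t
    using poly_seq_binomial [of z 0 1 t] that F1 by simp
  define f where "f = (\<lambda>k::nat. inv (y [^] k) \<otimes> (inv (x [^] k) \<otimes> (x \<otimes> y) [^] k))"
  have fP: "f \<in> poly_seq t 0" for t
    unfolding f_def by (intro poly_seq_closed pw x y m_closed)
  \<comment> \<open>\<open>g\<close> is \<open>f\<close> with the Newton terms below m stripped off.
    Starting at 2 is possible because f(0) = f(1) = 1, and it keeps out coefficients from
    \<open>F 1\<close>, whose p-th powers may be nontrivial.\<close>
  have "\<exists>g. (\<forall>t. g \<in> poly_seq t 0) \<and> (\<forall>k<m. g k = \<one>) \<and> g p = f p" if "2 \<le> m" "m \<le> p" for m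
    using that
  proof (induction m rule: dec_induct)
    case base
    have "f k = \<one>" if "k < 2" for k
    proof -
      have "k = 0 \<or> k = 1" using that by linarith
      then show ?thesis using x y by (auto simp: f_def word_simps)
    qed
    then show ?case using fP by blast
  next
    case (step m)
    then obtain g where g: "\<And>t. g \<in> poly_seq t 0" "\<And>k. k < m \<Longrightarrow> g k = \<one>" "g p = f p"
      by auto
    have gm: "g m \<in> F m" using poly_seq_vanish [OF g(1) order_refl g(2)] by simp
    have gc: "g m \<in> carrier G" using gm filt_carrier by blast
    \<comment> \<open>k choose m is 0 below m and 1 at m, so dividing by this term kills the value
      at m and keeps the earlier ones.\<close>
    define h where "h = (\<lambda>k. inv (g m [^] (k choose m)) \<otimes> g k)"
    have "h \<in> poly_seq t 0" for t
      unfolding h_def using gm by (intro poly_seq_closed g poly_seq_binomial) simp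
    moreover have "h k = \<one>" if "k < Suc m" for k
      using that g(2) gc by (cases "k = m") (auto simp: h_def binomial_eq_0)
    moreover have "h p = f p"
    proof -
      have "g m \<in> F 2" using gm filt_mono [of 2 m] step by auto
      then have "g m [^] p = \<one>" by (rule F2)
      moreover have "p dvd (p choose m)"
        using step \<open>prime p\<close> by (intro dvd_choose_prime) auto
      ultimately have "g m [^] (p choose m) = \<one>"
        using gc by (metis dvdE nat_pow_one nat_pow_pow)
      moreover have "g p \<in> carrier G" using g(1) poly_seq_carrier by blast
      ultimately show ?thesis using g(3) by (simp add: h_def)
    qed
    ultimately show ?case by blast
  qed
  from this [of p] obtain g where g: "\<And>t. g \<in> poly_seq t 0" "\<And>k. k < p \<Longrightarrow> g k = \<one>" "g p = f p"
    using prime_ge_2_nat [OF \<open>prime p\<close>] by auto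
  have "f p = \<one>" using poly_seq_vanish [OF g(1) order_refl, of p] g(2,3) Fp by auto
  moreover have "(x \<otimes> y) [^] p = x [^] p \<otimes> (y [^] p \<otimes> f p)"
    using x y by (simp add: f_def word_simps)
  ultimately show ?thesis using x y by simp
qed

end

section \<open>The power map of a group of order \<open>p ^ n\<close> with \<open>n \<le> p\<close>\<close>

context group
begin

lemma gcom_conj:
  "g \<in> carrier G \<Longrightarrow> x \<in> carrier G \<Longrightarrow> y \<in> carrier G \<Longrightarrow>
    g \<otimes> gcom G x y \<otimes> inv g = gcom G (g \<otimes> x \<otimes> inv g) (g \<otimes> y \<otimes> inv g)"
  by (simp add: gcom_def word_simps)

section \<open>Commutators and quotients by a normal subgroup\<close>

lemma normal_gcom:
  assumes "N \<lhd> G" "x \<in> N" "y \<in> carrier G"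
  shows "gcom G x y \<in> N" "gcom G y x \<in> N"
proof -
  interpret N: normal N G by fact
  have xc: "x \<in> carrier G" using assms by auto
  have "x \<otimes> (y \<otimes> inv x \<otimes> inv y) \<in> N"
    using assms N.inv_op_closed2 N.m_closed N.m_inv_closed by blast
  moreover have "gcom G x y = x \<otimes> (y \<otimes> inv x \<otimes> inv y)"
    using xc assms by (simp add: gcom_def m_assoc)
  ultimately show 1: "gcom G x y \<in> N" by simp
  show "gcom G y x \<in> N"
    using N.m_inv_closed [OF 1] xc assms by (simp add: inv_gcom)
qed

lemma normal_quotient_hom:
  assumes "N \<lhd> G" shows "group_hom G (G Mod N) (\<lambda>x. N #> x)"
  using normal.factorgroup_is_group [OF assms] normal.r_coset_hom_Mod [OF assms]
  by (simp add: group_hom_def group_hom_axioms_def)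

lemma normal_quotient_one:
  assumes "N \<lhd> G" "x \<in> carrier G" shows "N #> x = \<one>\<^bsub>G Mod N\<^esub> \<longleftrightarrow> x \<in> N"
  using coset_join1 [OF _ assms(2)] coset_join2 [OF assms(2)] normal_imp_subgroup [OF assms(1)]
  by auto

lemma normal_quotient_gcom:
  assumes "N \<lhd> G" "x \<in> carrier G" "y \<in> carrier G"
  shows "N #> gcom G x y = gcom (G Mod N) (N #> x) (N #> y)"
proof -
  interpret q: group_hom G "G Mod N" "\<lambda>x. N #> x" by (rule normal_quotient_hom [OF assms(1)])
  show ?thesis
    using assms by (simp only: gcom_def q.hom_mult q.hom_inv m_closed inv_closed)
qed

lemma normal_quotient_commute_iff:
  assumes N: "N \<lhd> G" and x: "x \<in> carrier G" and y: "y \<in> carrier G"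
  shows "gcom G x y \<in> N \<longleftrightarrow> (N #> x) \<otimes>\<^bsub>G Mod N\<^esub> (N #> y) = (N #> y) \<otimes>\<^bsub>G Mod N\<^esub> (N #> x)"
proof -
  interpret q: group_hom G "G Mod N" "\<lambda>x. N #> x" by (rule normal_quotient_hom [OF N])
  show ?thesis
    using normal_quotient_one [OF N gcom_closed [OF x y]] normal_quotient_gcom [OF N x y]
      q.H.gcom_eq_one_iff [OF q.hom_closed [OF x] q.hom_closed [OF y]] by simp
qed

text \<open>Used modulo \<open>\<gamma>\<^sub>i\<^sub>+\<^sub>j\<^sub>+\<^sub>1\<close>, this replaces the three subgroups lemma.\<close>

lemma gcom_gcom_eq_one:
  assumes x: "x \<in> carrier G" and y: "y \<in> carrier G" and g: "g \<in> carrier G"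
    and z: "\<And>h. h \<in> carrier G \<Longrightarrow> gcom G x y \<otimes> h = h \<otimes> gcom G x y"
    and u: "gcom G x g \<otimes> (g \<otimes> y \<otimes> inv g) = (g \<otimes> y \<otimes> inv g) \<otimes> gcom G x g"
  shows "gcom G x (gcom G y g) = \<one>"
proof -
  define c where "c = gcom G x y"
  define d where "d = gcom G x g"
  define y' where "y' = g \<otimes> inv y \<otimes> inv g"
  have cl: "c \<in> carrier G" "d \<in> carrier G" "y' \<in> carrier G"
    using x y g by (auto simp: c_def d_def y'_def)
  have 1: "x \<otimes> y \<otimes> inv x = c \<otimes> y"
    using x y by (simp add: c_def gcom_def word_simps)
  have "d \<otimes> inv y' = inv y' \<otimes> d"
    using u x y g by (simp add: d_def y'_def word_simps)
  then have "inv (d \<otimes> inv y') = inv (inv y' \<otimes> d)" by simp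
  then have "y' \<otimes> inv d = inv d \<otimes> y'" using cl by (simp add: inv_mult_group)
  then have dy: "d \<otimes> y' \<otimes> inv d = y'" using cl by (simp add: m_assoc r_cancel_inv)
  \<comment> \<open>Conjugation by x turns y into c y and y' into y' c^-1, as c is central and d
    commutes with y'. The two factors cancel in [y, g] = y y'.\<close>
  have "x \<otimes> y' \<otimes> inv x = d \<otimes> (g \<otimes> inv (x \<otimes> y \<otimes> inv x) \<otimes> inv g) \<otimes> inv d"
    using x y g by (simp add: d_def y'_def gcom_def word_simps)
  also have "\<dots> = d \<otimes> (g \<otimes> (inv y \<otimes> inv c) \<otimes> inv g) \<otimes> inv d"
    using 1 x y g cl by (simp add: inv_mult_group)
  also have "g \<otimes> (inv y \<otimes> inv c) \<otimes> inv g = y' \<otimes> inv c"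
  proof -
    have "inv c \<otimes> inv g = inv g \<otimes> inv c"
      using arg_cong [OF z [OF g], of "m_inv G"] g cl by (simp add: c_def [symmetric] inv_mult_group)
    then show ?thesis using y g cl by (simp add: y'_def m_assoc)
  qed
  also have "d \<otimes> (y' \<otimes> inv c) \<otimes> inv d = (d \<otimes> y' \<otimes> inv d) \<otimes> inv c"
  proof -
    have "inv c \<otimes> inv d = inv d \<otimes> inv c"
      using arg_cong [OF z [OF cl(2)], of "m_inv G"] cl by (simp add: c_def [symmetric] inv_mult_group)
    then show ?thesis using cl by (simp add: m_assoc)
  qed
  finally have 2: "x \<otimes> y' \<otimes> inv x = y' \<otimes> inv c" by (simp add: dy)
  have w: "gcom G y g = y \<otimes> y'"
    using y g by (simp add: gcom_def y'_def m_assoc)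
  have "x \<otimes> (y \<otimes> y') \<otimes> inv x = (x \<otimes> y \<otimes> inv x) \<otimes> (x \<otimes> y' \<otimes> inv x)"
    using x y cl by (simp add: word_simps)
  also have "\<dots> = c \<otimes> (y \<otimes> y') \<otimes> inv c"
    using y cl by (simp add: 1 2 m_assoc)
  also have "\<dots> = y \<otimes> y'"
    using z [of "y \<otimes> y'"] y cl by (simp add: c_def [symmetric] m_assoc)
  finally show ?thesis
    unfolding w using x y cl by (simp add: gcom_def r_cancel_inv)
qed

section \<open>The lower central series, with \<open>lcs k\<close> for the usual gamma_(k+1)\<close>

primrec lcs :: "nat \<Rightarrow> 'a set" where
  "lcs 0 = carrier G"
| "lcs (Suc k) = generate G {gcom G x g | x g. x \<in> lcs k \<and> g \<in> carrier G}"

declare lcs.simps(2) [simp del]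

lemma lcs_normal: "lcs k \<lhd> G"
proof (induction k)
  case 0
  then show ?case by (simp add: normal_self)
next
  case (Suc k)
  interpret N: normal "lcs k" G by fact
  show ?case unfolding lcs.simps(2)
  proof (rule normal_generateI)
    show "{gcom G x g | x g. x \<in> lcs k \<and> g \<in> carrier G} \<subseteq> carrier G" by auto
    fix h a assume "h \<in> {gcom G x g | x g. x \<in> lcs k \<and> g \<in> carrier G}" and a: "a \<in> carrier G"
    then obtain x g where h: "h = gcom G x g" "x \<in> lcs k" "g \<in> carrier G" by blast
    have "a \<otimes> h \<otimes> inv a = gcom G (a \<otimes> x \<otimes> inv a) (a \<otimes> g \<otimes> inv a)"
      using h a by (simp add: gcom_conj)
    moreover have "a \<otimes> x \<otimes> inv a \<in> lcs k" using h a N.inv_op_closed2 by blast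
    ultimately show "a \<otimes> h \<otimes> inv a \<in> {gcom G x g | x g. x \<in> lcs k \<and> g \<in> carrier G}"
      using h a by blast
  qed
qed

lemma lcs_subgroup: "subgroup (lcs k) G"
  by (rule normal_imp_subgroup [OF lcs_normal])

lemma lcs_carrier: "x \<in> lcs k \<Longrightarrow> x \<in> carrier G"
  by (rule subgroup.mem_carrier [OF lcs_subgroup])

lemma gcom_lcs: "x \<in> lcs k \<Longrightarrow> g \<in> carrier G \<Longrightarrow> gcom G x g \<in> lcs (Suc k)"
  unfolding lcs.simps(2) by (rule generate.incl) blast

lemma lcs_dec: "lcs (Suc k) \<subseteq> lcs k"
proof -
  have "{gcom G x g | x g. x \<in> lcs k \<and> g \<in> carrier G} \<subseteq> lcs k"
    using normal_gcom(1) [OF lcs_normal] by blast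
  then show ?thesis unfolding lcs.simps(2) by (rule generate_subgroup_incl [OF _ lcs_subgroup])
qed

text \<open>The elements that commute with all of \<open>lcs i\<close> modulo \<open>N\<close> form
  a subgroup \<open>S\<close>, so only the generators [y, g] of \<open>lcs (Suc j)\<close> matter.
  For them the induction hypothesis makes [x, y] central modulo \<open>N\<close>, and makes [x, g],
  which lies in \<open>lcs (Suc i)\<close>, commute with conjugates of y; the second use is why
  \<open>i\<close> is generalised.\<close>

lemma lcs_gcom: "x \<in> lcs i \<Longrightarrow> y \<in> lcs j \<Longrightarrow> gcom G x y \<in> lcs (Suc (i + j))"
proof (induction j arbitrary: i x y)
  case 0
  then show ?case using gcom_lcs by simp
next
  case (Suc j)
  define N where "N = lcs (Suc (i + Suc j))"
  interpret N: normal N G unfolding N_def by (rule lcs_normal)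
  interpret q: group_hom G "G Mod N" "\<lambda>x. N #> x"
    by (rule normal_quotient_hom [OF N.normal_axioms])
  note q_one = normal_quotient_one [OF N.normal_axioms]
  note q_gcom = normal_quotient_gcom [OF N.normal_axioms]
  note q_comm = normal_quotient_commute_iff [OF N.normal_axioms]
  define S where "S = {y \<in> carrier G. \<forall>x \<in> lcs i. gcom G x y \<in> N}"
  have "subgroup S G"
  proof (rule subgroupI)
    show "S \<subseteq> carrier G" by (auto simp: S_def)
    show "S \<noteq> {}" using lcs_carrier by (auto simp: S_def gcom_def intro!: exI [of _ \<one>])
    fix a assume a: "a \<in> S"
    have "gcom G x (inv a) = inv a \<otimes> inv (gcom G x a) \<otimes> a" if "x \<in> lcs i" for x
      using that a lcs_carrier [of x i] by (simp add: S_def gcom_def word_simps)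
    then show "inv a \<in> S"
      using a N.inv_op_closed1 N.m_inv_closed by (simp add: S_def)
    fix b assume b: "b \<in> S"
    have "gcom G x (a \<otimes> b) = gcom G x a \<otimes> (a \<otimes> gcom G x b \<otimes> inv a)" if "x \<in> lcs i" for x
      using that a b lcs_carrier [of x i] by (simp add: S_def gcom_def word_simps)
    then show "a \<otimes> b \<in> S"
      using a b N.inv_op_closed2 N.m_closed by (simp add: S_def)
  qed
  moreover have "gcom G y g \<in> S" if y: "y \<in> lcs j" and g: "g \<in> carrier G" for y g
  proof -
    have "gcom G x (gcom G y g) \<in> N" if x: "x \<in> lcs i" for x
    proof -
      note c = lcs_carrier [OF x] lcs_carrier [OF y] g
      have c': "gcom G x y \<in> carrier G" "gcom G x g \<in> carrier G" "g \<otimes> y \<otimes> inv g \<in> carrier G"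
        using c by auto
      have "gcom (G Mod N) (N #> x) (gcom (G Mod N) (N #> y) (N #> g)) = \<one>\<^bsub>G Mod N\<^esub>"
      proof (rule q.H.gcom_gcom_eq_one)
        show "N #> x \<in> carrier (G Mod N)" "N #> y \<in> carrier (G Mod N)" "N #> g \<in> carrier (G Mod N)"
          using c by (simp_all only: q.hom_closed)
        fix h assume "h \<in> carrier (G Mod N)"
        then obtain k where k: "k \<in> carrier G" "h = N #> k" by (auto simp: carrier_FactGroup)
        have "gcom G (gcom G x y) k \<in> N"
          using gcom_lcs [OF Suc.IH [OF x y] k(1)] by (simp add: N_def)
        then show "gcom (G Mod N) (N #> x) (N #> y) \<otimes>\<^bsub>G Mod N\<^esub> h
            = h \<otimes>\<^bsub>G Mod N\<^esub> gcom (G Mod N) (N #> x) (N #> y)"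
          unfolding k(2) q_gcom [OF c(1,2), symmetric] by (rule iffD1 [OF q_comm [OF c'(1) k(1)]])
      next
        have gy: "g \<otimes> y \<otimes> inv g \<in> lcs j"
          using normal.inv_op_closed2 [OF lcs_normal] g y by blast
        have "gcom G (gcom G x g) (g \<otimes> y \<otimes> inv g) \<in> N"
          using Suc.IH [OF gcom_lcs [OF x g] gy] by (simp add: N_def)
        moreover have eq: "N #> (g \<otimes> y \<otimes> inv g)
            = (N #> g) \<otimes>\<^bsub>G Mod N\<^esub> (N #> y) \<otimes>\<^bsub>G Mod N\<^esub> inv\<^bsub>G Mod N\<^esub> (N #> g)"
          using c by (simp only: q.hom_mult q.hom_inv m_closed inv_closed)
        ultimately show "gcom (G Mod N) (N #> x) (N #> g) \<otimes>\<^bsub>G Mod N\<^esub>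
            ((N #> g) \<otimes>\<^bsub>G Mod N\<^esub> (N #> y) \<otimes>\<^bsub>G Mod N\<^esub> inv\<^bsub>G Mod N\<^esub> (N #> g))
            = ((N #> g) \<otimes>\<^bsub>G Mod N\<^esub> (N #> y) \<otimes>\<^bsub>G Mod N\<^esub> inv\<^bsub>G Mod N\<^esub> (N #> g)) \<otimes>\<^bsub>G Mod N\<^esub>
              gcom (G Mod N) (N #> x) (N #> g)"
          unfolding eq [symmetric] q_gcom [OF c(1,3), symmetric]
          by (intro iffD1 [OF q_comm [OF c'(2,3)]])
      qed
      then show ?thesis
        unfolding q_gcom [OF c(2,3), symmetric] q_gcom [OF c(1) gcom_closed [OF c(2,3)], symmetric]
        by (rule iffD1 [OF q_one [OF gcom_closed [OF c(1) gcom_closed [OF c(2,3)]]]])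
    qed
    then show ?thesis using lcs_carrier [OF y] g by (simp add: S_def)
  qed
  then have "{gcom G x g | x g. x \<in> lcs j \<and> g \<in> carrier G} \<subseteq> S" by blast
  ultimately have "lcs (Suc j) \<subseteq> S"
    unfolding lcs.simps by (intro generate_subgroup_incl)
  then show ?case using Suc.prems by (auto simp: S_def N_def)
qed

text \<open>Truncated subtraction gives the shape F 0 = F 1 = G. If an index is 0, the commutator
  condition is normality; otherwise it is \<open>lcs_gcom\<close>.\<close>

lemma lcs_filtered: "filtered_group G (\<lambda>i. lcs (i - 1))"
proof (intro filtered_group.intro filtered_group_axioms.intro is_group)
  show "subgroup (lcs (i - 1)) G" for i by (rule lcs_subgroup)
  show "lcs (Suc i - 1) \<subseteq> lcs (i - 1)" for i using lcs_dec [of "i - 1"] by (cases i) auto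
  fix x y i j assume x: "x \<in> lcs (i - 1)" and y: "y \<in> lcs (j - 1)"
  show "gcom G x y \<in> lcs (i + j - 1)"
  proof (cases "i = 0 \<or> j = 0")
    case True
    then show ?thesis
      using x y lcs_carrier normal_gcom [OF lcs_normal] by auto
  next
    case False
    then have "Suc (i - 1 + (j - 1)) = i + j - 1" by linarith
    then show ?thesis using lcs_gcom [OF x y] by metis
  qed
qed

section \<open>Finite p-groups: centre and small orders\<close>

lemma finite_prime_power:
  assumes "prime p" "card (carrier G) = p ^ n" shows "finite (carrier G)"
proof (rule card_ge_0_finite)
  have "0 < p ^ n" using prime_gt_0_nat [OF assms(1)] by simp
  then show "0 < card (carrier G)" using assms(2) by simp
qed

lemma prime_power_subgroup:
  assumes "prime p" "card (carrier G) = p ^ n" "subgroup H G"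
  obtains a where "a \<le> n" "card H = p ^ a"
proof -
  have "finite (carrier G)" by (rule finite_prime_power [OF assms(1,2)])
  then have "card H dvd p ^ n"
    unfolding assms(2) [symmetric] order_def [symmetric]
    by (intro dvdI [of _ _ "card (rcosets H)"]) (simp only: lagrange [OF assms(3), symmetric] mult.commute)
  then show ?thesis using that divides_primepow_nat [OF assms(1)] by blast
qed

lemma prime_power_quotient:
  assumes "prime p" "card (carrier G) = p ^ n" "N \<lhd> G" "card N = p ^ a"
  shows "card (carrier (G Mod N)) = p ^ (n - a)"
proof -
  have "finite (carrier G)" by (rule finite_prime_power [OF assms(1,2)])
  then have l: "card (carrier (G Mod N)) * p ^ a = p ^ n"
    using lagrange [OF normal_imp_subgroup [OF assms(3)]] assms(2,4)
    by (simp add: FactGroup_def order_def)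
  then have "p ^ a dvd p ^ n" by (metis dvd_triv_right)
  then have "a \<le> n" using assms(1) by (metis power_dvd_imp_le prime_gt_1_nat)
  then have "p ^ n = p ^ (n - a) * p ^ a" by (metis le_add_diff_inverse2 power_add)
  then show ?thesis using l prime_gt_0_nat [OF assms(1)] by simp
qed

text \<open>Class equation: if the identity were the only singleton class, the other p^n - 1
  elements would split into classes of size divisible by p.\<close>

lemma prime_power_center:
  assumes "prime p" "card (carrier G) = p ^ n" "n > 0"
  shows "\<exists>z \<in> carrier G. z \<noteq> \<one> \<and> (\<forall>x \<in> carrier G. z \<otimes> x = x \<otimes> z)"
proof -
  interpret act: group_action G "carrier G" "\<lambda>g. \<lambda>h \<in> carrier G. g \<otimes> h \<otimes> inv g"
    by (rule action_by_conjugation)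
  let ?c = "\<lambda>g. \<lambda>h \<in> carrier G. g \<otimes> h \<otimes> inv g"
  have fin: "finite (carrier G)" by (rule finite_prime_power [OF assms(1,2)])
  have central: "z \<otimes> x = x \<otimes> z"
    if z: "z \<in> carrier G" and o: "orbit G ?c z = {z}" and x: "x \<in> carrier G" for x z
  proof -
    have "x \<otimes> z \<otimes> inv x \<in> orbit G ?c z" unfolding orbit_def using x z by auto
    then have "x \<otimes> z \<otimes> inv x = z" using o by simp
    then have "x \<otimes> z \<otimes> inv x \<otimes> x = z \<otimes> x" by simp
    then show ?thesis using x z by (simp add: m_assoc)
  qed
  have self: "z \<in> orbit G ?c z" if "z \<in> carrier G" for z
    using that act.orbit_refl by blast
  have orb1: "orbit G ?c \<one> = {\<one>}"
    unfolding orbit_def by (auto intro!: exI [of _ \<one>])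
  have "\<exists>z \<in> carrier G - {\<one>}. orbit G ?c z = {z}"
  proof (rule ccontr)
    assume neg: "\<not> ?thesis"
    let ?C = "orbits G (carrier G) ?c - {{\<one>}}"
    have disj: "\<forall>c1\<in>?C. \<forall>c2\<in>?C. c1 \<noteq> c2 \<longrightarrow> c1 \<inter> c2 = {}"
      using act.disjoint_union by blast
    have "{\<one>} \<in> orbits G (carrier G) ?c" unfolding orbits_def using orb1 by force
    then have one_notin: "\<one> \<notin> \<Union> ?C" using act.disjoint_union by blast
    have U: "\<Union> ?C = carrier G - {\<one>}"
      using one_notin act.orbits_coverture by auto
    have dv: "p dvd card c" if c: "c \<in> ?C" for c
    proof -
      obtain z where z: "z \<in> carrier G" "c = orbit G ?c z" using c unfolding orbits_def by auto
      have "card c dvd p ^ n"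
        unfolding z(2) assms(2) [symmetric] order_def [symmetric]
        by (rule dvdI [OF act.orbit_stabilizer_theorem [OF z(1), symmetric]])
      then obtain i where i: "card c = p ^ i" using divides_primepow_nat [OF assms(1)] by blast
      have "i \<noteq> 0"
      proof
        assume "i = 0"
        then have "card c = 1" using i by simp
        then obtain w where "c = {w}" by (rule card_1_singletonE)
        then have "c = {z}" using self [OF z(1)] z(2) by simp
        then show False using neg z c orb1 by auto
      qed
      then show ?thesis using i by (simp add: dvd_power)
    qed
    have "p dvd card (\<Union> ?C)"
      by (rule dvd_partition) (use disj dv U fin in auto)
    then have "p dvd p ^ n - 1" using U fin assms(2) by simp
    moreover have "p dvd p ^ n" using assms(3) by (simp add: dvd_power)
    ultimately have "p dvd 1"
      using dvd_diffD1 [of p "p ^ n" 1] prime_ge_1_nat [OF assms(1)] by simp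
    then show False using assms(1) by simp
  qed
  then obtain z where z: "z \<in> carrier G" "z \<noteq> \<one>" "orbit G ?c z = {z}" by blast
  then have "\<forall>x \<in> carrier G. z \<otimes> x = x \<otimes> z" using central [OF z(1,3)] by blast
  then show ?thesis using z(1,2) by blast
qed

definition centralizer :: "'a set \<Rightarrow> 'a set" where
  "centralizer S = {z \<in> carrier G. \<forall>x \<in> S. z \<otimes> x = x \<otimes> z}"

lemma centralizer_subgroup: assumes "S \<subseteq> carrier G" shows "subgroup (centralizer S) G"
proof (rule subgroupI)
  show "centralizer S \<subseteq> carrier G" by (auto simp: centralizer_def)
  have "\<one> \<in> centralizer S" using assms by (auto simp: centralizer_def)
  then show "centralizer S \<noteq> {}" by blast
  fix a assume a: "a \<in> centralizer S"
  have "inv a \<otimes> x = x \<otimes> inv a" if "x \<in> S" for x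
  proof -
    have c: "a \<in> carrier G" "x \<in> carrier G" "a \<otimes> x = x \<otimes> a" using a that assms by (auto simp: centralizer_def)
    have "x \<otimes> inv a = inv a \<otimes> (a \<otimes> x) \<otimes> inv a" using c(1,2) by (simp add: word_simps)
    also have "\<dots> = inv a \<otimes> x" unfolding c(3) using c(1,2) by (simp add: word_simps)
    finally show ?thesis by simp
  qed
  then show "inv a \<in> centralizer S" using a by (simp add: centralizer_def)
  fix b assume b: "b \<in> centralizer S"
  have "a \<otimes> b \<otimes> x = x \<otimes> (a \<otimes> b)" if x: "x \<in> S" for x
  proof -
    have c: "a \<in> carrier G" "b \<in> carrier G" "x \<in> carrier G" "a \<otimes> x = x \<otimes> a" "b \<otimes> x = x \<otimes> b"
      using a b x assms by (auto simp: centralizer_def)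
    have "a \<otimes> b \<otimes> x = a \<otimes> x \<otimes> b" using c(1-3) by (simp add: m_assoc c(5))
    then show ?thesis using c(1-3) by (simp add: m_assoc c(4))
  qed
  then show "a \<otimes> b \<in> centralizer S" using a b by (simp add: centralizer_def)
qed

text \<open>A noncentral x would give a strict chain 1 < Z(G) < C(x) < G of subgroups, and hence n
  \<ge> 3.\<close>

lemma prime_power_le_2_comm:
  assumes p: "prime p" and card: "card (carrier G) = p ^ n" and "n \<le> 2"
    and x: "x \<in> carrier G" and y: "y \<in> carrier G"
  shows "x \<otimes> y = y \<otimes> x"
proof (rule ccontr)
  assume ne: "x \<otimes> y \<noteq> y \<otimes> x"
  have fin: "finite (carrier G)" by (rule finite_prime_power [OF p card])
  define Z where "Z = centralizer (carrier G)"
  define C where "C = centralizer {x}"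
  have Z: "subgroup Z G" and C: "subgroup C G"
    unfolding Z_def C_def using x by (simp_all add: centralizer_subgroup)
  have "n > 0"
  proof (rule ccontr)
    assume "\<not> n > 0"
    then have "card (carrier G) = 1" using card by simp
    then obtain w where "carrier G = {w}" by (rule card_1_singletonE)
    then show False using ne x y by simp
  qed
  then obtain z where z: "z \<in> Z" "z \<noteq> \<one>"
    using prime_power_center [OF p card] unfolding Z_def centralizer_def by blast
  obtain a where a: "card Z = p ^ a" by (rule prime_power_subgroup [OF p card Z])
  obtain b where b: "b \<le> n" "card C = p ^ b" by (rule prime_power_subgroup [OF p card C])
  have "a \<noteq> 0"
  proof
    assume "a = 0"
    then have "card Z = 1" using a by simp
    then obtain w where "Z = {w}" by (rule card_1_singletonE)
    then show False using z subgroup.one_closed [OF Z] by simp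
  qed
  moreover have "Z \<subset> C"
    using x y ne by (auto simp: Z_def C_def centralizer_def)
  then have "card Z < card C"
    by (intro psubset_card_mono) (use fin subgroup.subset [OF C] in \<open>auto intro: finite_subset\<close>)
  then have "a < b" using a b prime_gt_1_nat [OF p] by simp
  ultimately have "b = n" using b \<open>n \<le> 2\<close> by linarith
  then have "C = carrier G"
    using b card fin subgroup.subset [OF C] by (intro card_subset_eq) auto
  then have "y \<in> C" using y by simp
  then show False using ne by (simp add: C_def centralizer_def)
qed

section \<open>The upper central series and the bound on the nilpotency class\<close>

primrec ucs :: "nat \<Rightarrow> 'a set" where
  "ucs 0 = {\<one>}"
| "ucs (Suc i) = {g \<in> carrier G. \<forall>x \<in> carrier G. gcom G g x \<in> ucs i}"

lemma ucs_normal: "ucs i \<lhd> G"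
proof (induction i)
  case 0
  then show ?case by (simp add: one_is_normal)
next
  case (Suc i)
  interpret N: normal "ucs i" G by fact
  have sub: "subgroup (ucs (Suc i)) G"
  proof (rule subgroupI)
    show "ucs (Suc i) \<subseteq> carrier G" by auto
    show "ucs (Suc i) \<noteq> {}" by (auto simp: gcom_def intro!: exI [of _ \<one>])
    fix a assume a: "a \<in> ucs (Suc i)"
    have "gcom G (inv a) x = inv a \<otimes> inv (gcom G a x) \<otimes> a" if "x \<in> carrier G" for x
      using that a by (simp add: gcom_def word_simps)
    then show "inv a \<in> ucs (Suc i)"
      using a N.inv_op_closed1 N.m_inv_closed by simp
    fix b assume b: "b \<in> ucs (Suc i)"
    have "gcom G (a \<otimes> b) x = (a \<otimes> gcom G b x \<otimes> inv a) \<otimes> gcom G a x" if "x \<in> carrier G" for x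
      using that a b by (simp add: gcom_def word_simps)
    then show "a \<otimes> b \<in> ucs (Suc i)"
      using a b N.inv_op_closed2 N.m_closed by simp
  qed
  have "a \<otimes> h \<otimes> inv a \<in> ucs (Suc i)" if h: "h \<in> ucs (Suc i)" and a: "a \<in> carrier G" for a h
  proof -
    have "gcom G (a \<otimes> h \<otimes> inv a) x \<in> ucs i" if x: "x \<in> carrier G" for x
    proof -
      have "gcom G (a \<otimes> h \<otimes> inv a) x = a \<otimes> gcom G h (inv a \<otimes> x \<otimes> a) \<otimes> inv a"
        using h a x by (simp add: gcom_def word_simps)
      then show ?thesis using h a x N.inv_op_closed2 by auto
    qed
    then show ?thesis using h a by auto
  qed
  then show ?case using sub by (simp add: normal_inv_iff)
qed

text \<open>A term that is not yet G grows at least by a factor p, since the quotient has a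
  nontrivial centre.\<close>

lemma ucs_card:
  assumes p: "prime p" and card: "card (carrier G) = p ^ n"
  shows "i \<le> n \<Longrightarrow> \<exists>a \<ge> i. card (ucs i) = p ^ a"
proof (induction i)
  case 0
  then show ?case by (intro exI [of _ 0]) simp
next
  case (Suc i)
  have fin: "finite (carrier G)" by (rule finite_prime_power [OF p card])
  obtain a where a: "i \<le> a" "card (ucs i) = p ^ a" using Suc by auto
  obtain b where b: "b \<le> n" "card (ucs (Suc i)) = p ^ b"
    using prime_power_subgroup [OF p card normal_imp_subgroup [OF ucs_normal]] by blast
  note N = ucs_normal [of i]
  have sub: "ucs i \<subseteq> ucs (Suc i)"
    using normal_gcom [OF N] subgroup.mem_carrier [OF normal_imp_subgroup [OF N]] by auto
  show ?case
  proof (cases "ucs i = carrier G")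
    case True
    then have "ucs (Suc i) = carrier G" by auto
    then show ?thesis using card Suc.prems by auto
  next
    case False
    have "card (ucs i) < card (carrier G)"
      using False subgroup.subset [OF normal_imp_subgroup [OF N]] fin
      by (intro psubset_card_mono) auto
    then have "a < n" using a card prime_gt_1_nat [OF p] by simp
    interpret q: group_hom G "G Mod ucs i" "\<lambda>x. ucs i #> x" by (rule normal_quotient_hom [OF N])
    obtain z where z: "z \<in> carrier (G Mod ucs i)" "z \<noteq> \<one>\<^bsub>G Mod ucs i\<^esub>"
        "\<forall>x \<in> carrier (G Mod ucs i). z \<otimes>\<^bsub>G Mod ucs i\<^esub> x = x \<otimes>\<^bsub>G Mod ucs i\<^esub> z"
      using q.H.prime_power_center [OF p prime_power_quotient [OF p card N a(2)]]
        zero_less_diff [THEN iffD2, OF \<open>a < n\<close>] by blast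
    obtain g where g: "g \<in> carrier G" "z = ucs i #> g" using z(1) by (auto simp: carrier_FactGroup)
    have "gcom G g x \<in> ucs i" if x: "x \<in> carrier G" for x
      using z(3) normal_quotient_commute_iff [OF N g(1) x] q.hom_closed [OF x] g(2) by blast
    then have "g \<in> ucs (Suc i)" using g(1) by simp
    moreover have "g \<notin> ucs i" using normal_quotient_one [OF N g(1)] z(2) g(2) by simp
    ultimately have "ucs i \<subset> ucs (Suc i)" using sub by blast
    then have "card (ucs i) < card (ucs (Suc i))"
      by (rule psubset_card_mono [rotated]) (use fin in auto)
    then have "a < b" using a b prime_gt_1_nat [OF p] by simp
    then show ?thesis using a b by (intro exI [of _ b]) auto
  qed
qed

lemma lcs_Suc_0_eq: "lcs (Suc 0) = derived G (carrier G)"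
  unfolding derived_def lcs.simps gcom_def by (rule arg_cong [of _ _ "generate G"]) blast

text \<open>The quotient by \<open>ucs (n - 2)\<close> has order at most p^2, also when the index is
  truncated to 0, and is therefore abelian. Each further commutator descends one term of the upper
  series.\<close>

lemma lcs_subset_ucs:
  assumes p: "prime p" and card: "card (carrier G) = p ^ n"
  shows "lcs (Suc j) \<subseteq> ucs (n - 2 - j)"
proof (induction j)
  case 0
  note N = ucs_normal [of "n - 2"]
  obtain a where a: "n - 2 \<le> a" "card (ucs (n - 2)) = p ^ a"
    using ucs_card [OF p card, of "n - 2"] by auto
  interpret q: group_hom G "G Mod ucs (n - 2)" "\<lambda>x. ucs (n - 2) #> x"
    by (rule normal_quotient_hom [OF N])
  have "n - a \<le> 2" using a(1) by linarith
  then have "gcom G x y \<in> ucs (n - 2)" if "x \<in> carrier G" "y \<in> carrier G" for x y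
    using q.H.prime_power_le_2_comm [OF p prime_power_quotient [OF p card N a(2)] _
        q.hom_closed [OF that(1)] q.hom_closed [OF that(2)]]
      normal_quotient_commute_iff [OF N that] by blast
  then show ?case
    unfolding lcs.simps by (intro generate_subgroup_incl) (auto intro: normal_imp_subgroup [OF N])
next
  case (Suc j)
  note N = ucs_normal [of "n - 2 - Suc j"]
  have "gcom G x g \<in> ucs (n - 2 - Suc j)" if x: "x \<in> lcs (Suc j)" and g: "g \<in> carrier G" for x g
  proof (cases "n - 2 - j")
    case 0
    then have "x = \<one>" using Suc.IH x by auto
    then show ?thesis using g subgroup.one_closed [OF normal_imp_subgroup [OF N]]
      by (simp add: gcom_def)
  next
    case (Suc k)
    then have "n - 2 - Suc j = k" by simp
    then show ?thesis using Suc.IH x g Suc by auto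
  qed
  then show ?case
    unfolding lcs.simps(2) [of "Suc j"]
    by (intro generate_subgroup_incl normal_imp_subgroup [OF N]) auto
qed

text \<open>Here n \<le> p enters: for j = p - 2 the index n - 2 - j is 0. The boundary case n = p
  relies on the start at \<open>ucs (n - 2)\<close>, that is, on groups of order p^2 being
  abelian.\<close>

lemma lcs_trivial:
  assumes p: "prime p" and card: "card (carrier G) = p ^ n" and "n \<le> p"
  shows "lcs (p - 1) = {\<one>}"
proof -
  obtain j where j: "p - 1 = Suc j" using prime_ge_2_nat [OF p] by (cases "p - 1") auto
  have "n - 2 - j = 0" using j \<open>n \<le> p\<close> by linarith
  then have "lcs (p - 1) \<subseteq> {\<one>}" using lcs_subset_ucs [OF p card, of j] j by simp
  then show ?thesis using subgroup.one_closed [OF lcs_subgroup] by blast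
qed

section \<open>The p-th power map as a central endomorphism\<close>

lemma prime_pow_hom:
  assumes p: "prime p" and card: "card (carrier G) = p ^ n" and "n \<le> p"
    and ex: "exp_divides G (derived G (carrier G)) p"
    and x: "x \<in> carrier G" and y: "y \<in> carrier G"
  shows "(x \<otimes> y) [^] p = x [^] p \<otimes> y [^] p"
proof -
  interpret filtered_group G "\<lambda>i. lcs (i - 1)" by (rule lcs_filtered)
  show ?thesis
  proof (rule pow_mult_prime [OF p _ _ _ x y])
    show "lcs (1 - 1) = carrier G" by simp
    show "lcs (p - 1) = {\<one>}" by (rule lcs_trivial [OF p card \<open>n \<le> p\<close>])
    have "lcs (2 - 1) = derived G (carrier G)" using lcs_Suc_0_eq by simp
    then show "z [^] p = \<one>" if "z \<in> lcs (2 - 1)" for z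
      using that ex unfolding exp_divides_def by blast
  qed
qed

text \<open>Applied to the factorisation [x, y] = x (y x^-1 y^-1), the homomorphism property of the
  p-th power turns [x, y]^p, which is trivial, into [x^p, y].\<close>

lemma prime_pow_central:
  assumes p: "prime p" and card: "card (carrier G) = p ^ n" and "n \<le> p"
    and ex: "exp_divides G (derived G (carrier G)) p"
    and x: "x \<in> carrier G" and y: "y \<in> carrier G"
  shows "x [^] p \<otimes> y = y \<otimes> x [^] p"
proof -
  note hom = prime_pow_hom [OF p card \<open>n \<le> p\<close> ex]
  have conj: "(y \<otimes> inv x \<otimes> inv y) [^] k = y \<otimes> inv x [^] k \<otimes> inv y" for k :: nat
    using x y by (induction k) (auto simp: word_simps)
  have "gcom G x y [^] p = \<one>"
    using ex gcom_in_derived [OF x y] by (simp add: exp_divides_def)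
  moreover have "gcom G x y = x \<otimes> (y \<otimes> inv x \<otimes> inv y)"
    using x y by (simp add: gcom_def m_assoc)
  ultimately have "x [^] p \<otimes> (y \<otimes> inv x [^] p \<otimes> inv y) = \<one>"
    using x y hom [of x "y \<otimes> inv x \<otimes> inv y"] by (simp add: conj)
  then have "gcom G (x [^] p) y = \<one>"
    using x y by (simp add: gcom_def m_assoc nat_pow_inv)
  then show ?thesis using x y gcom_eq_one_iff by simp
qed

end

section \<open>Jordan bases of finite abelian groups with a nilpotent endomorphism\<close>

text \<open>The linear map from integer vectors to A given by a family, in multiplicative notation.
  Vectors are functions on all natural numbers, of which only the entries below the length
  count.\<close>

primrec ev :: "('a, 'b) monoid_scheme \<Rightarrow> (nat \<Rightarrow> 'a) \<Rightarrow> nat \<Rightarrow> (nat \<Rightarrow> int) \<Rightarrow> 'a" where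
  "ev A a 0 m = \<one>\<^bsub>A\<^esub>"
| "ev A a (Suc l) m = ev A a l m \<otimes>\<^bsub>A\<^esub> a l [^]\<^bsub>A\<^esub> m l"

lemma ev_cong: "(\<And>l. l < N \<Longrightarrow> a l = b l) \<Longrightarrow> (\<And>l. l < N \<Longrightarrow> m l = m' l) \<Longrightarrow> ev A a N m = ev A b N m'"
  by (induction N) auto

context comm_group
begin

lemma ev_closed [simp]: "(\<And>l. a l \<in> carrier G) \<Longrightarrow> ev G a N m \<in> carrier G"
  by (induction N) auto

lemma ev_mem_subgroup:
  assumes "subgroup B G" "\<And>l. l < N \<Longrightarrow> a l \<in> B" shows "ev G a N m \<in> B"
  using assms(2)
proof (induction N)
  case 0
  then show ?case by (simp add: subgroup.one_closed [OF assms(1)])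
next
  case (Suc N)
  have "a N [^] m N \<in> B" using subgroup_int_pow_closed [OF assms(1)] Suc.prems by simp
  then show ?case using Suc by (simp add: subgroup.m_closed [OF assms(1)])
qed

lemma ev_zero [simp]: "ev G a N (\<lambda>l. 0) = \<one>"
  by (induction N) auto

lemma ev_add:
  assumes "\<And>l. a l \<in> carrier G"
  shows "ev G a N (\<lambda>l. m l + m' l) = ev G a N m \<otimes> ev G a N m'"
  using assms by (induction N) (simp_all add: int_pow_mult m_ac)

lemma ev_scale:
  assumes "\<And>l. a l \<in> carrier G"
  shows "ev G a N (\<lambda>l. c * m l) = ev G a N m [^] c"
  using assms by (induction N) (simp_all add: int_pow_distrib int_pow_pow mult.commute)

lemma ev_minus:
  assumes "\<And>l. a l \<in> carrier G"
  shows "ev G a N (\<lambda>l. - m l) = inv (ev G a N m)"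
  using ev_scale [of a N "-1" m] assms by (simp add: int_pow_neg)

lemma ev_diff:
  assumes "\<And>l. a l \<in> carrier G"
  shows "ev G a N (\<lambda>l. m l - m' l) = ev G a N m \<otimes> inv (ev G a N m')"
  using ev_add [of a N m "\<lambda>l. - m' l"] assms by (simp add: ev_minus)

lemma ev_append:
  assumes "\<And>l. a l \<in> carrier G"
  shows "ev G a (N + k) m = ev G a N m \<otimes> ev G (\<lambda>j. a (N + j)) k (\<lambda>j. m (N + j))"
  using assms by (induction k) (simp_all add: m_assoc)

lemma ev_front:
  assumes "\<And>l. a l \<in> carrier G"
  shows "ev G a (Suc k) m = a 0 [^] m 0 \<otimes> ev G (\<lambda>j. a (Suc j)) k (\<lambda>j. m (Suc j))"
  using ev_append [of a 1 k m] assms by simp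

lemma ev_unit:
  assumes "\<And>l. a l \<in> carrier G" "i < N"
  shows "ev G a N (\<lambda>l. if l = i then c else 0) = a i [^] c"
  using assms(2)
proof (induction N)
  case (Suc N)
  show ?case
  proof (cases "i = N")
    case True
    have "ev G a N (\<lambda>l. if l = i then c else 0) = ev G a N (\<lambda>l. 0)"
      by (rule ev_cong) (use True in auto)
    then show ?thesis using True assms by simp
  next
    case False
    then show ?thesis using Suc assms by simp
  qed
qed simp

lemma ev_hom:
  assumes "comm_group H" "h \<in> hom G H" "\<And>l. a l \<in> carrier G"
  shows "h (ev G a N m) = ev H (\<lambda>l. h (a l)) N m"
proof -
  interpret H: comm_group H by fact
  interpret group_hom G H h
    by (intro group_hom.intro group_hom_axioms.intro is_group H.is_group assms(2))
  show ?thesis using assms(3) by (induction N) (simp_all add: hom_int_pow)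
qed

end

text \<open>For \<open>e = 0\<close> this is an F_p[t]-module with t nilpotent, for
  \<open>e = 1\<close> an abelian p-group with t acting as the p-th power. Jordan forms of the
  former and cyclic decompositions of the latter are thus treated at once.\<close>

locale nilpotent_endo = comm_group A for A (structure) +
  fixes \<phi> :: "'a \<Rightarrow> 'a" and p e n :: nat
  assumes fin: "finite (carrier A)" and p: "prime p" and phi_hom: "\<phi> \<in> hom A A"
    and phi_nil: "\<And>a. a \<in> carrier A \<Longrightarrow> (\<phi> ^^ n) a = \<one>"
    and phi_pow: "\<And>a. a \<in> carrier A \<Longrightarrow> a [^] p = \<phi> a [^] e"
begin

sublocale phi: group_hom A A \<phi>
  by (intro group_hom.intro group_hom_axioms.intro is_group phi_hom)

lemma funpow_closed [simp]: "x \<in> carrier A \<Longrightarrow> (\<phi> ^^ j) x \<in> carrier A"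
  by (induction j) auto

lemma funpow_hom: "(\<phi> ^^ j) \<in> hom A A"
proof (rule homI)
  fix x y assume "x \<in> carrier A" "y \<in> carrier A"
  then show "(\<phi> ^^ j) (x \<otimes> y) = (\<phi> ^^ j) x \<otimes> (\<phi> ^^ j) y" by (induction j) simp_all
qed simp

lemma funpow_one [simp]: "(\<phi> ^^ j) \<one> = \<one>"
  by (induction j) auto

abbreviation cyc :: "'a \<Rightarrow> nat \<Rightarrow> (nat \<Rightarrow> int) \<Rightarrow> 'a" where
  "cyc x k m \<equiv> ev A (\<lambda>j. (\<phi> ^^ j) x) k m"

lemma int_pow_p_one:
  assumes y: "y \<in> carrier A" and yp: "y [^] p = \<one>" and c: "y [^] (c::int) = \<one>" and "y \<noteq> \<one>"
  shows "int p dvd c"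
proof (rule ccontr)
  assume "\<not> int p dvd c"
  then have "coprime c (int p)"
    using p by (metis coprime_commute prime_imp_coprime prime_nat_int_transfer)
  then obtain u v where uv: "u * c + v * int p = 1" using bezout_int [of c "int p"] by auto
  have "y = y [^] (u * c + v * int p)" using y by (simp add: uv)
  also have "\<dots> = (y [^] c) [^] u \<otimes> (y [^] p) [^] v"
    using y by (simp add: int_pow_mult int_pow_pow mult.commute int_pow_int [symmetric] del: int_pow_int)
  finally show False using c yp \<open>y \<noteq> \<one>\<close> by simp
qed

lemma cyc_top:
  assumes x: "x \<in> carrier A" and x1: "(\<phi> ^^ Suc k) x = \<one>"
  shows "(\<phi> ^^ k) (cyc x (Suc k) m) = (\<phi> ^^ k) x [^] m 0"
proof -
  have "(\<phi> ^^ k) (cyc x (Suc k) m) = ev A (\<lambda>j. (\<phi> ^^ k) ((\<phi> ^^ j) x)) (Suc k) m"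
    by (rule ev_hom [OF comm_group_axioms funpow_hom]) (use x in simp)
  also have "\<dots> = (\<phi> ^^ k) x [^] m 0 \<otimes>
      ev A (\<lambda>j. (\<phi> ^^ k) ((\<phi> ^^ Suc j) x)) k (\<lambda>j. m (Suc j))"
    using x by (subst ev_front) simp_all
  also have "ev A (\<lambda>j. (\<phi> ^^ k) ((\<phi> ^^ Suc j) x)) k (\<lambda>j. m (Suc j)) = \<one>"
  proof -
    have triv: "(\<phi> ^^ k) ((\<phi> ^^ Suc j) x) \<in> {\<one>}" for j
    proof -
      have "(\<phi> ^^ k) ((\<phi> ^^ Suc j) x) = (\<phi> ^^ (j + Suc k)) x"
        unfolding funpow_add [of k "Suc j", unfolded comp_def, THEN fun_cong, symmetric]
        by (simp add: add.commute)
      also have "\<dots> = (\<phi> ^^ j) ((\<phi> ^^ Suc k) x)"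
        unfolding funpow_add comp_def by (rule refl)
      finally show ?thesis using x1 by simp
    qed
    have "ev A (\<lambda>j. (\<phi> ^^ k) ((\<phi> ^^ Suc j) x)) k (\<lambda>j. m (Suc j)) \<in> {\<one>}"
      by (rule ev_mem_subgroup [OF triv_subgroup triv])
    then show ?thesis by simp
  qed
  finally show ?thesis using x by simp
qed

text \<open>The last nontrivial element \<open>(\<phi> ^^ k) x\<close> of the chain has order p,
  since its p-th power is a power of \<open>(\<phi> ^^ Suc k) x\<close>. All later terms die under
  \<open>\<phi> ^^ k\<close>, so p divides \<open>m 0\<close>, and p-th powers of x are traded for
  powers of \<open>\<phi> x\<close> by \<open>phi_pow\<close>.\<close>

lemma cyc_head:
  assumes x: "x \<in> carrier A" and k: "(\<phi> ^^ Suc k) x = \<one>" "(\<phi> ^^ k) x \<noteq> \<one>"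
    and m: "(\<phi> ^^ k) (cyc x (Suc k) m) = \<one>"
  obtains w where "m 0 = int p * w" "x [^] m 0 = \<phi> x [^] (int e * w)"
proof -
  have y: "(\<phi> ^^ k) x \<in> carrier A" using x by simp
  have "(\<phi> ^^ k) x [^] m 0 = \<one>" using cyc_top [OF x k(1)] m by simp
  moreover have "(\<phi> ^^ k) x [^] p = \<one>" using phi_pow [OF y] k(1) by simp
  ultimately have "int p dvd m 0" using int_pow_p_one [OF y _ _ k(2)] by blast
  then obtain w where w: "m 0 = int p * w" by blast
  have "x [^] m 0 = (x [^] p) [^] w"
    using x w by (simp add: int_pow_pow int_pow_int [symmetric] del: int_pow_int)
  also have "\<dots> = \<phi> x [^] (int e * w)"
    using x phi_pow [OF x] by (simp add: int_pow_pow int_pow_int [symmetric] del: int_pow_int)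
  finally show ?thesis using w that by blast
qed

text \<open>By \<open>cyc_head\<close> the constant coefficient of a relation is p w_0; trading x^p
  for a power of \<open>\<phi> x\<close> leaves a relation on the chain of \<open>\<phi> x\<close>,
  which is shorter by one. In polynomial terms, relations are multiples of p - e t modulo
  t^k.\<close>

lemma cyc_kernel:
  assumes "x \<in> carrier A" "(\<phi> ^^ k) x = \<one>" "k > 0 \<Longrightarrow> (\<phi> ^^ (k - 1)) x \<noteq> \<one>" "cyc x k m = \<one>"
  shows "\<exists>w. \<forall>j<k. m j = int p * w j - int e * (if j = 0 then 0 else w (j - 1))"
  using assms
proof (induction k arbitrary: x m)
  case (Suc k)
  note x = Suc.prems(1)
  have y: "(\<phi> ^^ k) x \<noteq> \<one>" using Suc.prems(3) by simp
  have "(\<phi> ^^ k) (cyc x (Suc k) m) = \<one>" unfolding Suc.prems(4) by simp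
  then obtain w0 where w0: "m 0 = int p * w0" and x0: "x [^] m 0 = \<phi> x [^] (int e * w0)"
    by (rule cyc_head [OF x Suc.prems(2) y])
  define m' where "m' = (\<lambda>j. m (Suc j) + (if j = 0 then int e * w0 else 0))"
  have sw: "(\<lambda>j. (\<phi> ^^ Suc j) x) = (\<lambda>j. (\<phi> ^^ j) (\<phi> x))"
    by (simp add: funpow_swap1)
  have one: "\<phi> x [^] (int e * w0) \<otimes> cyc (\<phi> x) k (\<lambda>j. m (Suc j)) = \<one>"
    using Suc.prems(4) ev_front [of "\<lambda>j. (\<phi> ^^ j) x" k m] x x0 sw by simp
  have "cyc (\<phi> x) k m' = \<one>"
  proof (cases "k = 0")
    case False
    have "cyc (\<phi> x) k m' = cyc (\<phi> x) k (\<lambda>j. m (Suc j)) \<otimes> cyc (\<phi> x) k (\<lambda>j. if j = 0 then int e * w0 else 0)"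
      unfolding m'_def by (rule ev_add) (use x in simp)
    also have "cyc (\<phi> x) k (\<lambda>j. if j = 0 then int e * w0 else 0) = \<phi> x [^] (int e * w0)"
      using False x by (subst ev_unit) auto
    finally show ?thesis using one x by (simp add: m_comm)
  qed simp
  moreover have "(\<phi> ^^ k) (\<phi> x) = \<one>" using Suc.prems(2) by (simp add: funpow_swap1)
  moreover have "(\<phi> ^^ (k - 1)) (\<phi> x) \<noteq> \<one>" if "k > 0"
    using y that by (cases k) (auto simp: funpow_swap1)
  ultimately obtain w where w: "\<forall>j<k. m' j = int p * w j - int e * (if j = 0 then 0 else w (j - 1))"
    using Suc.IH [of "\<phi> x" m'] x by auto
  define w' where "w' = (\<lambda>j. case j of 0 \<Rightarrow> w0 | Suc j \<Rightarrow> w j)"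
  have "m j = int p * w' j - int e * (if j = 0 then 0 else w' (j - 1))" if "j < Suc k" for j
  proof (cases j)
    case 0
    then show ?thesis using w0 by (simp add: w'_def)
  next
    case (Suc i)
    then have "m' i = int p * w i - int e * (if i = 0 then 0 else w (i - 1))" using w that by simp
    then show ?thesis using Suc by (cases i) (auto simp: w'_def m'_def)
  qed
  then show ?case by blast
qed auto

section \<open>Splitting off a cyclic submodule\<close>

definition phi_sub :: "'a set \<Rightarrow> bool" where
  "phi_sub B \<longleftrightarrow> subgroup B A \<and> (\<forall>b \<in> B. \<phi> b \<in> B)"

lemma phi_sub_funpow: "phi_sub B \<Longrightarrow> b \<in> B \<Longrightarrow> (\<phi> ^^ j) b \<in> B"
  by (induction j) (auto simp: phi_sub_def)

lemma cyc_phi: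
  assumes x: "x \<in> carrier A" and "(\<phi> ^^ k) x = \<one>"
  shows "\<phi> (cyc x k m) = cyc x k (\<lambda>j. if j = 0 then 0 else m (j - 1))"
proof -
  have "\<phi> (cyc x k m) = ev A (\<lambda>j. (\<phi> ^^ Suc j) x) k m"
    by (subst ev_hom [OF comm_group_axioms phi_hom]) (use x in simp_all)
  also have "\<dots> = cyc x (Suc k) (\<lambda>j. if j = 0 then 0 else m (j - 1))"
    using x by (subst ev_front) simp_all
  also have "\<dots> = cyc x k (\<lambda>j. if j = 0 then 0 else m (j - 1))"
    using assms by simp
  finally show ?thesis .
qed

lemma phi_sub_cyc:
  assumes x: "x \<in> carrier A" and "(\<phi> ^^ k) x = \<one>"
  shows "phi_sub (range (cyc x k))"
  unfolding phi_sub_def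
proof
  have "subgroup (range (cyc x k)) A"
  proof (rule subgroupI)
    show "range (cyc x k) \<subseteq> carrier A" using x by auto
    show "range (cyc x k) \<noteq> {}" by blast
    fix a assume a: "a \<in> range (cyc x k)"
    then obtain m where m: "a = cyc x k m" by blast
    have "inv a = cyc x k (\<lambda>j. - m j)" using m x by (simp add: ev_minus)
    then show "inv a \<in> range (cyc x k)" by blast
    fix b assume b: "b \<in> range (cyc x k)"
    then obtain m' where m': "b = cyc x k m'" by blast
    have "a \<otimes> b = cyc x k (\<lambda>j. m j + m' j)" using m m' x by (simp add: ev_add)
    then show "a \<otimes> b \<in> range (cyc x k)" by blast
  qed
  then show "subgroup (range (cyc x k)) A" .
  show "\<forall>b \<in> range (cyc x k). \<phi> b \<in> range (cyc x k)"
    using cyc_phi [OF assms] by auto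
qed

text \<open>Trading the leading term for a power of \<open>\<phi> x\<close> leaves only terms in the
  image of \<open>\<phi>\<close>. In \<open>phi_sub_split\<close> this allows an element outside the
  sum to be corrected: in a chain of length k + 1, being killed by t^k means being divisible by
  t.\<close>

lemma cyc_image:
  assumes x: "x \<in> carrier A" and k: "(\<phi> ^^ Suc k) x = \<one>" "(\<phi> ^^ k) x \<noteq> \<one>"
    and m: "(\<phi> ^^ k) (cyc x (Suc k) m) = \<one>"
  shows "\<exists>m'. cyc x (Suc k) m = \<phi> (cyc x (Suc k) m')"
proof -
  obtain w0 where x0: "x [^] m 0 = \<phi> x [^] (int e * w0)" by (rule cyc_head [OF assms])
  define m' where "m' = (\<lambda>j. m (Suc j) + (if j = 0 then int e * w0 else 0))"
  have "\<phi> (cyc x (Suc k) m') = ev A (\<lambda>j. (\<phi> ^^ Suc j) x) (Suc k) m'"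
    by (subst ev_hom [OF comm_group_axioms phi_hom]) (use x in simp_all)
  also have "\<dots> = ev A (\<lambda>j. (\<phi> ^^ Suc j) x) (Suc k) (\<lambda>j. m (Suc j)) \<otimes>
      ev A (\<lambda>j. (\<phi> ^^ Suc j) x) (Suc k) (\<lambda>j. if j = 0 then int e * w0 else 0)"
    unfolding m'_def by (rule ev_add) (use x in simp)
  also have "ev A (\<lambda>j. (\<phi> ^^ Suc j) x) (Suc k) (\<lambda>j. if j = 0 then int e * w0 else 0)
      = \<phi> x [^] (int e * w0)"
    using x by (subst ev_unit) simp_all
  also have "ev A (\<lambda>j. (\<phi> ^^ Suc j) x) (Suc k) (\<lambda>j. m (Suc j))
      = ev A (\<lambda>j. (\<phi> ^^ Suc j) x) k (\<lambda>j. m (Suc j))"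
    using x k(1) by simp
  also have "\<dots> \<otimes> \<phi> x [^] (int e * w0) = cyc x (Suc k) m"
    using x x0 ev_front [of "\<lambda>j. (\<phi> ^^ j) x" k m] by (simp add: m_comm)
  finally show ?thesis by metis
qed

text \<open>x generates a chain of maximal length, and \<open>B1\<close> is maximal among the
  submodules that meet its span \<open>X\<close> trivially. If \<open>B1\<close> and
  \<open>X\<close> did not generate B, there would be z outside their product with
  \<open>\<phi> z\<close> in \<open>B1\<close>. Adjoining z to \<open>B1\<close> gives a submodule
  that meets \<open>X\<close>, and this forces z back into the product.\<close>

lemma phi_sub_split:
  assumes B: "phi_sub B" "B \<noteq> {\<one>}"
  shows "\<exists>x k B1. x \<in> B \<and> k > 0 \<and> (\<phi> ^^ k) x = \<one> \<and> (\<phi> ^^ (k - 1)) x \<noteq> \<one> \<and> phi_sub B1 \<and> B1 \<subset> B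
    \<and> (\<forall>b \<in> B. \<exists>b1 \<in> B1. \<exists>m. b = b1 \<otimes> cyc x k m)
    \<and> (\<forall>b1 \<in> B1. \<forall>m. b1 \<otimes> cyc x k m = \<one> \<longrightarrow> b1 = \<one>)"
proof -
  have Bsub: "subgroup B A" using B by (simp add: phi_sub_def)
  have Bc: "b \<in> carrier A" if "b \<in> B" for b by (rule subgroup.mem_carrier [OF Bsub that])
  define K where "K = (LEAST k. \<forall>b \<in> B. (\<phi> ^^ k) b = \<one>)"
  have ex: "\<forall>b \<in> B. (\<phi> ^^ n) b = \<one>" using phi_nil Bc by blast
  have K: "\<forall>b \<in> B. (\<phi> ^^ K) b = \<one>" unfolding K_def by (rule LeastI [of _ n]) (rule ex)
  have "K \<noteq> 0"
  proof
    assume "K = 0"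
    then have "\<forall>b \<in> B. b = \<one>" using K by simp
    then have "B = {\<one>}" using subgroup.one_closed [OF Bsub] by blast
    then show False using B by simp
  qed
  then obtain k where k: "K = Suc k" by (cases K) auto
  have "\<not> (\<forall>b \<in> B. (\<phi> ^^ k) b = \<one>)"
    using not_less_Least [of k "\<lambda>k. \<forall>b \<in> B. (\<phi> ^^ k) b = \<one>"] k by (simp add: K_def)
  then obtain x where x: "x \<in> B" "(\<phi> ^^ k) x \<noteq> \<one>" by blast
  have xc: "x \<in> carrier A" using x Bc by blast
  have xk: "(\<phi> ^^ Suc k) x = \<one>" using K k x by simp
  define X where "X = range (cyc x (Suc k))"
  have X: "phi_sub X" unfolding X_def by (rule phi_sub_cyc [OF xc xk])
  then have Xsub: "subgroup X A" by (simp add: phi_sub_def)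
  have Xc: "u \<in> carrier A" if "u \<in> X" for u by (rule subgroup.mem_carrier [OF Xsub that])
  have xX: "x \<in> X"
  proof -
    have "cyc x (Suc k) (\<lambda>l. if l = 0 then 1 else 0) = x"
      using xc by (subst ev_unit) simp_all
    then show ?thesis unfolding X_def by (metis rangeI)
  qed
  have XB: "X \<subseteq> B"
    unfolding X_def by (intro image_subsetI ev_mem_subgroup [OF Bsub] phi_sub_funpow [OF B(1) x(1)])
  define F where "F = {B1. phi_sub B1 \<and> B1 \<subseteq> B \<and> B1 \<inter> X = {\<one>}}"
  have "F \<subseteq> Pow (carrier A)" using Bc by (auto simp: F_def)
  then have "finite F" using fin finite_subset by blast
  moreover have "{\<one>} \<in> F"
    using subgroup.one_closed [OF Bsub] subgroup.one_closed [OF Xsub] triv_subgroup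
    by (auto simp: F_def phi_sub_def)
  ultimately obtain B1 where B1F: "B1 \<in> F" and max: "\<And>B'. B' \<in> F \<Longrightarrow> B1 \<subseteq> B' \<Longrightarrow> B1 = B'"
    using finite_has_maximal [of F] by blast
  have B1: "phi_sub B1" "B1 \<subseteq> B" "B1 \<inter> X = {\<one>}" using B1F by (auto simp: F_def)
  have B1sub: "subgroup B1 A" using B1 by (simp add: phi_sub_def)
  have B1c: "b \<in> carrier A" if "b \<in> B1" for b by (rule subgroup.mem_carrier [OF B1sub that])
  define S where "S = B1 <#> X"
  have S: "subgroup S A" unfolding S_def by (rule mult_subgroups [OF B1sub Xsub])
  have SI: "b \<otimes> u \<in> S" if "b \<in> B1" "u \<in> X" for b u
    using that by (auto simp: S_def set_mult_def)
  have SE: "\<exists>b \<in> B1. \<exists>u \<in> X. s = b \<otimes> u" if "s \<in> S" for s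
    using that by (auto simp: S_def set_mult_def)
  have B1S: "B1 \<subseteq> S"
    using SI [OF _ subgroup.one_closed [OF Xsub]] B1c by auto
  have XS: "X \<subseteq> S"
    using SI [OF subgroup.one_closed [OF B1sub]] Xc by auto
  have "B \<subseteq> S"
  proof (rule ccontr)
    assume "\<not> B \<subseteq> S"
    then obtain y0 where y0: "y0 \<in> B" "y0 \<notin> S" by blast
    \<comment> \<open>The first iterate of y0 that lands in S; the one before it is y, outside S
      with \<open>\<phi> y\<close> inside.\<close>
    define J where "J = (LEAST j. (\<phi> ^^ j) y0 \<in> S)"
    have "(\<phi> ^^ K) y0 \<in> S" using K y0 subgroup.one_closed [OF S] by simp
    then have J: "(\<phi> ^^ J) y0 \<in> S" unfolding J_def by (rule LeastI)
    have "J \<noteq> 0" using J y0 by (cases J) auto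
    then obtain j where j: "J = Suc j" by (cases J) auto
    define y where "y = (\<phi> ^^ j) y0"
    have yS: "y \<notin> S"
      using not_less_Least [of j "\<lambda>j. (\<phi> ^^ j) y0 \<in> S"] j by (simp add: J_def y_def)
    have yB: "y \<in> B" unfolding y_def by (rule phi_sub_funpow [OF B(1) y0(1)])
    have yc: "y \<in> carrier A" using Bc yB by blast
    have "\<phi> y \<in> S" using J j by (simp add: y_def)
    then obtain b u where bu: "b \<in> B1" "u \<in> X" "\<phi> y = b \<otimes> u" using SE by blast
    have bc: "b \<in> carrier A" and uc: "u \<in> carrier A" using bu B1c Xc by auto
    \<comment> \<open>Here the maximal chain length is used: \<open>\<phi> ^^ Suc k\<close> kills y,
      so \<open>\<phi> ^^ k\<close> kills b u, and then also u because \<open>B1\<close> and X meet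
      trivially.\<close>
    have "(\<phi> ^^ k) (\<phi> y) = \<one>" using K k yB by (simp add: funpow_swap1)
    then have "(\<phi> ^^ k) b \<otimes> (\<phi> ^^ k) u = \<one>"
      using bu hom_mult [OF funpow_hom bc uc, of k] by simp
    then have "(\<phi> ^^ k) u = inv ((\<phi> ^^ k) b)"
      using bc uc by (metis funpow_closed inv_equality m_comm)
    moreover have "(\<phi> ^^ k) u \<in> X" by (rule phi_sub_funpow [OF X bu(2)])
    moreover have "inv ((\<phi> ^^ k) b) \<in> B1"
      by (rule subgroup.m_inv_closed [OF B1sub phi_sub_funpow [OF B1(1) bu(1)]])
    ultimately have "(\<phi> ^^ k) u = \<one>" using B1(3) by auto
    then obtain v where v: "v \<in> X" "u = \<phi> v"
      using cyc_image [OF xc xk x(2)] bu(2) unfolding X_def by blast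
    have vc: "v \<in> carrier A" using v Xc by blast
    \<comment> \<open>Dividing by v removes the X-part of \<open>\<phi> y\<close>.\<close>
    define z where "z = y \<otimes> inv v"
    have zc: "z \<in> carrier A" using yc vc by (simp add: z_def)
    have zB: "z \<in> B" unfolding z_def using yB v XB
      by (intro subgroup.m_closed [OF Bsub] subgroup.m_inv_closed [OF Bsub]) auto
    have zb: "\<phi> z = b" using bu v vc yc bc by (simp add: z_def m_assoc)
    have zS: "z \<notin> S"
    proof
      assume "z \<in> S"
      then have "z \<otimes> v \<in> S" using subgroup.m_closed [OF S] v XS by blast
      then show False using yS yc vc by (simp add: z_def m_assoc)
    qed
    define B' where "B' = B1 <#> generate A {z}"
    have B'I: "c \<otimes> z [^] (i::int) \<in> B'" if "c \<in> B1" for c i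
      using that zc by (auto simp: B'_def set_mult_def generate_pow)
    have B'E: "\<exists>c \<in> B1. \<exists>i::int. a = c \<otimes> z [^] i" if "a \<in> B'" for a
      using that zc by (auto simp: B'_def set_mult_def generate_pow)
    have "subgroup B' A"
      unfolding B'_def using zc by (intro mult_subgroups [OF B1sub] generate_is_subgroup) simp
    moreover have "\<phi> a \<in> B'" if aB: "a \<in> B'" for a
    proof -
      from B'E [OF aB] obtain c i where a: "c \<in> B1" "a = c \<otimes> z [^] (i::int)" by blast
      have "\<phi> a = (\<phi> c \<otimes> b [^] i) \<otimes> z [^] (0::int)"
        using a B1c zc zb bc by (simp add: phi.hom_int_pow)
      moreover have "\<phi> c \<otimes> b [^] i \<in> B1"
        using B1(1) a(1) bu(1) subgroup_int_pow_closed [OF B1sub]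
        by (intro subgroup.m_closed [OF B1sub]) (auto simp: phi_sub_def)
      ultimately show ?thesis using B'I [of _ 0] by simp
    qed
    moreover have "B' \<subseteq> B"
      using B'E B1(2) subgroup_int_pow_closed [OF Bsub zB] subgroup.m_closed [OF Bsub] by blast
    moreover have B1B': "B1 \<subseteq> B'" using B'I [of _ 0] B1c by auto
    moreover have "B1 \<noteq> B'"
      using B'I [OF subgroup.one_closed [OF B1sub], of 1] zc zS B1S by auto
    ultimately have "\<not> B' \<inter> X = {\<one>}"
      using max [of B'] by (auto simp: F_def phi_sub_def)
    moreover have "\<one> \<in> B' \<inter> X"
      using subgroup.one_closed [OF B1sub] subgroup.one_closed [OF Xsub] B1B' by blast
    ultimately obtain a where a: "a \<in> B'" "a \<in> X" "a \<noteq> \<one>" by blast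
    from B'E [OF a(1)] obtain c i where ci: "c \<in> B1" "a = c \<otimes> z [^] (i::int)" by blast
    have cc: "c \<in> carrier A" using ci B1c by blast
    have zp: "z [^] int p \<in> B1"
    proof -
      have "z [^] int p = b [^] int e" using phi_pow [OF zc] zb by (simp add: int_pow_int)
      then show ?thesis using subgroup_int_pow_closed [OF B1sub bu(1)] by simp
    qed
    have zi: "z [^] i \<in> S"
    proof -
      have "z [^] i = inv c \<otimes> a" using ci cc zc by (simp add: m_assoc [symmetric])
      then show ?thesis using SI [OF subgroup.m_inv_closed [OF B1sub ci(1)] a(2)] by simp
    qed
    \<comment> \<open>If p divided i, then z^i would be a power of z^p = b^e and lie in
      \<open>B1\<close>, and so would a. Hence i is invertible modulo p, and z is a product of
      powers of z^i and z^p, which both lie in S.\<close>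
    have "\<not> int p dvd i"
    proof
      assume "int p dvd i"
      then obtain r where r: "i = int p * r" by blast
      have "z [^] i = (z [^] int p) [^] r" using r zc by (simp add: int_pow_pow)
      then have "z [^] i \<in> B1" using subgroup_int_pow_closed [OF B1sub zp] by simp
      then have "a \<in> B1" using ci subgroup.m_closed [OF B1sub] by simp
      then show False using a B1(3) by blast
    qed
    then have "coprime i (int p)"
      using p by (metis coprime_commute prime_imp_coprime prime_nat_int_transfer)
    then obtain r s where rs: "r * i + s * int p = 1" using bezout_int [of i "int p"] by auto
    have "z = z [^] (r * i + s * int p)" using zc by (simp add: rs)
    also have "\<dots> = (z [^] i) [^] r \<otimes> (z [^] int p) [^] s"
      using zc by (simp add: int_pow_mult int_pow_pow mult.commute del: int_pow_int)
    also have "\<dots> \<in> S"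
      using zp B1S by (intro subgroup.m_closed [OF S subgroup_int_pow_closed [OF S zi]
            subgroup_int_pow_closed [OF S]]) auto
    finally show False using zS by simp
  qed
  have dec: "\<forall>b \<in> B. \<exists>b1 \<in> B1. \<exists>m. b = b1 \<otimes> cyc x (Suc k) m"
    using \<open>B \<subseteq> S\<close> SE unfolding X_def by blast
  have dir: "\<forall>b1 \<in> B1. \<forall>m. b1 \<otimes> cyc x (Suc k) m = \<one> \<longrightarrow> b1 = \<one>"
  proof (intro ballI allI impI)
    fix b1 m assume b1: "b1 \<in> B1" "b1 \<otimes> cyc x (Suc k) m = \<one>"
    have "b1 = inv (cyc x (Suc k) m)"
      using b1 B1c xc by (intro inv_equality [symmetric]) auto
    moreover have "inv (cyc x (Suc k) m) \<in> X"
      by (rule subgroup.m_inv_closed [OF Xsub]) (simp add: X_def)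
    ultimately show "b1 = \<one>" using b1 B1(3) by auto
  qed
  have "x \<noteq> \<one>" using x(2) by auto
  then have "B1 \<noteq> B" using xX x(1) B1(3) by blast
  then have "B1 \<subset> B" using B1(2) by blast
  then show ?thesis
    using x xk B1(1) dec dir by (intro exI [of _ x] exI [of _ "Suc k"] exI [of _ B1]) simp
qed

end

section \<open>Groups with a central nilpotent endomorphism\<close>

text \<open>
  The operator \<open>t\<close> on integer vectors: the basis is a concatenation of Jordan chains, and \<open>Z\<close> is the set of
  positions at which a chain starts. It always contains \<open>0\<close>, so \<open>l - 1\<close> is not truncated.
\<close>

definition shift :: "nat set \<Rightarrow> (nat \<Rightarrow> int) \<Rightarrow> nat \<Rightarrow> int" where
  "shift Z w l = (if l \<in> Z then 0 else w (l - 1))"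

locale central_endo = group G for G (structure) +
  fixes p n e :: nat and \<phi> :: "'a \<Rightarrow> 'a"
  assumes p: "prime p" and fin: "finite (carrier G)" and phi_hom: "\<phi> \<in> hom G G"
    and phi_central: "\<And>x y. x \<in> carrier G \<Longrightarrow> y \<in> carrier G \<Longrightarrow> \<phi> x \<otimes> y = y \<otimes> \<phi> x"
    and phi_nil: "\<And>x. x \<in> carrier G \<Longrightarrow> (\<phi> ^^ n) x = \<one>"
    and phi_pow: "\<And>x. x \<in> carrier G \<Longrightarrow> x [^] p = \<phi> x [^] e"
begin

sublocale phi: group_hom G G \<phi>
  by (intro group_hom.intro group_hom_axioms.intro is_group phi_hom)

lemma funpow_closed [simp]: "x \<in> carrier G \<Longrightarrow> (\<phi> ^^ j) x \<in> carrier G"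
  by (induction j) auto

abbreviation D :: "'a set" where "D \<equiv> derived G (carrier G)"
abbreviation Q :: "'a set monoid" where "Q \<equiv> G Mod D"

definition q :: "'a \<Rightarrow> 'a set" where "q x = D #> x"

lemma D_subgroup: "subgroup D G"
  by (rule derived_is_subgroup) simp

lemma D_carrier: "c \<in> D \<Longrightarrow> c \<in> carrier G"
  by (rule subgroup.mem_carrier [OF D_subgroup])

text \<open>The image of \<open>\<phi>\<close> is central, hence abelian, so commutators die. Thus
  \<open>\<phi>\<close> descends to \<open>Q\<close>, and with \<open>phi_pow\<close> the derived
  subgroup has exponent dividing p.\<close>

lemma phi_D: "c \<in> D \<Longrightarrow> \<phi> c = \<one>"
proof -
  have "derived_set G (carrier G) \<subseteq> kernel G G \<phi>"
  proof
    fix c assume "c \<in> derived_set G (carrier G)"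
    then obtain x y where xy: "x \<in> carrier G" "y \<in> carrier G" "c = x \<otimes> y \<otimes> inv x \<otimes> inv y" by blast
    have "\<phi> c = gcom G (\<phi> x) (\<phi> y)" using xy by (simp add: gcom_def)
    also have "\<dots> = \<one>" using xy phi_central [of x "\<phi> y"] by (simp add: gcom_eq_one_iff)
    finally show "c \<in> kernel G G \<phi>" using xy by (simp add: kernel_def)
  qed
  then have "D \<subseteq> kernel G G \<phi>"
    unfolding derived_def by (rule generate_subgroup_incl [OF _ phi.subgroup_kernel])
  then show "c \<in> D \<Longrightarrow> \<phi> c = \<one>" by (auto simp: kernel_def)
qed

sublocale q: group_hom G Q q
  using normal_quotient_hom [OF derived_self_is_normal] by (simp add: q_def [abs_def])

lemma q_one_iff: "x \<in> carrier G \<Longrightarrow> q x = \<one>\<^bsub>Q\<^esub> \<longleftrightarrow> x \<in> D"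
  unfolding q_def by (rule normal_quotient_one [OF derived_self_is_normal])

lemma q_surj: "c \<in> carrier Q \<Longrightarrow> \<exists>x \<in> carrier G. c = q x"
  unfolding q_def carrier_FactGroup by blast

lemma Q_comm: "comm_group Q"
proof (rule q.H.group_comm_groupI)
  fix a b assume "a \<in> carrier Q" "b \<in> carrier Q"
  then obtain x y where xy: "x \<in> carrier G" "y \<in> carrier G" "a = q x" "b = q y"
    using q_surj by blast
  show "a \<otimes>\<^bsub>Q\<^esub> b = b \<otimes>\<^bsub>Q\<^esub> a"
    unfolding xy q_def
    using normal_quotient_commute_iff [OF derived_self_is_normal xy(1,2)] gcom_in_derived [OF xy(1,2)]
    by (rule iffD1)
qed

text \<open>The image of a coset in this formula is a singleton because \<open>\<phi>\<close> kills
  \<open>D\<close>, so no representative is chosen.\<close>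

definition phiQ :: "'a set \<Rightarrow> 'a set" where
  "phiQ c = the_elem ((\<lambda>x. q (\<phi> x)) ` c)"

lemma phiQ_q: assumes "x \<in> carrier G" shows "phiQ (q x) = q (\<phi> x)"
proof -
  have "q x = (\<lambda>d. d \<otimes> x) ` D" by (auto simp: q_def r_coset_def)
  moreover have "\<phi> (d \<otimes> x) = \<phi> x" if "d \<in> D" for d
    using that assms D_carrier phi_D by simp
  ultimately have "(\<lambda>x. q (\<phi> x)) ` q x = (\<lambda>d. q (\<phi> x)) ` D" by (simp add: image_image)
  also have "\<dots> = {q (\<phi> x)}" using subgroup.one_closed [OF D_subgroup] by blast
  finally show ?thesis by (simp add: phiQ_def)
qed

lemma phiQ_funpow: "x \<in> carrier G \<Longrightarrow> (phiQ ^^ j) (q x) = q ((\<phi> ^^ j) x)"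
  by (induction j) (simp_all add: phiQ_q)

lemma nilpotent_Q: "nilpotent_endo Q phiQ p e n"
proof (intro nilpotent_endo.intro nilpotent_endo_axioms.intro Q_comm p)
  show "finite (carrier Q)" using fin by (simp add: carrier_FactGroup)
  show "phiQ \<in> hom Q Q"
  proof (rule homI)
    fix a assume "a \<in> carrier Q"
    then obtain x where x: "x \<in> carrier G" "a = q x" using q_surj by blast
    then show "phiQ a \<in> carrier Q" using q.hom_closed by (simp add: phiQ_q)
    fix b assume "b \<in> carrier Q"
    then obtain y where y: "y \<in> carrier G" "b = q y" using q_surj by blast
    have "phiQ (q x \<otimes>\<^bsub>Q\<^esub> q y) = phiQ (q (x \<otimes> y))" using x y by (simp only: q.hom_mult)
    also have "\<dots> = q (\<phi> (x \<otimes> y))" using x y by (intro phiQ_q m_closed)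
    also have "\<dots> = q (\<phi> x) \<otimes>\<^bsub>Q\<^esub> q (\<phi> y)"
      using x y by (simp only: phi.hom_mult q.hom_mult phi.hom_closed)
    finally show "phiQ (a \<otimes>\<^bsub>Q\<^esub> b) = phiQ a \<otimes>\<^bsub>Q\<^esub> phiQ b"
      using x y by (simp only: phiQ_q)
  qed
next
  fix a assume "a \<in> carrier Q"
  then obtain x where x: "x \<in> carrier G" "a = q x" using q_surj by blast
  show "(phiQ ^^ n) a = \<one>\<^bsub>Q\<^esub>"
    using x phi_nil [of x] by (simp add: phiQ_funpow q.hom_one del: one_FactGroup)
  have "q (x [^] p) = q (\<phi> x [^] e)" using phi_pow [OF x(1)] by simp
  then show "a [^]\<^bsub>Q\<^esub> p = phiQ a [^]\<^bsub>Q\<^esub> e"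
    using x by (simp add: phiQ_q q.hom_nat_pow)
qed

sublocale Q: nilpotent_endo Q phiQ p e n
  by (rule nilpotent_Q)

abbreviation evq :: "(nat \<Rightarrow> 'a) \<Rightarrow> nat \<Rightarrow> (nat \<Rightarrow> int) \<Rightarrow> 'a set" where
  "evq b \<equiv> ev Q (\<lambda>l. q (b l))"

text \<open>A Jordan basis of \<open>Q\<close>, lifted to G. Within a chain \<open>\<phi>\<close>
  sends each lift to the next in G itself and not only modulo \<open>D\<close>, which makes maps
  prescribed on the lifts compatible with \<open>\<phi>\<close>; at a chain end only membership in
  \<open>D\<close> can be asked. The last clause leaves the multiples of p - e t as the only
  relations. All positions from N on are in Z, so the last chain ends like any other.\<close>

definition chains :: "nat \<Rightarrow> nat set \<Rightarrow> (nat \<Rightarrow> 'a) \<Rightarrow> bool" where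
  "chains N Z b \<longleftrightarrow> 0 \<in> Z \<and> {N..} \<subseteq> Z \<and> (\<forall>l. b l \<in> carrier G)
    \<and> (\<forall>l<N. if Suc l \<in> Z then \<phi> (b l) \<in> D else \<phi> (b l) = b (Suc l))
    \<and> (\<forall>m. evq b N m = \<one>\<^bsub>Q\<^esub> \<longrightarrow> (\<exists>w. \<forall>l<N. m l = int p * w l - int e * shift Z w l))"

text \<open>\<open>direct\<close> splits a relation on the joined family into one on the old chains
  and one on the new chain, where \<open>Q.cyc_kernel\<close> applies.\<close>

lemma chains_append:
  assumes c: "chains N1 Z1 b1" and g: "g \<in> carrier G" and k: "k > 0"
    and gk: "(phiQ ^^ k) (q g) = \<one>\<^bsub>Q\<^esub>" "(phiQ ^^ (k - 1)) (q g) \<noteq> \<one>\<^bsub>Q\<^esub>"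
    and direct: "\<And>m m'. evq b1 N1 m \<otimes>\<^bsub>Q\<^esub> Q.cyc (q g) k m' = \<one>\<^bsub>Q\<^esub> \<Longrightarrow>
      evq b1 N1 m = \<one>\<^bsub>Q\<^esub>"
  shows "\<exists>Z b. chains (N1 + k) Z b \<and>
    (\<forall>m. evq b (N1 + k) m = evq b1 N1 m \<otimes>\<^bsub>Q\<^esub> Q.cyc (q g) k (\<lambda>j. m (N1 + j)))"
proof -
  \<comment> \<open>The new chain consists of the iterates of a single lift g, which makes its links
    exact in G.\<close>
  define b where "b = (\<lambda>l. if l < N1 then b1 l else (\<phi> ^^ (l - N1)) g)"
  define Z where "Z = {l \<in> Z1. l \<le> N1} \<union> {N1 + k..}"
  have Z1: "0 \<in> Z1" "N1 \<in> Z1" and b1: "\<And>l. b1 l \<in> carrier G"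
    using c by (auto simp: chains_def)
  have bc: "b l \<in> carrier G" for l using b1 g by (simp add: b_def)
  have ev_eq: "evq b (N1 + k) m
      = evq b1 N1 m \<otimes>\<^bsub>Q\<^esub> Q.cyc (q g) k (\<lambda>j. m (N1 + j))" for m
  proof -
    have "evq b (N1 + k) m
        = evq b N1 m \<otimes>\<^bsub>Q\<^esub> ev Q (\<lambda>j. q (b (N1 + j))) k (\<lambda>j. m (N1 + j))"
      using bc by (intro Q.ev_append q.hom_closed)
    also have "evq b N1 m = evq b1 N1 m"
      by (rule ev_cong) (simp_all add: b_def)
    also have "ev Q (\<lambda>j. q (b (N1 + j))) k (\<lambda>j. m (N1 + j)) = Q.cyc (q g) k (\<lambda>j. m (N1 + j))"
      by (rule ev_cong) (simp_all add: b_def phiQ_funpow g)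
    finally show ?thesis .
  qed
  have "chains (N1 + k) Z b"
    unfolding chains_def
  proof (intro conjI allI impI)
    show "0 \<in> Z" using Z1 by (simp add: Z_def)
    show "{N1 + k..} \<subseteq> Z" by (simp add: Z_def)
    show "b l \<in> carrier G" for l by (rule bc)
  next
    fix l assume l: "l < N1 + k"
    show "if Suc l \<in> Z then \<phi> (b l) \<in> D else \<phi> (b l) = b (Suc l)"
    proof (cases "l < N1")
      case True
      then have Zl: "Suc l \<in> Z \<longleftrightarrow> Suc l \<in> Z1" using k by (auto simp: Z_def)
      have cl: "if Suc l \<in> Z1 then \<phi> (b1 l) \<in> D else \<phi> (b1 l) = b1 (Suc l)"
        using c True by (simp add: chains_def)
      show ?thesis
      proof (cases "Suc l \<in> Z1")
        case False
        then have "Suc l < N1" using True Z1 by (metis Suc_lessI)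
        then show ?thesis using cl Zl False True by (simp add: b_def)
      qed (use cl Zl True in \<open>simp add: b_def\<close>)
    next
      case False
      have bl: "\<phi> (b l) = (\<phi> ^^ (Suc l - N1)) g" using False by (simp add: b_def Suc_diff_le)
      show ?thesis
      proof (cases "Suc l \<in> Z")
        case True
        then have "Suc l - N1 = k" using False l by (auto simp: Z_def)
        then have "q (\<phi> (b l)) = \<one>\<^bsub>Q\<^esub>" using gk(1) g by (simp add: bl phiQ_funpow del: one_FactGroup)
        then show ?thesis using True q_one_iff [of "\<phi> (b l)"] bc by simp
      qed (use False bl in \<open>simp add: b_def\<close>)
    qed
  next
    fix m assume m: "evq b (N1 + k) m = \<one>\<^bsub>Q\<^esub>"
    have e1: "evq b1 N1 m = \<one>\<^bsub>Q\<^esub>"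
      by (rule direct [OF m [unfolded ev_eq]])
    have "Q.cyc (q g) k (\<lambda>j. m (N1 + j)) \<in> carrier Q"
      by (intro Q.ev_closed Q.funpow_closed q.hom_closed g)
    then have e2: "Q.cyc (q g) k (\<lambda>j. m (N1 + j)) = \<one>\<^bsub>Q\<^esub>"
      using m [unfolded ev_eq e1] by (simp only: q.H.l_one)
    have "evq b1 N1 m = \<one>\<^bsub>Q\<^esub> \<longrightarrow>
        (\<exists>w. \<forall>l<N1. m l = int p * w l - int e * shift Z1 w l)"
      using c unfolding chains_def by (elim conjE) (erule allE)
    then obtain w1 where w1: "\<forall>l<N1. m l = int p * w1 l - int e * shift Z1 w1 l"
      using e1 by iprover
    from Q.cyc_kernel [OF q.hom_closed [OF g] gk(1) gk(2) e2]
    obtain w2 where w2: "\<forall>j<k. m (N1 + j) = int p * w2 j - int e * (if j = 0 then 0 else w2 (j - 1))"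
      by blast
    define w where "w = (\<lambda>l. if l < N1 then w1 l else w2 (l - N1))"
    have "m l = int p * w l - int e * shift Z w l" if l: "l < N1 + k" for l
    proof (cases "l < N1")
      case True
      then have "l \<in> Z \<longleftrightarrow> l \<in> Z1" by (auto simp: Z_def)
      then show ?thesis using w1 True by (auto simp: w_def shift_def)
    next
      case False
      define j where "j = l - N1"
      have j: "l = N1 + j" "j < k" using False l by (auto simp: j_def)
      have "l \<in> Z \<longleftrightarrow> j = 0" using j Z1 by (auto simp: Z_def)
      then show ?thesis using w2 j by (auto simp: w_def shift_def)
    qed
    then show "\<exists>w. \<forall>l<N1 + k. m l = int p * w l - int e * shift Z w l" by blast
  qed
  then show ?thesis using ev_eq by blast
qed

text \<open>Stated for all stable subgroups because the complement \<open>B1\<close> supplied by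
  \<open>Q.phi_sub_split\<close> is only one of these.\<close>

lemma chains_exist_sub:
  "Q.phi_sub B \<Longrightarrow> \<exists>N Z b. chains N Z b \<and> range (evq b N) = B"
proof (induction "card B" arbitrary: B rule: less_induct)
  case less
  have Bsub: "subgroup B Q" using less.prems by (simp add: Q.phi_sub_def)
  have finB: "finite B" using subgroup.subset [OF Bsub] Q.fin by (rule finite_subset)
  show ?case
  proof (cases "B = {\<one>\<^bsub>Q\<^esub>}")
    case True
    have "chains 0 UNIV (\<lambda>_. \<one>)" by (simp add: chains_def)
    moreover have "range (ev Q (\<lambda>l. q \<one>) 0) = B" using True by auto
    ultimately show ?thesis by (intro exI conjI)
  next
    case False
    from Q.phi_sub_split [OF less.prems False] obtain x k B1 where
      x: "x \<in> B" and k: "k > 0" "(phiQ ^^ k) x = \<one>\<^bsub>Q\<^esub>" "(phiQ ^^ (k - 1)) x \<noteq> \<one>\<^bsub>Q\<^esub>"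
      and B1: "Q.phi_sub B1" "B1 \<subset> B"
      and dec: "\<forall>b \<in> B. \<exists>b1 \<in> B1. \<exists>m. b = b1 \<otimes>\<^bsub>Q\<^esub> Q.cyc x k m"
      and dir: "\<forall>b1 \<in> B1. \<forall>m. b1 \<otimes>\<^bsub>Q\<^esub> Q.cyc x k m = \<one>\<^bsub>Q\<^esub> \<longrightarrow> b1 = \<one>\<^bsub>Q\<^esub>"
      by (elim exE conjE) (rule that; assumption)
    from less.hyps [OF psubset_card_mono [OF finB B1(2)] B1(1)]
    obtain N1 Z1 b1 where c1: "chains N1 Z1 b1" and r1: "range (evq b1 N1) = B1"
      by (elim exE conjE) (rule that; assumption)
    obtain g where g: "g \<in> carrier G" "x = q g"
      using q_surj subgroup.mem_carrier [OF Bsub x] by blast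
    have m1: "evq b1 N1 m \<in> B1" for m using r1 by blast
    have direct: "evq b1 N1 m = \<one>\<^bsub>Q\<^esub>"
      if "evq b1 N1 m \<otimes>\<^bsub>Q\<^esub> Q.cyc (q g) k m' = \<one>\<^bsub>Q\<^esub>" for m m'
      by (rule dir [rule_format, OF m1, of m m']) (use that g(2) in simp)
    have "\<exists>Z b. chains (N1 + k) Z b \<and> (\<forall>m. evq b (N1 + k) m
        = evq b1 N1 m \<otimes>\<^bsub>Q\<^esub> Q.cyc (q g) k (\<lambda>j. m (N1 + j)))"
      by (rule chains_append [OF c1 g(1) k(1) k(2,3) [unfolded g(2)]]) (rule direct)
    then obtain Z b where c: "chains (N1 + k) Z b" and evb: "\<forall>m. evq b (N1 + k) m
        = evq b1 N1 m \<otimes>\<^bsub>Q\<^esub> Q.cyc (q g) k (\<lambda>j. m (N1 + j))"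
      by (elim exE conjE) (rule that; assumption)
    note evb = evb [rule_format, folded g(2)]
    have "range (evq b (N1 + k)) = B"
    proof
      show "range (evq b (N1 + k)) \<subseteq> B"
      proof (rule image_subsetI)
        fix m
        have "Q.cyc x k (\<lambda>j. m (N1 + j)) \<in> B"
          by (rule Q.ev_mem_subgroup [OF Bsub Q.phi_sub_funpow [OF less.prems x]])
        moreover have "evq b1 N1 m \<in> B" using m1 B1(2) by blast
        ultimately show "evq b (N1 + k) m \<in> B"
          unfolding evb by (intro subgroup.m_closed [OF Bsub])
      qed
      show "B \<subseteq> range (evq b (N1 + k))"
      proof
        fix a assume "a \<in> B"
        then obtain d m where d: "d \<in> B1" "a = d \<otimes>\<^bsub>Q\<^esub> Q.cyc x k m" using dec by blast
        then obtain m1 where m1: "d = evq b1 N1 m1" using r1 by blast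
        define mm where "mm = (\<lambda>l. if l < N1 then m1 l else m (l - N1))"
        have "evq b1 N1 mm = d" unfolding m1 by (rule ev_cong) (simp_all add: mm_def)
        moreover have "(\<lambda>j. mm (N1 + j)) = m" by (simp add: mm_def)
        ultimately have "a = evq b (N1 + k) mm" unfolding evb d(2) by simp
        then show "a \<in> range (evq b (N1 + k))" by blast
      qed
    qed
    then show ?thesis using c by (intro exI conjI)
  qed
qed

lemma chains_exist: "\<exists>N Z b. chains N Z b \<and> (\<forall>x \<in> carrier G. \<exists>m. q x = evq b N m)"
proof -
  have "Q.phi_sub (carrier Q)"
    unfolding Q.phi_sub_def using q.H.subgroup_self Q.phi.hom_closed by simp
  from chains_exist_sub [OF this] obtain N Z b
    where "chains N Z b" and r: "range (evq b N) = carrier Q" by blast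
  moreover have "\<exists>m. q x = evq b N m" if "x \<in> carrier G" for x
    using r q.hom_closed [OF that] by blast
  ultimately show ?thesis by blast
qed

end

section \<open>Linked pairs\<close>

text \<open>The defect in \<open>theta_mult\<close> stems from carries of digits. Elements of the
  derived subgroup have digit vector 0 and cause no carry, so \<open>theta_derived\<close> is exact;
  with \<open>theta_gcom\<close> the link restricts to an isomorphism of the derived subgroups that
  respects all commutators.\<close>

locale linking = G: central_endo G p n e \<phi> + H: central_endo H p n e' \<chi>
  for G :: "('a, 'c) monoid_scheme" (structure) and H :: "('b, 'd) monoid_scheme"
    and p n e e' :: nat and \<phi> \<chi> +
  fixes \<theta> :: "'a \<Rightarrow> 'b"
  assumes bij: "bij_betw \<theta> (carrier G) (carrier H)"
    and theta_gcom: "\<And>x y. x \<in> carrier G \<Longrightarrow> y \<in> carrier G \<Longrightarrow> \<theta> (gcom G x y) = gcom H (\<theta> x) (\<theta> y)"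
    and theta_phi: "\<And>x. x \<in> carrier G \<Longrightarrow> \<theta> (\<phi> x) = \<chi> (\<theta> x)"
    and theta_derived: "\<And>x c. x \<in> carrier G \<Longrightarrow> c \<in> derived G (carrier G) \<Longrightarrow>
      \<theta> (x \<otimes> c) = \<theta> x \<otimes>\<^bsub>H\<^esub> \<theta> c"
    and theta_mult: "\<And>x y. x \<in> carrier G \<Longrightarrow> y \<in> carrier G \<Longrightarrow>
      \<exists>w \<in> carrier H. \<theta> (x \<otimes> y) = \<theta> x \<otimes>\<^bsub>H\<^esub> \<theta> y \<otimes>\<^bsub>H\<^esub> \<chi> w"
begin

abbreviation Hmult :: "'b \<Rightarrow> 'b \<Rightarrow> 'b" (infixl \<open>\<cdot>\<close> 70) where
  "x \<cdot> y \<equiv> x \<otimes>\<^bsub>H\<^esub> y"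

lemma theta_closed [simp]: "x \<in> carrier G \<Longrightarrow> \<theta> x \<in> carrier H"
  using bij by (auto simp: bij_betw_def)

lemma theta_inj: "x \<in> carrier G \<Longrightarrow> y \<in> carrier G \<Longrightarrow> \<theta> x = \<theta> y \<Longrightarrow> x = y"
  using bij by (auto simp: bij_betw_def inj_on_def)

lemma theta_surj: "u \<in> carrier H \<Longrightarrow> \<exists>x \<in> carrier G. u = \<theta> x"
  using bij by (auto simp: bij_betw_def)

lemma theta_one [simp]: "\<theta> \<one> = \<one>\<^bsub>H\<^esub>"
  using theta_derived [OF G.one_closed subgroup.one_closed [OF G.D_subgroup]] by simp

lemma theta_D: "c \<in> derived G (carrier G) \<Longrightarrow> \<theta> c \<in> derived H (carrier H)"
  unfolding derived_def
proof (induction c rule: generate.induct)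
  case one
  then show ?case by (simp add: generate.one)
next
  case (incl h)
  then obtain x y where "x \<in> carrier G" "y \<in> carrier G" "h = gcom G x y" by (auto simp: gcom_def)
  then show ?case using H.gcom_in_derived [of "\<theta> x" "\<theta> y"] by (simp add: theta_gcom derived_def)
next
  case (inv h)
  then obtain x y where "x \<in> carrier G" "y \<in> carrier G" "h = gcom G x y" by (auto simp: gcom_def)
  then show ?case using H.gcom_in_derived [of "\<theta> y" "\<theta> x"]
    by (simp add: G.inv_gcom theta_gcom derived_def)
next
  case (eng h1 h2)
  have "h1 \<in> carrier G" by (rule G.D_carrier) (use eng in \<open>simp add: derived_def\<close>)
  then have "\<theta> (h1 \<otimes> h2) = \<theta> h1 \<cdot> \<theta> h2"
    by (rule theta_derived) (use eng in \<open>simp add: derived_def\<close>)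
  then show ?case using eng by (simp add: generate.eng)
qed

lemma theta_D_surj: "d \<in> derived H (carrier H) \<Longrightarrow> \<exists>c \<in> derived G (carrier G). d = \<theta> c"
  unfolding derived_def [of H]
proof (induction d rule: generate.induct)
  case one
  then show ?case using subgroup.one_closed [OF G.D_subgroup] by (intro bexI [of _ "\<one>"]) simp_all
next
  case (incl h)
  then obtain u v where uv: "u \<in> carrier H" "v \<in> carrier H" "h = gcom H u v" by (auto simp: gcom_def)
  obtain x y where xy: "x \<in> carrier G" "y \<in> carrier G" "u = \<theta> x" "v = \<theta> y"
    using theta_surj uv(1,2) by blast
  show ?case using G.gcom_in_derived [OF xy(1,2)] theta_gcom [OF xy(1,2)] uv xy
    by (intro bexI [of _ "gcom G x y"]) simp_all
next
  case (inv h)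
  then obtain u v where uv: "u \<in> carrier H" "v \<in> carrier H" "h = gcom H u v" by (auto simp: gcom_def)
  obtain x y where xy: "x \<in> carrier G" "y \<in> carrier G" "u = \<theta> x" "v = \<theta> y"
    using theta_surj uv(1,2) by blast
  show ?case using G.gcom_in_derived [OF xy(2,1)] theta_gcom [OF xy(2,1)] uv xy
    by (intro bexI [of _ "gcom G y x"]) (simp_all add: H.inv_gcom)
next
  case (eng h1 h2)
  then obtain c1 c2 where c: "c1 \<in> G.D" "c2 \<in> G.D" "h1 = \<theta> c1" "h2 = \<theta> c2" by blast
  have "\<theta> (c1 \<otimes> c2) = h1 \<cdot> h2"
    using theta_derived [OF G.D_carrier [OF c(1)] c(2)] c by simp
  then show ?case using subgroup.m_closed [OF G.D_subgroup c(1,2)] by (intro bexI [of _ "c1 \<otimes> c2"]) simp_all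
qed

text \<open>Symmetry of linking requires the defect to be expressed by \<open>\<phi>\<close>. The
  coset of x y modulo the image of \<open>\<phi>\<close> is mapped into the coset of
  \<open>\<theta> x \<cdot> \<theta> y\<close> modulo the image of \<open>\<chi>\<close>. Both have
  the same finite size, so the map is onto.\<close>

lemma theta_mult_surj:
  assumes x: "x \<in> carrier G" and y: "y \<in> carrier G"
  shows "\<exists>w \<in> carrier G. \<theta> x \<cdot> \<theta> y = \<theta> (x \<otimes> y \<otimes> \<phi> w)"
proof -
  define T where "T = (\<lambda>a. \<theta> (x \<otimes> y \<otimes> a)) ` \<phi> ` carrier G"
  define U where "U = (\<lambda>a. \<theta> x \<cdot> \<theta> y \<cdot> a) ` \<chi> ` carrier H"
  have xy: "x \<otimes> y \<in> carrier G" "\<theta> x \<cdot> \<theta> y \<in> carrier H" using x y by simp_all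
  have cU: "card U = card (\<chi> ` carrier H)"
    unfolding U_def by (rule card_image) (use xy in \<open>auto simp: inj_on_def\<close>)
  have cT: "card T = card (\<phi> ` carrier G)"
    unfolding T_def
    by (rule card_image) (use xy in \<open>auto simp: inj_on_def dest!: theta_inj [rotated 2]\<close>)
  have "\<chi> ` carrier H = \<theta> ` \<phi> ` carrier G"
    using theta_phi theta_surj by (force simp: image_iff)
  moreover have "inj_on \<theta> (\<phi> ` carrier G)"
    by (rule inj_onI) (auto intro: theta_inj)
  ultimately have "card T = card U" using cU cT by (simp add: card_image)
  moreover have "T \<subseteq> U"
  proof
    fix t assume "t \<in> T"
    then obtain v where v: "v \<in> carrier G" "t = \<theta> (x \<otimes> y \<otimes> \<phi> v)" by (auto simp: T_def)
    obtain w1 where w1: "w1 \<in> carrier H" "t = \<theta> (x \<otimes> y) \<cdot> \<theta> (\<phi> v) \<cdot> \<chi> w1"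
      using theta_mult [OF xy(1), of "\<phi> v"] v by auto
    obtain w2 where w2: "w2 \<in> carrier H" "\<theta> (x \<otimes> y) = \<theta> x \<cdot> \<theta> y \<cdot> \<chi> w2"
      using theta_mult [OF x y] by auto
    have "t = \<theta> x \<cdot> \<theta> y \<cdot> \<chi> (w2 \<cdot> \<theta> v \<cdot> w1)"
      using w1 w2 v x y theta_phi [OF v(1)] by (simp add: H.m_assoc)
    moreover have "w2 \<cdot> \<theta> v \<cdot> w1 \<in> carrier H" using w1 w2 v by simp
    ultimately show "t \<in> U" unfolding U_def by blast
  qed
  moreover have "finite U" unfolding U_def using H.fin by simp
  ultimately have "T = U" by (metis card_subset_eq)
  moreover have "\<theta> x \<cdot> \<theta> y \<in> U"
    unfolding U_def using xy by (intro image_eqI [of _ _ "\<chi> \<one>\<^bsub>H\<^esub>"]) simp_all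
  ultimately have "\<theta> x \<cdot> \<theta> y \<in> T" by simp
  then show ?thesis unfolding T_def by blast
qed

lemma linking_sym: "linking H G p n e' e \<chi> \<phi> (inv_into (carrier G) \<theta>)"
proof (intro linking.intro linking_axioms.intro G.central_endo_axioms H.central_endo_axioms)
  let ?i = "inv_into (carrier G) \<theta>"
  have i: "?i (\<theta> x) = x" if "x \<in> carrier G" for x
    using that bij by (simp add: bij_betw_def)
  show "bij_betw ?i (carrier H) (carrier G)" by (rule bij_betw_inv_into [OF bij])
  fix u assume u: "u \<in> carrier H"
  then obtain x where x: "x \<in> carrier G" "u = \<theta> x" using theta_surj by blast
  show "?i (\<chi> u) = \<phi> (?i u)" using x i theta_phi [OF x(1), symmetric] by simp
  {
    fix v assume v: "v \<in> carrier H"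
    then obtain y where y: "y \<in> carrier G" "v = \<theta> y" using theta_surj by blast
    show "?i (gcom H u v) = gcom G (?i u) (?i v)"
      using x y i theta_gcom [OF x(1) y(1), symmetric] by simp
    obtain w where w: "w \<in> carrier G" "\<theta> x \<cdot> \<theta> y = \<theta> (x \<otimes> y \<otimes> \<phi> w)"
      using theta_mult_surj [OF x(1) y(1)] by blast
    have "?i (u \<cdot> v) = ?i u \<otimes> ?i v \<otimes> \<phi> w" using x y w i by simp
    then show "\<exists>w \<in> carrier G. ?i (u \<cdot> v) = ?i u \<otimes> ?i v \<otimes> \<phi> w" using w by blast
  }
  fix d assume "d \<in> derived H (carrier H)"
  then obtain c where c: "c \<in> derived G (carrier G)" "d = \<theta> c" using theta_D_surj by blast
  show "?i (u \<cdot> d) = ?i u \<otimes> ?i d"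
    using x c i theta_derived [OF x(1) c(1), symmetric] G.D_carrier [OF c(1)] by simp
qed

end

text \<open>\<open>\<eta>\<close> carries a defect \<open>\<chi> w\<close> to
  \<open>\<psi> (\<eta> w)\<close>, again in the image of the operator, so the defects of both links
  combine into one.\<close>

lemma linking_trans:
  assumes "linking G H p n e e' \<phi> \<chi> \<theta>" and "linking H K p n e' e'' \<chi> \<psi> \<eta>"
  shows "linking G K p n e e'' \<phi> \<psi> (\<eta> \<circ> \<theta>)"
proof -
  interpret L: linking G H p n e e' \<phi> \<chi> \<theta> by fact
  interpret M: linking H K p n e' e'' \<chi> \<psi> \<eta> by fact
  show ?thesis
  proof (intro linking.intro linking_axioms.intro L.G.central_endo_axioms M.H.central_endo_axioms)
    show "bij_betw (\<eta> \<circ> \<theta>) (carrier G) (carrier K)" by (rule bij_betw_trans [OF L.bij M.bij])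
    fix x assume x: "x \<in> carrier G"
    show "(\<eta> \<circ> \<theta>) (\<phi> x) = \<psi> ((\<eta> \<circ> \<theta>) x)" using x by (simp add: L.theta_phi M.theta_phi)
    {
      fix y assume y: "y \<in> carrier G"
      show "(\<eta> \<circ> \<theta>) (gcom G x y) = gcom K ((\<eta> \<circ> \<theta>) x) ((\<eta> \<circ> \<theta>) y)"
        using x y by (simp add: L.theta_gcom M.theta_gcom)
      obtain w where w: "w \<in> carrier H" "\<theta> (x \<otimes>\<^bsub>G\<^esub> y) = \<theta> x \<otimes>\<^bsub>H\<^esub> \<theta> y \<otimes>\<^bsub>H\<^esub> \<chi> w"
        using L.theta_mult [OF x y] by blast
      have c: "\<theta> x \<in> carrier H" "\<theta> y \<in> carrier H" "\<theta> x \<otimes>\<^bsub>H\<^esub> \<theta> y \<in> carrier H" "\<chi> w \<in> carrier H"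
        using x y w by simp_all
      obtain w1 where w1: "w1 \<in> carrier K"
          "\<eta> (\<theta> x \<otimes>\<^bsub>H\<^esub> \<theta> y \<otimes>\<^bsub>H\<^esub> \<chi> w) = \<eta> (\<theta> x \<otimes>\<^bsub>H\<^esub> \<theta> y) \<otimes>\<^bsub>K\<^esub> \<eta> (\<chi> w) \<otimes>\<^bsub>K\<^esub> \<psi> w1"
        using M.theta_mult [OF c(3,4)] by blast
      obtain w2 where w2: "w2 \<in> carrier K"
          "\<eta> (\<theta> x \<otimes>\<^bsub>H\<^esub> \<theta> y) = \<eta> (\<theta> x) \<otimes>\<^bsub>K\<^esub> \<eta> (\<theta> y) \<otimes>\<^bsub>K\<^esub> \<psi> w2"
        using M.theta_mult [OF c(1,2)] by blast
      have "(\<eta> \<circ> \<theta>) (x \<otimes>\<^bsub>G\<^esub> y) = (\<eta> \<circ> \<theta>) x \<otimes>\<^bsub>K\<^esub> (\<eta> \<circ> \<theta>) y \<otimes>\<^bsub>K\<^esub> \<psi> (w2 \<otimes>\<^bsub>K\<^esub> \<eta> w \<otimes>\<^bsub>K\<^esub> w1)"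
        using w w1 w2 x y by (simp add: M.theta_phi M.H.m_assoc)
      moreover have "w2 \<otimes>\<^bsub>K\<^esub> \<eta> w \<otimes>\<^bsub>K\<^esub> w1 \<in> carrier K" using w w1 w2 by simp
      ultimately show "\<exists>w \<in> carrier K. (\<eta> \<circ> \<theta>) (x \<otimes>\<^bsub>G\<^esub> y) = (\<eta> \<circ> \<theta>) x \<otimes>\<^bsub>K\<^esub> (\<eta> \<circ> \<theta>) y \<otimes>\<^bsub>K\<^esub> \<psi> w"
        by (rule bexI)
    }
    fix c assume c: "c \<in> derived G (carrier G)"
    show "(\<eta> \<circ> \<theta>) (x \<otimes>\<^bsub>G\<^esub> c) = (\<eta> \<circ> \<theta>) x \<otimes>\<^bsub>K\<^esub> (\<eta> \<circ> \<theta>) c"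
      using x by (simp add: L.theta_derived [OF x c] M.theta_derived [OF _ L.theta_D [OF c]])
  qed
qed

lemma linking_iso:
  assumes "central_endo G p n e \<phi>" and "central_endo H p n e' \<chi>" and f: "f \<in> iso G H"
    and comm: "\<And>x. x \<in> carrier G \<Longrightarrow> f (\<phi> x) = \<chi> (f x)"
  shows "linking G H p n e e' \<phi> \<chi> f"
proof -
  interpret G: central_endo G p n e \<phi> by fact
  interpret H: central_endo H p n e' \<chi> by fact
  interpret f: group_hom G H f
    using f by (intro group_hom.intro group_hom_axioms.intro G.is_group H.is_group) (simp add: iso_def)
  show ?thesis
  proof (intro linking.intro linking_axioms.intro G.central_endo_axioms H.central_endo_axioms)
    show "bij_betw f (carrier G) (carrier H)" using f by (simp add: iso_def)
    fix x assume x: "x \<in> carrier G"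
    show "f (\<phi> x) = \<chi> (f x)" by (rule comm [OF x])
    show "f (x \<otimes>\<^bsub>G\<^esub> c) = f x \<otimes>\<^bsub>H\<^esub> f c" if "c \<in> derived G (carrier G)" for c
      using x G.D_carrier [OF that] by simp
    fix y assume y: "y \<in> carrier G"
    show "f (gcom G x y) = gcom H (f x) (f y)" using x y by (simp add: gcom_def)
    show "\<exists>w \<in> carrier H. f (x \<otimes>\<^bsub>G\<^esub> y) = f x \<otimes>\<^bsub>H\<^esub> f y \<otimes>\<^bsub>H\<^esub> \<chi> w"
      using x y by (intro bexI [of _ "\<one>\<^bsub>H\<^esub>"]) simp_all
  qed
qed

section \<open>Extending homomorphisms along a Jordan basis\<close>

text \<open>The group generated by K and x is a cyclic extension of K, determined by x^p and by the
  conjugation action of x; \<open>fp\<close> and \<open>fconj\<close> say that y satisfies the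
  corresponding relations. Only products k x^i with natural i are treated; in a finite group these
  exhaust the extension.\<close>

lemma (in group) extend_hom:
  fixes f :: "'a \<Rightarrow> 'c"
  assumes H: "group H" and K: "subgroup K G" and x: "x \<in> carrier G" and y: "y \<in> carrier H"
    and conj: "\<And>k. k \<in> K \<Longrightarrow> x \<otimes> k \<otimes> inv x \<in> K"
    and fc: "\<And>k. k \<in> K \<Longrightarrow> f k \<in> carrier H"
    and fm: "\<And>k k'. k \<in> K \<Longrightarrow> k' \<in> K \<Longrightarrow> f (k \<otimes> k') = f k \<otimes>\<^bsub>H\<^esub> f k'"
    and xp: "x [^] (p::nat) \<in> K" and dv: "\<And>i::nat. x [^] i \<in> K \<Longrightarrow> p dvd i"
    and fp: "f (x [^] p) = y [^]\<^bsub>H\<^esub> p"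
    and fconj: "\<And>k. k \<in> K \<Longrightarrow> f (x \<otimes> k \<otimes> inv x) \<otimes>\<^bsub>H\<^esub> y = y \<otimes>\<^bsub>H\<^esub> f k"
  shows "\<exists>f'. (\<forall>k \<in> K. \<forall>i::nat. f' (k \<otimes> x [^] i) = f k \<otimes>\<^bsub>H\<^esub> y [^]\<^bsub>H\<^esub> i) \<and>
    (\<forall>k \<in> K. \<forall>k' \<in> K. \<forall>(i::nat) (j::nat).
      f' ((k \<otimes> x [^] i) \<otimes> (k' \<otimes> x [^] j)) = f' (k \<otimes> x [^] i) \<otimes>\<^bsub>H\<^esub> f' (k' \<otimes> x [^] j))"
proof -
  interpret H: group H by fact
  have Kc: "k \<in> carrier G" if "k \<in> K" for k by (rule subgroup.mem_carrier [OF K that])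
  have f1: "f \<one> = \<one>\<^bsub>H\<^esub>"
    using fm [OF subgroup.one_closed [OF K] subgroup.one_closed [OF K]] fc [OF subgroup.one_closed [OF K]]
    by simp
  have fpow: "f (x [^] (p * r)) = y [^]\<^bsub>H\<^esub> (p * r) \<and> x [^] (p * r) \<in> K" for r
  proof (induction r)
    case 0
    then show ?case using f1 subgroup.one_closed [OF K] by simp
  next
    case (Suc r)
    have eq: "x [^] (p * Suc r) = x [^] (p * r) \<otimes> x [^] p"
      using x by (simp add: nat_pow_mult add.commute)
    have "f (x [^] (p * Suc r)) = y [^]\<^bsub>H\<^esub> (p * r) \<otimes>\<^bsub>H\<^esub> y [^]\<^bsub>H\<^esub> p"
      unfolding eq using Suc xp fp fm by simp
    also have "\<dots> = y [^]\<^bsub>H\<^esub> (p * Suc r)" using y by (simp add: H.nat_pow_mult add.commute)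
    finally show ?case unfolding eq using Suc xp subgroup.m_closed [OF K] by simp
  qed
  \<comment> \<open>Two expressions of one element differ by x^(i - j) in K, whose exponent is a
    multiple of p, and there f is known from \<open>fp\<close>. The condition j \<le> i keeps the
    exponent natural.\<close>
  have wd_le: "f k \<otimes>\<^bsub>H\<^esub> y [^]\<^bsub>H\<^esub> i = f k' \<otimes>\<^bsub>H\<^esub> y [^]\<^bsub>H\<^esub> j"
    if kk: "k \<in> K" "k' \<in> K" and eq: "k \<otimes> x [^] i = k' \<otimes> x [^] j" and "j \<le> i" for k k' and i j :: nat
  proof -
    have s: "x [^] i = x [^] (i - j) \<otimes> x [^] j" using x \<open>j \<le> i\<close> by (simp add: nat_pow_mult)
    have "(k \<otimes> x [^] (i - j)) \<otimes> x [^] j = k' \<otimes> x [^] j"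
      using eq Kc kk x unfolding s by (simp add: m_assoc)
    then have k': "k \<otimes> x [^] (i - j) = k'" using Kc kk x by simp
    then have "x [^] (i - j) = inv k \<otimes> k'" using Kc kk x by (auto simp: l_cancel_inv)
    then have inK: "x [^] (i - j) \<in> K"
      using kk subgroup.m_closed [OF K subgroup.m_inv_closed [OF K]] by simp
    then obtain r where r: "i - j = p * r" using dv by blast
    have "f k' = f k \<otimes>\<^bsub>H\<^esub> y [^]\<^bsub>H\<^esub> (i - j)"
      using fm [OF kk(1) inK] k' fpow [of r] r by simp
    then have "f k' \<otimes>\<^bsub>H\<^esub> y [^]\<^bsub>H\<^esub> j = f k \<otimes>\<^bsub>H\<^esub> (y [^]\<^bsub>H\<^esub> (i - j) \<otimes>\<^bsub>H\<^esub> y [^]\<^bsub>H\<^esub> j)"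
      using fc kk y by (simp add: H.m_assoc)
    also have "\<dots> = f k \<otimes>\<^bsub>H\<^esub> y [^]\<^bsub>H\<^esub> i" using y \<open>j \<le> i\<close> by (simp add: H.nat_pow_mult)
    finally show ?thesis by simp
  qed
  have wd: "f k \<otimes>\<^bsub>H\<^esub> y [^]\<^bsub>H\<^esub> i = f k' \<otimes>\<^bsub>H\<^esub> y [^]\<^bsub>H\<^esub> j"
    if "k \<in> K" "k' \<in> K" "k \<otimes> x [^] i = k' \<otimes> x [^] j" for k k' and i j :: nat
    using wd_le [OF that] wd_le [OF that(2,1) that(3) [symmetric]] by (cases "j \<le> i") simp_all
  define f' where "f' = (\<lambda>g. SOME v. \<exists>k \<in> K. \<exists>i::nat. g = k \<otimes> x [^] i \<and> v = f k \<otimes>\<^bsub>H\<^esub> y [^]\<^bsub>H\<^esub> i)"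
  have f'eq: "f' (k \<otimes> x [^] i) = f k \<otimes>\<^bsub>H\<^esub> y [^]\<^bsub>H\<^esub> i" if k: "k \<in> K" for k and i :: nat
    unfolding f'_def
  proof (rule some_equality)
    show "\<exists>k' \<in> K. \<exists>j::nat. k \<otimes> x [^] i = k' \<otimes> x [^] j \<and> f k \<otimes>\<^bsub>H\<^esub> y [^]\<^bsub>H\<^esub> i = f k' \<otimes>\<^bsub>H\<^esub> y [^]\<^bsub>H\<^esub> j"
      by (rule bexI [OF _ k]) (rule exI [of _ i], simp)
    fix v assume "\<exists>k' \<in> K. \<exists>j::nat. k \<otimes> x [^] i = k' \<otimes> x [^] j \<and> v = f k' \<otimes>\<^bsub>H\<^esub> y [^]\<^bsub>H\<^esub> j"
    then obtain k' and j :: nat where "k' \<in> K" "k \<otimes> x [^] i = k' \<otimes> x [^] j" "v = f k' \<otimes>\<^bsub>H\<^esub> y [^]\<^bsub>H\<^esub> j"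
      by blast
    then show "v = f k \<otimes>\<^bsub>H\<^esub> y [^]\<^bsub>H\<^esub> i" using wd [OF k] by simp
  qed
  have fcj: "x [^] i \<otimes> k \<otimes> inv (x [^] i) \<in> K \<and>
      f (x [^] i \<otimes> k \<otimes> inv (x [^] i)) \<otimes>\<^bsub>H\<^esub> y [^]\<^bsub>H\<^esub> i = y [^]\<^bsub>H\<^esub> i \<otimes>\<^bsub>H\<^esub> f k" if k: "k \<in> K" for k and i :: nat
  proof (induction i)
    case 0
    then show ?case using k Kc fc by simp
  next
    case (Suc i)
    define k1 where "k1 = x [^] i \<otimes> k \<otimes> inv (x [^] i)"
    have k1: "k1 \<in> K" "f k1 \<otimes>\<^bsub>H\<^esub> y [^]\<^bsub>H\<^esub> i = y [^]\<^bsub>H\<^esub> i \<otimes>\<^bsub>H\<^esub> f k" using Suc by (simp_all add: k1_def)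
    have eq: "x [^] Suc i \<otimes> k \<otimes> inv (x [^] Suc i) = x \<otimes> k1 \<otimes> inv x"
      unfolding nat_pow_Suc2 [OF x] using x Kc [OF k] by (simp add: k1_def word_simps)
    have k2: "x \<otimes> k1 \<otimes> inv x \<in> K" by (rule conj [OF k1(1)])
    have "f (x \<otimes> k1 \<otimes> inv x) \<otimes>\<^bsub>H\<^esub> y [^]\<^bsub>H\<^esub> Suc i
        = (f (x \<otimes> k1 \<otimes> inv x) \<otimes>\<^bsub>H\<^esub> y) \<otimes>\<^bsub>H\<^esub> y [^]\<^bsub>H\<^esub> i"
      unfolding H.nat_pow_Suc2 [OF y] using fc [OF k2] y by (simp add: H.m_assoc)
    also have "\<dots> = y \<otimes>\<^bsub>H\<^esub> (f k1 \<otimes>\<^bsub>H\<^esub> y [^]\<^bsub>H\<^esub> i)"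
      unfolding fconj [OF k1(1)] using fc [OF k1(1)] y by (simp add: H.m_assoc)
    also have "\<dots> = y [^]\<^bsub>H\<^esub> Suc i \<otimes>\<^bsub>H\<^esub> f k"
      unfolding H.nat_pow_Suc2 [OF y] k1(2) using fc [OF k] y by (simp add: H.m_assoc)
    finally show ?case using eq k2 by simp
  qed
  have f'm: "f' ((k \<otimes> x [^] i) \<otimes> (k' \<otimes> x [^] j)) = f' (k \<otimes> x [^] i) \<otimes>\<^bsub>H\<^esub> f' (k' \<otimes> x [^] j)"
    if kk: "k \<in> K" "k' \<in> K" for k k' and i j :: nat
  proof -
    define c where "c = x [^] i \<otimes> k' \<otimes> inv (x [^] i)"
    have c: "c \<in> K" "f c \<otimes>\<^bsub>H\<^esub> y [^]\<^bsub>H\<^esub> i = y [^]\<^bsub>H\<^esub> i \<otimes>\<^bsub>H\<^esub> f k'"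
      using fcj [OF kk(2), of i] by (simp_all add: c_def)
    have "(k \<otimes> x [^] i) \<otimes> (k' \<otimes> x [^] j) = (k \<otimes> c) \<otimes> x [^] (i + j)"
      using x Kc kk by (simp add: c_def word_simps nat_pow_mult [symmetric])
    then have "f' ((k \<otimes> x [^] i) \<otimes> (k' \<otimes> x [^] j)) = f (k \<otimes> c) \<otimes>\<^bsub>H\<^esub> y [^]\<^bsub>H\<^esub> (i + j)"
      using f'eq [OF subgroup.m_closed [OF K kk(1) c(1)], of "i + j"] by simp
    also have "\<dots> = f k \<otimes>\<^bsub>H\<^esub> (f c \<otimes>\<^bsub>H\<^esub> y [^]\<^bsub>H\<^esub> i) \<otimes>\<^bsub>H\<^esub> y [^]\<^bsub>H\<^esub> j"
      using fm [OF kk(1) c(1)] fc kk c(1) y by (simp add: H.m_assoc H.nat_pow_mult [symmetric])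
    also have "\<dots> = (f k \<otimes>\<^bsub>H\<^esub> y [^]\<^bsub>H\<^esub> i) \<otimes>\<^bsub>H\<^esub> (f k' \<otimes>\<^bsub>H\<^esub> y [^]\<^bsub>H\<^esub> j)"
      unfolding c(2) using fc kk y by (simp add: H.m_assoc)
    finally show ?thesis using f'eq kk by simp
  qed
  show ?thesis by (intro exI [of _ f'] conjI ballI allI f'eq f'm)
qed

text \<open>Reducing exponents modulo the group order turns the integer coordinates of a Jordan
  basis into the natural exponents of \<open>extend_hom\<close>.\<close>

lemma (in group) int_pow_eq_nat_pow:
  assumes "finite (carrier G)" "x \<in> carrier G"
  shows "\<exists>j::nat. x [^] (i::int) = x [^] j"
proof -
  have ord: "x [^] int (order G) = \<one>"
    using pow_order_eq_1 [OF assms(2)] by (simp add: int_pow_int)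
  have "order G > 0" using assms(1) order_gt_0_iff_finite by blast
  then have nn: "0 \<le> i mod int (order G)" by simp
  have "i = int (order G) * (i div int (order G)) + i mod int (order G)" by simp
  then have "x [^] i = x [^] (int (order G) * (i div int (order G))) \<otimes> x [^] (i mod int (order G))"
    using assms(2) by (metis int_pow_mult)
  also have "x [^] (int (order G) * (i div int (order G))) = (x [^] int (order G)) [^] (i div int (order G))"
    using assms(2) by (simp only: int_pow_pow)
  also have "\<dots> = \<one>" unfolding ord by simp
  finally have "x [^] i = x [^] (i mod int (order G))" using assms(2) by simp
  also have "\<dots> = x [^] nat (i mod int (order G))" by (rule pow_nat [OF nn, symmetric])
  finally show ?thesis by blast
qed

context central_endo
begin

section \<open>The filtration of G by the tails of a Jordan basis\<close>

lemma chainsD: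
  assumes "chains N Z b"
  shows "0 \<in> Z" "\<And>l. N \<le> l \<Longrightarrow> l \<in> Z" "\<And>l. b l \<in> carrier G"
    and "\<And>l. l < N \<Longrightarrow> Suc l \<in> Z \<Longrightarrow> \<phi> (b l) \<in> D"
    and "\<And>l. l < N \<Longrightarrow> Suc l \<notin> Z \<Longrightarrow> \<phi> (b l) = b (Suc l)"
    and "\<And>m. evq b N m = \<one>\<^bsub>Q\<^esub> \<Longrightarrow> \<exists>w. \<forall>l<N. m l = int p * w l - int e * shift Z w l"
  using assms unfolding chains_def by (auto split: if_splits)

lemma phiQ_ev:
  assumes c: "chains N Z b"
  shows "phiQ (evq b N m) = evq b N (shift Z m)"
proof -
  note c = chainsD [OF c]
  have qb: "q (b l) \<in> carrier Q" for l by (rule q.hom_closed [OF c(3)])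
  \<comment> \<open>Shifting lengthens a prefix by one position. At l = N the extra coefficient is 0
    because N lies in Z.\<close>
  have "phiQ (evq b l m) = evq b (Suc l) (shift Z m)" if "l \<le> N" for l
    using that
  proof (induction l)
    case 0
    have "shift Z m 0 = 0" using c(1) by (simp add: shift_def)
    then show ?case using qb Q.phi.hom_one by (simp del: one_FactGroup mult_FactGroup)
  next
    case (Suc l)
    have "phiQ (q (b l)) [^]\<^bsub>Q\<^esub> m l = q (b (Suc l)) [^]\<^bsub>Q\<^esub> shift Z m (Suc l)"
    proof (cases "Suc l \<in> Z")
      case True
      have "q (\<phi> (b l)) = \<one>\<^bsub>Q\<^esub>" using c(4) [of l] True Suc.prems q_one_iff [of "\<phi> (b l)"] c(3) by simp
      then show ?thesis using True c(3) by (simp add: phiQ_q shift_def del: one_FactGroup)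
    next
      case False
      then show ?thesis using c(3,5) [of l] Suc.prems by (simp add: phiQ_q shift_def)
    qed
    moreover have "phiQ (evq b (Suc l) m)
        = phiQ (evq b l m) \<otimes>\<^bsub>Q\<^esub> phiQ (q (b l)) [^]\<^bsub>Q\<^esub> m l"
      using Q.ev_closed [OF qb] qb by (simp add: Q.phi.hom_int_pow del: one_FactGroup mult_FactGroup)
    ultimately show ?case using Suc by simp
  qed
  from this [of N] show ?thesis
    using c(2) [of N] Q.ev_closed [OF qb] qb by (simp add: shift_def del: one_FactGroup mult_FactGroup)
qed

text \<open>For a generating Jordan basis the tails run from G at l = 0 down to \<open>D\<close> at
  l = N, one basis element per step. They are stable under \<open>\<phi>\<close> because it moves
  coefficients to higher positions.\<close>

definition tail :: "nat \<Rightarrow> (nat \<Rightarrow> 'a) \<Rightarrow> nat \<Rightarrow> 'a set" where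
  "tail N b l = {g \<in> carrier G. \<exists>m. (\<forall>j<l. m j = 0) \<and> q g = evq b N m}"

lemma tail_subgroup:
  assumes c: "chains N Z b"
  shows "subgroup (tail N b l) G"
proof (rule subgroupI)
  have qb: "q (b l) \<in> carrier Q" for l by (rule q.hom_closed [OF chainsD(3) [OF c]])
  show "tail N b l \<subseteq> carrier G" by (auto simp: tail_def)
  have "\<one> \<in> tail N b l"
    unfolding tail_def using q.hom_one by (auto simp del: one_FactGroup intro!: exI [of _ "\<lambda>_. 0"])
  then show "tail N b l \<noteq> {}" by blast
  fix g assume "g \<in> tail N b l"
  then obtain m where g: "g \<in> carrier G" "\<forall>j<l. m j = 0" "q g = evq b N m"
    unfolding tail_def by blast
  have "q (inv g) = evq b N (\<lambda>j. - m j)"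
    using g q.hom_inv [OF g(1)] Q.ev_minus [OF qb] by simp
  then show "inv g \<in> tail N b l"
    unfolding tail_def using g(1,2) by (auto intro!: exI [of _ "\<lambda>j. - m j"])
  fix h assume "h \<in> tail N b l"
  then obtain m' where h: "h \<in> carrier G" "\<forall>j<l. m' j = 0" "q h = evq b N m'"
    unfolding tail_def by blast
  have "q (g \<otimes> h) = evq b N (\<lambda>j. m j + m' j)"
    using g h q.hom_mult [OF g(1) h(1)] Q.ev_add [OF qb] by simp
  then show "g \<otimes> h \<in> tail N b l"
    unfolding tail_def using g(1,2) h(1,2) by (auto intro!: exI [of _ "\<lambda>j. m j + m' j"])
qed

lemma D_tail: "c \<in> D \<Longrightarrow> c \<in> tail N b l"
  unfolding tail_def using q_one_iff [of c] D_carrier [of c]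
  by (auto simp del: one_FactGroup intro!: exI [of _ "\<lambda>_. 0"])

lemma b_tail:
  assumes c: "chains N Z b" and "l \<le> j" "j < N"
  shows "b j \<in> tail N b l"
proof -
  have bc: "b l \<in> carrier G" for l by (rule chainsD(3) [OF c])
  have "evq b N (\<lambda>l. if l = j then 1 else 0) = q (b j) [^]\<^bsub>Q\<^esub> (1::int)"
    using assms(3) q.hom_closed [OF bc] by (intro Q.ev_unit)
  then have "q (b j) = evq b N (\<lambda>l. if l = j then 1 else 0)"
    using q.hom_closed [OF bc, of j] by simp
  then show ?thesis
    unfolding tail_def using bc assms(2)
    by (auto intro!: exI [of _ "\<lambda>l. if l = j then 1 else 0"])
qed

lemma phi_tail:
  assumes c: "chains N Z b" and g: "g \<in> tail N b l"
  shows "\<phi> g \<in> tail N b l"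
proof -
  obtain m where m: "g \<in> carrier G" "\<forall>j<l. m j = 0" "q g = evq b N m"
    using g unfolding tail_def by blast
  have "q (\<phi> g) = evq b N (shift Z m)"
    using phiQ_ev [OF c, of m] m phiQ_q [OF m(1)] by simp
  moreover have "\<forall>j<l. shift Z m j = 0"
    using m(2) chainsD(1) [OF c] by (auto simp: shift_def)
  ultimately show ?thesis unfolding tail_def using m(1) by auto
qed

lemma tail_conj:
  assumes c: "chains N Z b" and g: "g \<in> tail N b l" and x: "x \<in> carrier G"
  shows "x \<otimes> g \<otimes> inv x \<in> tail N b l"
proof -
  have gc: "g \<in> carrier G" using g by (simp add: tail_def)
  have "x \<otimes> g \<otimes> inv x = gcom G x g \<otimes> g" using x gc by (simp add: gcom_def word_simps)
  then show ?thesis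
    using subgroup.m_closed [OF tail_subgroup [OF c] D_tail [OF gcom_in_derived [OF x gc]] g] by simp
qed

lemma tail_end: "g \<in> tail N b N \<Longrightarrow> g \<in> D"
proof -
  assume "g \<in> tail N b N"
  then obtain m where m: "g \<in> carrier G" "\<forall>j<N. m j = 0" "q g = evq b N m"
    unfolding tail_def by blast
  have "evq b N m = evq b N (\<lambda>_. 0)" by (rule ev_cong) (use m(2) in auto)
  then have "q g = \<one>\<^bsub>Q\<^esub>" using m(3) by simp
  then show ?thesis using q_one_iff [OF m(1)] by simp
qed

text \<open>The vector with entry i at l, minus a vector supported above l, is a relation (p - e
  t)w. Its entries below l vanish, which forces w to vanish there, from left to right. So nothing is
  carried into position l, and i = p w_l.\<close>

lemma tail_pow_dvd:
  assumes c: "chains N Z b" and l: "l < N" and i: "b l [^] (i::nat) \<in> tail N b (Suc l)"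
  shows "p dvd i"
proof -
  have bc: "b l \<in> carrier G" for l by (rule chainsD(3) [OF c])
  have qb: "q (b l) \<in> carrier Q" for l by (rule q.hom_closed [OF bc])
  obtain m where m: "\<forall>j<Suc l. m j = 0" "q (b l [^] i) = evq b N m"
    using i unfolding tail_def by blast
  define u where "u = (\<lambda>j. if j = l then int i else 0)"
  have "evq b N u = q (b l) [^]\<^bsub>Q\<^esub> int i"
    unfolding u_def by (rule Q.ev_unit [OF qb l])
  then have "evq b N u = evq b N m"
    using m(2) q.hom_nat_pow [OF bc, of l i] by (simp add: int_pow_int)
  then have "evq b N (\<lambda>j. u j - m j) = \<one>\<^bsub>Q\<^esub>"
    unfolding Q.ev_diff [OF qb] using Q.ev_closed [of "\<lambda>l. q (b l)" N m] qb by (simp only: q.H.r_inv)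
  from chainsD(6) [OF c this]
  obtain w where w: "\<forall>j<N. u j - m j = int p * w j - int e * shift Z w j" by blast
  have w0: "w j = 0" if "j < l" for j
    using that
  proof (induction j)
    case 0
    then have "int p * w 0 = 0"
      using w [rule_format, of 0] m(1) l chainsD(1) [OF c] by (simp add: u_def shift_def)
    then show ?case using p by auto
  next
    case (Suc j)
    then have "int p * w (Suc j) = 0"
      using w [rule_format, of "Suc j"] m(1) l by (simp add: u_def shift_def split: if_splits)
    then show ?case using p by auto
  qed
  have "shift Z w l = 0" using w0 [of "l - 1"] chainsD(1) [OF c] by (cases l) (auto simp: shift_def)
  then have "int i = int p * w l" using w [rule_format, OF l] m(1) by (simp add: u_def)
  then show ?thesis by (metis dvd_triv_left int_dvd_int_iff)
qed

lemma tail_decomp: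
  assumes c: "chains N Z b" and l: "l < N" and g: "g \<in> tail N b l"
  shows "\<exists>k \<in> tail N b (Suc l). \<exists>i::nat. g = k \<otimes> b l [^] i"
proof -
  have bc: "b l \<in> carrier G" for l by (rule chainsD(3) [OF c])
  have qb: "q (b l) \<in> carrier Q" for l by (rule q.hom_closed [OF bc])
  obtain m where m: "g \<in> carrier G" "\<forall>j<l. m j = 0" "q g = evq b N m"
    using g unfolding tail_def by blast
  obtain i :: nat where i: "b l [^] m l = b l [^] i" using int_pow_eq_nat_pow [OF fin bc] by blast
  define u where "u = (\<lambda>j. if j = l then m l else 0)"
  define k where "k = g \<otimes> inv (b l [^] m l)"
  have kc: "k \<in> carrier G" using m(1) bc by (simp add: k_def)
  have "q k = q g \<otimes>\<^bsub>Q\<^esub> inv\<^bsub>Q\<^esub> (q (b l) [^]\<^bsub>Q\<^esub> m l)"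
    unfolding k_def using m(1) bc by (simp only: q.hom_mult q.hom_inv q.hom_int_pow inv_closed int_pow_closed)
  also have "q (b l) [^]\<^bsub>Q\<^esub> m l = evq b N u"
    unfolding u_def by (rule Q.ev_unit [OF qb l, symmetric])
  also have "q g \<otimes>\<^bsub>Q\<^esub> inv\<^bsub>Q\<^esub> (evq b N u) = evq b N (\<lambda>j. m j - u j)"
    unfolding m(3) by (rule Q.ev_diff [OF qb, symmetric])
  finally have "k \<in> tail N b (Suc l)"
    unfolding tail_def using kc m(2) by (auto simp: u_def less_Suc_eq intro!: exI [of _ "\<lambda>j. m j - u j"])
  moreover have "g = k \<otimes> b l [^] i" using m(1) bc unfolding i [symmetric] by (simp add: k_def m_assoc)
  ultimately show ?thesis by blast
qed

end

section \<open>Linked pairs of the same type are isomorphic\<close>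

locale rigid_linking = linking G H p n e e \<phi> \<chi> \<theta>
  for G :: "('a, 'c) monoid_scheme" (structure) and H :: "('b, 'd) monoid_scheme"
    and p n e :: nat and \<phi> \<chi> \<theta>
begin

lemma theta_pow: "x \<in> carrier G \<Longrightarrow> \<exists>w \<in> carrier H. \<theta> (x [^] (i::nat)) = \<theta> x [^]\<^bsub>H\<^esub> i \<cdot> \<chi> w"
proof (induction i)
  case 0
  then show ?case by (intro bexI [of _ "\<one>\<^bsub>H\<^esub>"]) simp_all
next
  case (Suc i)
  then obtain w where w: "w \<in> carrier H" "\<theta> (x [^] i) = \<theta> x [^]\<^bsub>H\<^esub> i \<cdot> \<chi> w" by blast
  obtain v where v: "v \<in> carrier H" "\<theta> (x [^] i \<otimes> x) = \<theta> (x [^] i) \<cdot> \<theta> x \<cdot> \<chi> v"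
    using theta_mult [of "x [^] i" x] Suc.prems by auto
  have "\<theta> (x [^] Suc i) = \<theta> x [^]\<^bsub>H\<^esub> i \<cdot> (\<chi> w \<cdot> \<theta> x) \<cdot> \<chi> v"
    using v w Suc.prems by (simp add: H.m_assoc)
  also have "\<chi> w \<cdot> \<theta> x = \<theta> x \<cdot> \<chi> w" by (rule H.phi_central) (use w Suc.prems in simp_all)
  also have "\<theta> x [^]\<^bsub>H\<^esub> i \<cdot> (\<theta> x \<cdot> \<chi> w) \<cdot> \<chi> v = \<theta> x [^]\<^bsub>H\<^esub> Suc i \<cdot> \<chi> (w \<cdot> v)"
    using v w Suc.prems by (simp add: H.m_assoc)
  finally show ?case using v w by (intro bexI [of _ "w \<cdot> v"]) simp_all
qed

text \<open>A homomorphism that straightens \<open>\<theta>\<close> on a tail. Agreement with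
  \<open>\<theta>\<close> on \<open>G.D\<close> and on the basis elements of the tail fixes the
  images of commutators and of \<open>\<phi> (b j)\<close> for the next basis element, which the
  next extension has to match.\<close>

definition lift :: "nat \<Rightarrow> (nat \<Rightarrow> 'a) \<Rightarrow> nat \<Rightarrow> ('a \<Rightarrow> 'b) \<Rightarrow> bool" where
  "lift N b l f \<longleftrightarrow>
    (\<forall>k \<in> G.tail N b l. \<forall>k' \<in> G.tail N b l. f (k \<otimes> k') = f k \<cdot> f k') \<and>
    (\<forall>k \<in> G.tail N b l. \<exists>w \<in> carrier H. f k = \<theta> k \<cdot> \<chi> w) \<and>
    (\<forall>c \<in> G.D. f c = \<theta> c) \<and>
    (\<forall>j. l \<le> j \<and> j < N \<longrightarrow> f (b j) = \<theta> (b j)) \<and>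
    (\<forall>k \<in> G.tail N b l. f (\<phi> k) = \<chi> (f k))"

lemma lift_base: "lift N b N \<theta>"
  unfolding lift_def
proof (intro conjI ballI allI impI)
  fix k assume "k \<in> G.tail N b N"
  then have k: "k \<in> G.D" by (rule G.tail_end)
  show "\<theta> (k \<otimes> k') = \<theta> k \<cdot> \<theta> k'" if "k' \<in> G.tail N b N" for k'
    by (rule theta_derived [OF G.D_carrier [OF k] G.tail_end [OF that]])
  show "\<exists>w \<in> carrier H. \<theta> k = \<theta> k \<cdot> \<chi> w"
    using G.D_carrier [OF k] by (intro bexI [of _ "\<one>\<^bsub>H\<^esub>"]) simp_all
  show "\<theta> (\<phi> k) = \<chi> (\<theta> k)" by (rule theta_phi [OF G.D_carrier [OF k]])
qed simp_all

text \<open>The new basis element goes to its image under \<open>\<theta>\<close>. The relation for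
  the p-th power survives because both pairs have the same e: x^p = \<phi>(x)^e goes to \<chi>(y)^e
  = y^p. The relations for conjugation survive because \<open>\<theta>\<close> respects commutators
  and the defect of \<open>f\<close> is central.\<close>

lemma lift_step:
  assumes c: "G.chains N Z b" and l: "l < N" and f: "lift N b (Suc l) f"
  shows "\<exists>f'. lift N b l f'"
proof -
  let ?K = "G.tail N b (Suc l)"
  define x where "x = b l"
  define y where "y = \<theta> x"
  note cD = G.chainsD [OF c]
  have x: "x \<in> carrier G" unfolding x_def by (rule cD(3))
  have y: "y \<in> carrier H" unfolding y_def using x by simp
  have K: "subgroup ?K G" by (rule G.tail_subgroup [OF c])
  have Kc: "k \<in> carrier G" if "k \<in> ?K" for k by (rule subgroup.mem_carrier [OF K that])
  have fm: "f (k \<otimes> k') = f k \<cdot> f k'" if "k \<in> ?K" "k' \<in> ?K" for k k'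
    using f that unfolding lift_def by simp
  have fw: "\<exists>w \<in> carrier H. f k = \<theta> k \<cdot> \<chi> w" if "k \<in> ?K" for k
    using f that unfolding lift_def by simp
  have fD: "f c = \<theta> c" if "c \<in> G.D" for c
    using f that unfolding lift_def by simp
  have fb: "f (b j) = \<theta> (b j)" if "Suc l \<le> j" "j < N" for j
    using f that unfolding lift_def by simp
  have fphi: "f (\<phi> k) = \<chi> (f k)" if "k \<in> ?K" for k
    using f that unfolding lift_def by simp
  have fc: "f k \<in> carrier H" if "k \<in> ?K" for k
    using fw [OF that] Kc [OF that] by auto
  have fpow: "f (k [^] i) = f k [^]\<^bsub>H\<^esub> i" if k: "k \<in> ?K" for k and i :: nat
  proof (induction i)
    case 0
    have "\<one> \<in> G.D" by (rule subgroup.one_closed [OF G.D_subgroup])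
    then show ?case using fD by simp
  next
    case (Suc i)
    then show ?case using fm [OF G.subgroup_nat_pow_closed [OF K k] k] by simp
  qed
  \<comment> \<open>\<open>\<phi> x\<close> lies in the derived subgroup at a chain end and is the
    next basis element otherwise; at both places \<open>f\<close> coincides with
    \<open>\<theta>\<close>.\<close>
  have phix: "\<phi> x \<in> ?K \<and> f (\<phi> x) = \<chi> y"
  proof (cases "Suc l \<in> Z")
    case True
    then have d: "\<phi> x \<in> G.D" unfolding x_def by (rule cD(4) [OF l])
    then show ?thesis using G.D_tail [OF d] fD [OF d] theta_phi [OF x] by (simp add: y_def)
  next
    case False
    then have eq: "\<phi> x = b (Suc l)" unfolding x_def by (rule cD(5) [OF l])
    have sl: "Suc l < N" using False cD(2) [of "Suc l"] by (meson not_le)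
    then show ?thesis
      using G.b_tail [OF c order_refl sl] fb [OF order_refl sl] theta_phi [OF x] eq by (simp add: y_def)
  qed
  have xp: "x [^] p \<in> ?K"
    unfolding G.phi_pow [OF x] using phix by (intro G.subgroup_nat_pow_closed [OF K]) simp
  have fp: "f (x [^] p) = y [^]\<^bsub>H\<^esub> p"
    unfolding G.phi_pow [OF x] H.phi_pow [OF y] using phix fpow by simp
  have conj: "x \<otimes> k \<otimes> inv x \<in> ?K" if "k \<in> ?K" for k
    by (rule G.tail_conj [OF c that x])
  have fconj: "f (x \<otimes> k \<otimes> inv x) \<cdot> y = y \<cdot> f k" if k: "k \<in> ?K" for k
  proof -
    have kc: "k \<in> carrier G" by (rule Kc [OF k])
    have d: "gcom G x k \<in> G.D" by (rule G.gcom_in_derived [OF x kc])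
    obtain w where w: "w \<in> carrier H" "f k = \<theta> k \<cdot> \<chi> w" using fw [OF k] by blast
    have tk: "\<theta> k \<in> carrier H" using kc by simp
    have "x \<otimes> k \<otimes> inv x = gcom G x k \<otimes> k"
      using x kc by (simp add: gcom_def G.word_simps)
    then have "f (x \<otimes> k \<otimes> inv x) = gcom H y (\<theta> k) \<cdot> f k"
      using fm [OF G.D_tail [OF d] k] fD [OF d] theta_gcom [OF x kc] by (simp add: y_def)
    then have "f (x \<otimes> k \<otimes> inv x) \<cdot> y = gcom H y (\<theta> k) \<cdot> (\<theta> k \<cdot> (\<chi> w \<cdot> y))"
      using w tk y by (simp add: H.m_assoc)
    also have "\<chi> w \<cdot> y = y \<cdot> \<chi> w" by (rule H.phi_central [OF w(1) y])
    also have "gcom H y (\<theta> k) \<cdot> (\<theta> k \<cdot> (y \<cdot> \<chi> w)) = (gcom H y (\<theta> k) \<cdot> (\<theta> k \<cdot> y)) \<cdot> \<chi> w"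
      using w(1) tk y by (simp add: H.m_assoc)
    also have "\<dots> = y \<cdot> f k"
      unfolding H.gcom_mult [OF y tk] w(2) using w(1) tk y by (simp add: H.m_assoc)
    finally show ?thesis .
  qed
  have dv: "p dvd i" if "x [^] i \<in> ?K" for i :: nat
    using G.tail_pow_dvd [OF c l] that unfolding x_def by blast
  obtain f' where f'1: "\<forall>k \<in> ?K. \<forall>i::nat. f' (k \<otimes> x [^] i) = f k \<cdot> y [^]\<^bsub>H\<^esub> i"
    and f'2: "\<forall>k \<in> ?K. \<forall>k' \<in> ?K. \<forall>(i::nat) (j::nat).
      f' ((k \<otimes> x [^] i) \<otimes> (k' \<otimes> x [^] j)) = f' (k \<otimes> x [^] i) \<cdot> f' (k' \<otimes> x [^] j)"
    using G.extend_hom [OF H.is_group K x y conj fc fm xp dv fp fconj] by metis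
  have f'K: "f' k = f k" if "k \<in> ?K" for k
    using f'1 [rule_format, OF that, of 0] Kc [OF that] fc [OF that] by simp
  have dec: "\<exists>k \<in> ?K. \<exists>i::nat. g = k \<otimes> x [^] i" if "g \<in> G.tail N b l" for g
    unfolding x_def by (rule G.tail_decomp [OF c l that])
  have "lift N b l f'"
    unfolding lift_def
  proof (intro conjI ballI allI impI)
    fix g assume "g \<in> G.tail N b l"
    then obtain k and i :: nat where k: "k \<in> ?K" "g = k \<otimes> x [^] i" using dec by blast
    have fg: "f' g = f k \<cdot> y [^]\<^bsub>H\<^esub> i" using f'1 k by simp
    show "f' (g \<otimes> g') = f' g \<cdot> f' g'" if g': "g' \<in> G.tail N b l" for g'
    proof -
      from dec [OF g'] obtain k' and j :: nat
        where k': "k' \<in> ?K" "g' = k' \<otimes> x [^] j" by blast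
      show ?thesis unfolding k(2) k'(2) by (rule f'2 [rule_format, OF k(1) k'(1)])
    qed
    show "\<exists>w \<in> carrier H. f' g = \<theta> g \<cdot> \<chi> w"
    proof -
      obtain w1 where w1: "w1 \<in> carrier H" "f k = \<theta> k \<cdot> \<chi> w1" using fw [OF k(1)] by blast
      obtain w2 where w2: "w2 \<in> carrier H" "\<theta> (x [^] i) = y [^]\<^bsub>H\<^esub> i \<cdot> \<chi> w2"
        using theta_pow [OF x, of i] unfolding y_def by blast
      obtain w3 where w3: "w3 \<in> carrier H" "\<theta> g = \<theta> k \<cdot> \<theta> (x [^] i) \<cdot> \<chi> w3"
        using theta_mult [OF Kc [OF k(1)] G.nat_pow_closed [OF x, of i]] unfolding k(2) by blast
      have tk: "\<theta> k \<in> carrier H" using Kc [OF k(1)] by simp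
      have yi: "y [^]\<^bsub>H\<^esub> i \<in> carrier H" using y by simp
      \<comment> \<open>\<open>w1\<close> is the defect of \<open>f\<close> at k, \<open>w2\<close>
        and \<open>w3\<close> are those of \<open>\<theta>\<close> at the power and at the
        product.\<close>
      let ?w = "inv\<^bsub>H\<^esub> (w2 \<cdot> w3) \<cdot> w1"
      have "\<theta> g \<cdot> \<chi> ?w = \<theta> k \<cdot> y [^]\<^bsub>H\<^esub> i \<cdot> \<chi> (w2 \<cdot> w3) \<cdot> \<chi> ?w"
        using w3 w2 tk yi by (simp add: H.m_assoc)
      also have "\<dots> = \<theta> k \<cdot> y [^]\<^bsub>H\<^esub> i \<cdot> (\<chi> (w2 \<cdot> w3) \<cdot> \<chi> ?w)"
        using w1(1) w2(1) w3(1) tk yi by (simp add: H.m_assoc del: H.phi.hom_mult)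
      also have "\<chi> (w2 \<cdot> w3) \<cdot> \<chi> ?w = \<chi> w1"
        using w1(1) w2(1) w3(1) by (simp add: H.phi.hom_mult [symmetric] H.r_cancel_inv del: H.phi.hom_mult)
      also have "\<theta> k \<cdot> y [^]\<^bsub>H\<^esub> i \<cdot> \<chi> w1 = \<theta> k \<cdot> (\<chi> w1 \<cdot> y [^]\<^bsub>H\<^esub> i)"
        using w1(1) tk yi H.phi_central [OF w1(1) yi] by (simp add: H.m_assoc)
      also have "\<dots> = f' g" unfolding fg w1(2) using w1(1) tk yi by (simp add: H.m_assoc)
      finally show ?thesis using w1 w2 w3 by (intro bexI [of _ ?w]) simp_all
    qed
    show "f' (\<phi> g) = \<chi> (f' g)"
    proof -
      have kk: "\<phi> k \<in> ?K" by (rule G.phi_tail [OF c k(1)])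
      have xi: "\<phi> x [^] i \<in> ?K" by (rule G.subgroup_nat_pow_closed [OF K]) (use phix in simp)
      have "\<phi> g = \<phi> k \<otimes> \<phi> x [^] i"
        using k(2) Kc [OF k(1)] x by (simp add: G.phi.hom_nat_pow)
      then have "f' (\<phi> g) = f (\<phi> k) \<cdot> f (\<phi> x) [^]\<^bsub>H\<^esub> i"
        using f'K [OF subgroup.m_closed [OF K kk xi]] fm [OF kk xi] fpow phix by simp
      also have "\<dots> = \<chi> (f' g)"
        unfolding fg using fphi [OF k(1)] phix fc [OF k(1)] y by (simp add: H.phi.hom_nat_pow)
      finally show ?thesis .
    qed
  next
    fix d assume d: "d \<in> G.D"
    show "f' d = \<theta> d" using f'K [OF G.D_tail [OF d]] fD [OF d] by simp
  next
    fix j assume j: "l \<le> j \<and> j < N"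
    show "f' (b j) = \<theta> (b j)"
    proof (cases "j = l")
      case True
      have one: "\<one> \<in> ?K" by (rule subgroup.one_closed [OF K])
      have "f \<one> = \<one>\<^bsub>H\<^esub>" using fD [OF subgroup.one_closed [OF G.D_subgroup]] by simp
      then have "f' x = y" using f'1 [rule_format, OF one, of 1] x y by simp
      then show ?thesis using True by (simp add: x_def y_def)
    next
      case False
      then show ?thesis using j f'K [OF G.b_tail [OF c, of "Suc l" j]] fb [of j] by simp
    qed
  qed
  then show ?thesis by blast
qed

text \<open>At l = 0 the straightened map is a homomorphism on all of G that agrees with
  \<open>\<theta>\<close> modulo the image of \<open>\<chi>\<close>. Nilpotency of
  \<open>\<chi>\<close> makes it onto, and equal finite orders make it injective.\<close>

theorem rigidity: "\<exists>f \<in> iso G H. \<forall>x \<in> carrier G. f (\<phi> x) = \<chi> (f x)"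
proof -
  obtain N Z b where c: "G.chains N Z b"
    and surj: "\<forall>x \<in> carrier G. \<exists>m. G.q x = G.evq b N m"
    using G.chains_exist by (elim exE conjE) (rule that; assumption)
  have "\<exists>f. lift N b (N - i) f" for i
  proof (induction i)
    case 0
    then show ?case using lift_base by auto
  next
    case (Suc i)
    show ?case
    proof (cases "i < N")
      case True
      then have "N - i = Suc (N - Suc i)" by simp
      moreover have "N - Suc i < N" using True by simp
      ultimately show ?thesis using Suc lift_step [OF c] by metis
    next
      case False
      then show ?thesis using Suc by simp
    qed
  qed
  from this [of N] obtain f where f: "lift N b 0 f" by auto
  have tail0: "G.tail N b 0 = carrier G" unfolding G.tail_def using surj by auto
  have fm: "f (x \<otimes> y) = f x \<cdot> f y" if "x \<in> carrier G" "y \<in> carrier G" for x y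
    using f that unfolding lift_def tail0 by simp
  have fw: "\<exists>w \<in> carrier H. f x = \<theta> x \<cdot> \<chi> w" if "x \<in> carrier G" for x
    using f that unfolding lift_def tail0 by simp
  have fphi: "f (\<phi> x) = \<chi> (f x)" if "x \<in> carrier G" for x
    using f that unfolding lift_def tail0 by simp
  have fc: "f x \<in> carrier H" if "x \<in> carrier G" for x
    using fw [OF that] that by auto
  have hom: "f \<in> hom G H" by (rule homI) (use fc fm in auto)
  \<comment> \<open>Each u is f(x) times some \<chi>(w). Applying this to w in turn, and using that
    f commutes with the operators, pushes the error into the image of \<open>\<chi> ^^ j\<close>; at
    j = n it is trivial.\<close>
  have step: "\<exists>x \<in> carrier G. \<exists>w \<in> carrier H. u = f x \<cdot> (\<chi> ^^ j) w" if "u \<in> carrier H" for u j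
    using that
  proof (induction j arbitrary: u)
    case 0
    obtain x where x: "x \<in> carrier G" "u = \<theta> x" using theta_surj 0 by blast
    obtain w where w: "w \<in> carrier H" "f x = \<theta> x \<cdot> \<chi> w" using fw [OF x(1)] by blast
    have "u = f x \<cdot> inv\<^bsub>H\<^esub> (\<chi> w)" using x w by (simp add: H.m_assoc)
    then show ?case using x w by (intro bexI [of _ x] bexI [of _ "inv\<^bsub>H\<^esub> (\<chi> w)"]) simp_all
  next
    case (Suc j)
    obtain x where x: "x \<in> carrier G" "u = \<theta> x" using theta_surj Suc.prems by blast
    obtain w where w: "w \<in> carrier H" "f x = \<theta> x \<cdot> \<chi> w" using fw [OF x(1)] by blast
    have u: "u = f x \<cdot> \<chi> (inv\<^bsub>H\<^esub> w)" using x w by (simp add: H.m_assoc)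
    obtain x' v where v: "x' \<in> carrier G" "v \<in> carrier H" "inv\<^bsub>H\<^esub> w = f x' \<cdot> (\<chi> ^^ j) v"
      using Suc.IH [of "inv\<^bsub>H\<^esub> w"] w(1) by auto
    have "\<chi> (inv\<^bsub>H\<^esub> w) = f (\<phi> x') \<cdot> (\<chi> ^^ Suc j) v"
      unfolding v(3) fphi [OF v(1)] using v fc [OF v(1)] by (simp add: H.phi.hom_mult)
    then have "u = f (x \<otimes> \<phi> x') \<cdot> (\<chi> ^^ Suc j) v"
      unfolding u using x(1) v(1,2) fc [OF x(1)] fc [of "\<phi> x'"] fm [OF x(1), of "\<phi> x'"]
        H.funpow_closed [OF v(2), of "Suc j"] by (simp add: H.m_assoc del: funpow.simps)
    then show ?case using x(1) v(1,2) by (intro bexI [of _ "x \<otimes> \<phi> x'"] bexI [of _ v]) simp_all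
  qed
  have onto: "f ` carrier G = carrier H"
  proof
    show "f ` carrier G \<subseteq> carrier H" using fc by blast
    show "carrier H \<subseteq> f ` carrier G"
    proof
      fix u assume u: "u \<in> carrier H"
      obtain x w where xw: "x \<in> carrier G" "w \<in> carrier H" "u = f x \<cdot> (\<chi> ^^ n) w"
        using step [OF u, of n] by blast
      then have "u = f x" using H.phi_nil [OF xw(2)] fc [OF xw(1)] by simp
      then show "u \<in> f ` carrier G" using xw(1) by blast
    qed
  qed
  have "card (carrier G) = card (carrier H)" by (rule bij_betw_same_card [OF bij])
  then have "inj_on f (carrier G)" using onto G.fin by (simp add: eq_card_imp_inj_on)
  then have "f \<in> iso G H" using hom onto by (simp add: iso_def bij_betw_def)
  then show ?thesis using fphi by blast
qed

end

section \<open>Changing the type of a pair\<close>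

locale twist = central_endo G p n e \<phi> for G :: "('a, 'c) monoid_scheme" (structure) and p n e \<phi> +
  fixes N :: nat and Z :: "nat set" and b :: "nat \<Rightarrow> 'a" and e' :: nat
  assumes chains: "chains N Z b"
    and chains_surj: "\<And>x. x \<in> carrier G \<Longrightarrow> \<exists>m. q x = evq b N m"
begin

lemmas cD = chainsD [OF chains]

lemma qb: "q (b l) \<in> carrier Q"
  by (rule q.hom_closed [OF cD(3)])

section \<open>Normal forms of integer vectors modulo p - d t\<close>

abbreviation Ev :: "(nat \<Rightarrow> int) \<Rightarrow> 'a set" where "Ev \<equiv> evq b N"

definition M :: "(nat \<Rightarrow> int) set" where "M = {m. \<forall>l\<ge>N. m l = 0}"

text \<open>Multiplication by p - d t, where t acts as \<open>shift Z\<close>.\<close>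

definition tw :: "nat \<Rightarrow> (nat \<Rightarrow> int) \<Rightarrow> nat \<Rightarrow> int" where
  "tw d w l = int p * w l - int d * shift Z w l"

text \<open>Digit vectors represent the classes modulo p - d t uniquely, whatever d is. That one set
  serves for both e and e' is the source of the bijection \<open>\<theta>\<close>.\<close>

definition digits :: "(nat \<Rightarrow> int) \<Rightarrow> bool" where
  "digits m \<longleftrightarrow> m \<in> M \<and> (\<forall>l. 0 \<le> m l \<and> m l < int p)"

definition s :: int where "s = int e - int e'"

lemma Ev_closed [simp]: "Ev m \<in> carrier Q"
  by (rule Q.ev_closed [OF qb])

lemma Ev_cong: "(\<And>l. l < N \<Longrightarrow> m l = m' l) \<Longrightarrow> Ev m = Ev m'"
  by (rule ev_cong) simp_all

lemma p0: "int p > 0"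
  using prime_gt_0_nat [OF p] by simp

lemma M_add: "m \<in> M \<Longrightarrow> m' \<in> M \<Longrightarrow> (\<lambda>l. m l + m' l) \<in> M"
  and M_minus: "m \<in> M \<Longrightarrow> (\<lambda>l. - m l) \<in> M"
  and M_scale: "m \<in> M \<Longrightarrow> (\<lambda>l. c * m l) \<in> M"
  and M_zero: "(\<lambda>l. 0) \<in> M"
  and M_shift: "shift Z m \<in> M"
  using cD(2) by (auto simp: M_def shift_def)

lemma M_tw: "m \<in> M \<Longrightarrow> tw d m \<in> M"
  using cD(2) by (auto simp: M_def shift_def tw_def)

lemma Ev_tw: "Ev (tw e w) = \<one>\<^bsub>Q\<^esub>"
proof -
  have "Ev (tw e w) = Ev (\<lambda>l. int p * w l) \<otimes>\<^bsub>Q\<^esub> inv\<^bsub>Q\<^esub> Ev (\<lambda>l. int e * shift Z w l)"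
    unfolding tw_def by (rule Q.ev_diff [OF qb])
  also have "Ev (\<lambda>l. int p * w l) = Ev w [^]\<^bsub>Q\<^esub> p"
    unfolding Q.ev_scale [OF qb] by (rule int_pow_int)
  also have "\<dots> = phiQ (Ev w) [^]\<^bsub>Q\<^esub> e" by (rule Q.phi_pow [OF Ev_closed])
  also have "\<dots> = Ev (\<lambda>l. int e * shift Z w l)"
    unfolding phiQ_ev [OF chains] Q.ev_scale [OF qb] by (rule int_pow_int [symmetric])
  finally show ?thesis by (simp only: q.H.r_inv Ev_closed)
qed

lemma tw_split: "tw e' w = (\<lambda>l. tw e w l + s * shift Z w l)"
  by (auto simp: tw_def s_def algebra_simps)

lemma Ev_tw': "Ev (tw e' w) = Ev (shift Z w) [^]\<^bsub>Q\<^esub> s"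
proof -
  have "Ev (tw e' w) = Ev (tw e w) \<otimes>\<^bsub>Q\<^esub> Ev (\<lambda>l. s * shift Z w l)"
    unfolding tw_split by (rule Q.ev_add [OF qb])
  then show ?thesis unfolding Ev_tw Q.ev_scale [OF qb] by (simp only: q.H.l_one q.H.int_pow_closed Ev_closed)
qed

text \<open>Long division by p - d t with remainders in 0, ..., p - 1: along each chain, d times the
  quotient at one position is carried to the next.\<close>

primrec quo :: "nat \<Rightarrow> (nat \<Rightarrow> int) \<Rightarrow> nat \<Rightarrow> int" where
  "quo d m 0 = m 0 div int p"
| "quo d m (Suc l) = (m (Suc l) + int d * (if Suc l \<in> Z then 0 else quo d m l)) div int p"

lemma quo_eq: "quo d m l = (m l + int d * shift Z (quo d m) l) div int p"
  using cD(1) by (cases l) (auto simp: shift_def)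

lemma reduce:
  assumes m: "m \<in> M"
  shows "quo d m \<in> M" "digits (\<lambda>l. m l - tw d (quo d m) l)"
proof -
  show w: "quo d m \<in> M"
    unfolding M_def
  proof (intro CollectI allI impI)
    fix l assume "N \<le> l"
    then show "quo d m l = 0" using m cD(2) [of l] quo_eq [of d m l] by (simp add: M_def shift_def)
  qed
  have "m l - tw d (quo d m) l = (m l + int d * shift Z (quo d m) l) mod int p" for l
    unfolding tw_def by (subst (1) quo_eq) (simp add: algebra_simps minus_mult_div_eq_mod [symmetric])
  moreover have "(\<lambda>l. m l - tw d (quo d m) l) \<in> M"
    using M_add [OF m M_minus [OF M_tw [OF w]]] by simp
  ultimately show "digits (\<lambda>l. m l - tw d (quo d m) l)"
    unfolding digits_def using p0 by simp
qed

lemma small_multiple: assumes "\<bar>int p * c\<bar> < int p" shows "c = 0"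
proof (rule ccontr)
  assume "c \<noteq> 0"
  then have "int p * c \<noteq> 0" using p0 by simp
  then have "\<bar>int p\<bar> \<le> \<bar>int p * c\<bar>" by (intro dvd_imp_le_int) simp_all
  then show False using assms by simp
qed

lemma digits_diff: "digits m \<Longrightarrow> digits m' \<Longrightarrow> \<bar>m l - m' l\<bar> < int p"
  unfolding digits_def by (elim conjE allE [of _ l]) linarith

text \<open>Position by position: once w vanishes at the preceding place, p w_l is a difference of
  two digits, hence smaller than p in absolute value.\<close>

lemma digits_unique:
  assumes m: "digits m" "digits m'" and eq: "\<And>l. l < N \<Longrightarrow> m l - m' l = tw d w l"
  shows "l < N \<Longrightarrow> w l = 0"
proof (induction l)
  case 0
  then have "m 0 - m' 0 = int p * w 0" using eq [of 0] cD(1) by (simp add: tw_def shift_def)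
  then show ?case using digits_diff [OF m, of 0] by (intro small_multiple) simp
next
  case (Suc l)
  then have "shift Z w (Suc l) = 0" by (simp add: shift_def)
  then have "m (Suc l) - m' (Suc l) = int p * w (Suc l)" using eq [of "Suc l"] Suc.prems by (simp add: tw_def)
  then show ?case using digits_diff [OF m, of "Suc l"] by (intro small_multiple) simp
qed

lemma Ev_kernel:
  assumes m: "m \<in> M" and "Ev m = \<one>\<^bsub>Q\<^esub>"
  shows "\<exists>w \<in> M. m = tw e w"
proof -
  obtain w where w: "\<forall>l<N. m l = int p * w l - int e * shift Z w l" using cD(6) [OF assms(2)] by blast
  \<comment> \<open>The entries of w from N on are arbitrary; clearing them gives a vector in
    \<open>M\<close>.\<close>
  define w' where "w' = (\<lambda>l. if l < N then w l else 0)"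
  have "m l = tw e w' l" for l
  proof (cases "l < N")
    case True
    then show ?thesis using w by (auto simp: tw_def w'_def shift_def)
  next
    case False
    then show ?thesis using m cD(2) [of l] by (simp add: M_def tw_def w'_def shift_def)
  qed
  moreover have "w' \<in> M" by (simp add: M_def w'_def)
  ultimately show ?thesis by (intro bexI [of _ w'] ext)
qed

lemma Ev_digits_inj:
  assumes m: "digits m" "digits m'" and "Ev m = Ev m'"
  shows "m = m'"
proof -
  have "Ev (\<lambda>l. m l - m' l) = \<one>\<^bsub>Q\<^esub>"
    unfolding Q.ev_diff [OF qb] assms(3) by (simp only: q.H.r_inv Ev_closed)
  moreover have "(\<lambda>l. m l - m' l) \<in> M"
    using M_add [of m, OF _ M_minus [of m']] m by (simp add: digits_def)
  ultimately obtain w where w: "w \<in> M" "(\<lambda>l. m l - m' l) = tw e w" using Ev_kernel by blast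
  have eq: "m l - m' l = tw e w l" for l using w(2) by (rule fun_cong)
  have "w l = 0" for l using digits_unique [OF m eq, of l] w(1) by (cases "l < N") (auto simp: M_def)
  then have "tw e w l = 0" for l by (simp add: tw_def shift_def)
  then show ?thesis using eq by (intro ext) (metis eq_iff_diff_eq_0)
qed

definition \<delta> :: "'a \<Rightarrow> nat \<Rightarrow> int" where
  "\<delta> g = (SOME m. digits m \<and> Ev m = q g)"

lemma delta_exists: assumes g: "g \<in> carrier G" shows "\<exists>m. digits m \<and> Ev m = q g"
proof -
  obtain m0 where m0: "q g = Ev m0" using chains_surj [OF g] by blast
  define m where "m = (\<lambda>l. if l < N then m0 l else 0)"
  have m: "m \<in> M" by (simp add: m_def M_def)
  have "Ev m = q g" unfolding m0 by (rule Ev_cong) (simp add: m_def)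
  then have "Ev (\<lambda>l. m l - tw e (quo e m) l) = q g"
    unfolding Q.ev_diff [OF qb] Ev_tw by (simp only: q.H.inv_one q.H.r_one q.hom_closed [OF g])
  then show ?thesis using reduce(2) [OF m, of e] by blast
qed

lemma delta: "g \<in> carrier G \<Longrightarrow> digits (\<delta> g)" "g \<in> carrier G \<Longrightarrow> Ev (\<delta> g) = q g"
  using someI_ex [OF delta_exists] unfolding \<delta>_def by blast+

lemma delta_eq: "g \<in> carrier G \<Longrightarrow> digits m \<Longrightarrow> Ev m = q g \<Longrightarrow> \<delta> g = m"
  using Ev_digits_inj delta by metis

section \<open>The fibre product and its quotient\<close>

definition F :: "('a \<times> (nat \<Rightarrow> int)) monoid" where
  "F = \<lparr>carrier = {(g, m). g \<in> carrier G \<and> m \<in> M \<and> q g = Ev m},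
    mult = \<lambda>(g, m) (h, m'). (g \<otimes> h, \<lambda>l. m l + m' l), one = (\<one>, \<lambda>l. 0)\<rparr>"

abbreviation Fmult :: "'a \<times> (nat \<Rightarrow> int) \<Rightarrow> 'a \<times> (nat \<Rightarrow> int) \<Rightarrow> 'a \<times> (nat \<Rightarrow> int)" (infixl \<open>\<cdot>\<close> 70)
  where "x \<cdot> y \<equiv> x \<otimes>\<^bsub>F\<^esub> y"

lemma F_carrier: "(g, m) \<in> carrier F \<longleftrightarrow> g \<in> carrier G \<and> m \<in> M \<and> q g = Ev m"
  by (simp add: F_def)

lemma F_carrierE:
  assumes "x \<in> carrier F"
  obtains g m where "x = (g, m)" "g \<in> carrier G" "m \<in> M" "q g = Ev m"
  using assms by (cases x) (auto simp: F_carrier)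

lemma F_mult [simp]: "(g, m) \<cdot> (h, m') = (g \<otimes> h, \<lambda>l. m l + m' l)"
  by (simp add: F_def)

lemma F_one: "\<one>\<^bsub>F\<^esub> = (\<one>, \<lambda>l. 0)"
  by (simp add: F_def)

lemma F_mem_inv: "(g, m) \<in> carrier F \<Longrightarrow> (inv g, \<lambda>l. - m l) \<in> carrier F"
  unfolding F_carrier using q.hom_inv Q.ev_minus [OF qb] M_minus by simp

lemma F_group: "group F"
proof (rule groupI)
  fix x y assume "x \<in> carrier F" "y \<in> carrier F"
  then show "x \<cdot> y \<in> carrier F"
    using q.hom_mult Q.ev_add [OF qb] M_add
    by (elim F_carrierE) (simp add: F_carrier del: mult_FactGroup)
next
  show "\<one>\<^bsub>F\<^esub> \<in> carrier F"
    using q.hom_one M_zero by (simp add: F_one F_carrier del: one_FactGroup)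
next
  fix x y z assume "x \<in> carrier F" "y \<in> carrier F" "z \<in> carrier F"
  then show "x \<cdot> y \<cdot> z = x \<cdot> (y \<cdot> z)"
    by (elim F_carrierE) (simp add: m_assoc add.assoc)
next
  fix x assume "x \<in> carrier F"
  then show "\<one>\<^bsub>F\<^esub> \<cdot> x = x" by (elim F_carrierE) (simp add: F_one)
next
  fix x assume x: "x \<in> carrier F"
  then obtain g m where gm: "x = (g, m)" "g \<in> carrier G" by (rule F_carrierE)
  have "(inv g, \<lambda>l. - m l) \<cdot> x = \<one>\<^bsub>F\<^esub>" using gm by (simp add: F_one)
  then show "\<exists>y \<in> carrier F. y \<cdot> x = \<one>\<^bsub>F\<^esub>" using F_mem_inv x gm(1) by blast
qed

sublocale F: group F by (rule F_group)

lemma F_inv: "(g, m) \<in> carrier F \<Longrightarrow> inv\<^bsub>F\<^esub> (g, m) = (inv g, \<lambda>l. - m l)"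
proof (rule F.inv_equality)
  assume gm: "(g, m) \<in> carrier F"
  show "(inv g, \<lambda>l. - m l) \<cdot> (g, m) = \<one>\<^bsub>F\<^esub>" using gm by (simp add: F_one F_carrier)
  show "(inv g, \<lambda>l. - m l) \<in> carrier F" by (rule F_mem_inv [OF gm])
qed

lemma F_nat_pow: "(g, m) \<in> carrier F \<Longrightarrow> (g, m) [^]\<^bsub>F\<^esub> (i::nat) = (g [^] i, \<lambda>l. int i * m l)"
  by (induction i) (auto simp: F_one algebra_simps)

lemma F_int_pow:
  assumes "(g, m) \<in> carrier F" shows "(g, m) [^]\<^bsub>F\<^esub> (i::int) = (g [^] i, \<lambda>l. i * m l)"
proof (cases "i < 0")
  case True
  have mem: "(g [^] nat (- i), \<lambda>l. int (nat (- i)) * m l) \<in> carrier F"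
    unfolding F_nat_pow [OF assms, symmetric] by (rule F.nat_pow_closed [OF assms])
  have eq: "(g, m) [^]\<^bsub>F\<^esub> i = inv\<^bsub>F\<^esub> ((g, m) [^]\<^bsub>F\<^esub> nat (- i))" "g [^] i = inv (g [^] nat (- i))"
    using True by (simp_all only: int_pow_def2 if_True)
  have "- (int (nat (- i)) * m l) = i * m l" for l using True by simp
  then show ?thesis unfolding eq F_nat_pow [OF assms] F_inv [OF mem] by (simp only:)
next
  case False
  then have eq: "(g, m) [^]\<^bsub>F\<^esub> i = (g, m) [^]\<^bsub>F\<^esub> nat i" "g [^] i = g [^] nat i"
    by (simp_all only: int_pow_def2 if_False)
  have "int (nat i) * m l = i * m l" for l using False by simp
  then show ?thesis unfolding eq F_nat_pow [OF assms] by (simp only:)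
qed

lemma F_gcom:
  assumes "(g, m) \<in> carrier F" "(h, m') \<in> carrier F"
  shows "gcom F (g, m) (h, m') = (gcom G g h, \<lambda>l. 0)"
  unfolding gcom_def F_inv [OF assms(1)] F_inv [OF assms(2)] F_mult by (rule prod_eqI) auto

definition phiF :: "'a \<times> (nat \<Rightarrow> int) \<Rightarrow> 'a \<times> (nat \<Rightarrow> int)" where
  "phiF x = (\<phi> (fst x), shift Z (snd x))"

text \<open>This is x^p \<phi>(x)^(-e') in closed form: in the first component g^p = \<phi>(g)^e
  leaves the exponent s = e - e', and the second is multiplication by p - e' t. In this form it is
  visibly a homomorphism with central values.\<close>

definition psi :: "'a \<times> (nat \<Rightarrow> int) \<Rightarrow> 'a \<times> (nat \<Rightarrow> int)" where
  "psi x = (\<phi> (fst x) [^] s, tw e' (snd x))"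

lemma phiF_closed: "x \<in> carrier F \<Longrightarrow> phiF x \<in> carrier F"
  by (elim F_carrierE)
    (simp add: phiF_def F_carrier M_shift phiQ_q [symmetric] phiQ_ev [OF chains])

lemma phiF_hom: "phiF \<in> hom F F"
  by (rule homI [OF phiF_closed], assumption, elim F_carrierE) (auto simp: phiF_def shift_def)

lemma psi_closed: "x \<in> carrier F \<Longrightarrow> psi x \<in> carrier F"
proof (elim F_carrierE)
  fix g m assume gm: "x = (g, m)" "g \<in> carrier G" "m \<in> M" "q g = Ev m"
  have "q (\<phi> g [^] s) = q (\<phi> g) [^]\<^bsub>Q\<^esub> s" using gm(2) by (intro q.hom_int_pow phi.hom_closed)
  also have "q (\<phi> g) = Ev (shift Z m)"
    using phiQ_q [OF gm(2)] gm(4) phiQ_ev [OF chains] by simp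
  finally show ?thesis using gm M_tw by (simp add: psi_def F_carrier Ev_tw')
qed

lemma psi_hom: "psi \<in> hom F F"
proof (rule homI [OF psi_closed])
  fix x y assume "x \<in> carrier F" "y \<in> carrier F"
  then show "psi (x \<cdot> y) = psi x \<cdot> psi y"
  proof (elim F_carrierE)
    fix g m h m' assume "x = (g, m)" "g \<in> carrier G" "y = (h, m')" "h \<in> carrier G"
    moreover from this have "(\<phi> g \<otimes> \<phi> h) [^] s = \<phi> g [^] s \<otimes> \<phi> h [^] s"
      by (intro int_pow_mult_distrib phi_central) simp_all
    ultimately show ?thesis by (auto simp: psi_def tw_def shift_def algebra_simps)
  qed
qed

sublocale psi: group_hom F F psi
  by (intro group_hom.intro group_hom_axioms.intro F_group psi_hom)

lemma phi_int_pow_central: "x \<in> carrier G \<Longrightarrow> y \<in> carrier G \<Longrightarrow> \<phi> x [^] (i::int) \<otimes> y = y \<otimes> \<phi> x [^] i"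
  using phi_central [of "x [^] i" y] by (simp add: phi.hom_int_pow)

lemma psi_central:
  assumes "x \<in> carrier F" "y \<in> carrier F" shows "psi x \<cdot> y = y \<cdot> psi x"
  using assms by (elim F_carrierE) (simp add: psi_def phi_int_pow_central add.commute)

definition NN :: "('a \<times> (nat \<Rightarrow> int)) set" where "NN = psi ` carrier F"

lemma NN_normal: "NN \<lhd> F"
  unfolding F.normal_inv_iff
proof (intro conjI ballI)
  show "subgroup NN F" unfolding NN_def by (rule psi.img_is_subgroup)
  fix x h assume x: "x \<in> carrier F" and "h \<in> NN"
  then obtain y where y: "y \<in> carrier F" "h = psi y" unfolding NN_def by blast
  have "x \<cdot> h \<cdot> inv\<^bsub>F\<^esub> x = h"
    unfolding y(2) psi_central [OF y(1) x, symmetric] using x psi_closed [OF y(1)] by (simp add: F.m_assoc)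
  then show "x \<cdot> h \<cdot> inv\<^bsub>F\<^esub> x \<in> NN" using \<open>h \<in> NN\<close> by simp
qed

abbreviation T :: "('a \<times> (nat \<Rightarrow> int)) set monoid" where "T \<equiv> F Mod NN"

definition \<beta> :: "'a \<times> (nat \<Rightarrow> int) \<Rightarrow> ('a \<times> (nat \<Rightarrow> int)) set" where "\<beta> x = NN #>\<^bsub>F\<^esub> x"

sublocale beta: group_hom F T \<beta>
  using F.normal_quotient_hom [OF NN_normal] by (simp add: \<beta>_def [abs_def])

lemma beta_surj: "c \<in> carrier T \<Longrightarrow> \<exists>x \<in> carrier F. c = \<beta> x"
  unfolding \<beta>_def carrier_FactGroup by blast

lemma beta_psi: "z \<in> carrier F \<Longrightarrow> y \<in> carrier F \<Longrightarrow> \<beta> (psi z \<cdot> y) = \<beta> y"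
proof -
  assume z: "z \<in> carrier F" and y: "y \<in> carrier F"
  have "\<beta> (psi z) = \<one>\<^bsub>T\<^esub>"
    unfolding \<beta>_def by (rule iffD2 [OF F.normal_quotient_one [OF NN_normal psi_closed [OF z]]])
      (use z in \<open>simp add: NN_def\<close>)
  then show ?thesis
    using beta.hom_mult [OF psi_closed [OF z] y] beta.hom_closed [OF y] by (simp only: beta.H.l_one)
qed

lemma beta_eqD:
  assumes x: "x \<in> carrier F" and y: "y \<in> carrier F" and eq: "\<beta> x = \<beta> y"
  shows "\<exists>z \<in> carrier F. x = psi z \<cdot> y"
proof -
  have "\<beta> (x \<cdot> inv\<^bsub>F\<^esub> y) = \<one>\<^bsub>T\<^esub>"
    using x y eq by (simp only: beta.hom_mult beta.hom_inv F.inv_closed beta.H.r_inv beta.hom_closed)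
  then have "x \<cdot> inv\<^bsub>F\<^esub> y \<in> NN"
    using F.normal_quotient_one [OF NN_normal, of "x \<cdot> inv\<^bsub>F\<^esub> y"] x y unfolding \<beta>_def by simp
  then obtain z where z: "z \<in> carrier F" "x \<cdot> inv\<^bsub>F\<^esub> y = psi z" unfolding NN_def by blast
  have "x = psi z \<cdot> y" unfolding z(2) [symmetric] using x y by (simp add: F.m_assoc)
  then show ?thesis using z(1) by blast
qed

lemma beta_gcom: "x \<in> carrier F \<Longrightarrow> y \<in> carrier F \<Longrightarrow> \<beta> (gcom F x y) = gcom T (\<beta> x) (\<beta> y)"
  unfolding \<beta>_def by (rule F.normal_quotient_gcom [OF NN_normal])

definition phiT :: "('a \<times> (nat \<Rightarrow> int)) set \<Rightarrow> ('a \<times> (nat \<Rightarrow> int)) set" where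
  "phiT c = the_elem ((\<lambda>x. \<beta> (phiF x)) ` c)"

lemma phiF_psi: "x \<in> carrier F \<Longrightarrow> phiF (psi x) = psi (phiF x)"
  by (elim F_carrierE) (auto simp: phiF_def psi_def phi.hom_int_pow tw_def shift_def)

lemma phiT_beta: assumes x: "x \<in> carrier F" shows "phiT (\<beta> x) = \<beta> (phiF x)"
proof -
  have "\<beta> x = (\<lambda>z. psi z \<cdot> x) ` carrier F" by (auto simp: \<beta>_def r_coset_def NN_def)
  moreover have "\<beta> (phiF (psi z \<cdot> x)) = \<beta> (phiF x)" if z: "z \<in> carrier F" for z
    using hom_mult [OF phiF_hom psi_closed [OF z] x] phiF_psi [OF z]
      beta_psi [OF phiF_closed [OF z] phiF_closed [OF x]] by simp
  ultimately have "(\<lambda>x. \<beta> (phiF x)) ` \<beta> x = (\<lambda>z. \<beta> (phiF x)) ` carrier F" by (simp add: image_image)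
  also have "\<dots> = {\<beta> (phiF x)}" using F.one_closed by blast
  finally show ?thesis by (simp add: phiT_def)
qed

lemma phiT_hom: "phiT \<in> hom T T"
proof (rule homI)
  fix c assume "c \<in> carrier T"
  then obtain x where x: "x \<in> carrier F" "c = \<beta> x" using beta_surj by blast
  show "phiT c \<in> carrier T"
    unfolding x(2) phiT_beta [OF x(1)] by (rule beta.hom_closed [OF phiF_closed [OF x(1)]])
  fix d assume "d \<in> carrier T"
  then obtain y where y: "y \<in> carrier F" "d = \<beta> y" using beta_surj by blast
  have "phiT (\<beta> x \<otimes>\<^bsub>T\<^esub> \<beta> y) = phiT (\<beta> (x \<cdot> y))" using x y by (simp only: beta.hom_mult)
  also have "\<dots> = \<beta> (phiF x \<cdot> phiF y)"
    using x y hom_mult [OF phiF_hom x(1) y(1)] phiT_beta [OF F.m_closed [OF x(1) y(1)]] by simp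
  also have "\<dots> = phiT (\<beta> x) \<otimes>\<^bsub>T\<^esub> phiT (\<beta> y)"
    using x y by (simp only: phiT_beta beta.hom_mult phiF_closed)
  finally show "phiT (c \<otimes>\<^bsub>T\<^esub> d) = phiT c \<otimes>\<^bsub>T\<^esub> phiT d" using x y by simp
qed

section \<open>The link between a pair and its twist\<close>

definition \<theta> :: "'a \<Rightarrow> ('a \<times> (nat \<Rightarrow> int)) set" where "\<theta> g = \<beta> (g, \<delta> g)"

lemma delta_mem: "g \<in> carrier G \<Longrightarrow> (g, \<delta> g) \<in> carrier F"
  using delta [of g] by (simp add: F_carrier digits_def)

lemma theta_eq: "(g, m) \<in> carrier F \<Longrightarrow> digits m \<Longrightarrow> \<beta> (g, m) = \<theta> g"
  using delta_eq [of g m] by (simp add: \<theta>_def F_carrier)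

text \<open>Uniqueness and existence of digits modulo p - e' t. If two representatives differ by
  \<open>psi (h, w)\<close>, uniqueness gives w = 0, so h lies in \<open>D\<close> and \<phi>(h) is
  trivial. Conversely, division by p - e' t turns any vector into digits at the price of changing g
  by a power of \<phi>(h).\<close>

lemma theta_bij: "bij_betw \<theta> (carrier G) (carrier T)"
proof (rule bij_betw_imageI)
  show "inj_on \<theta> (carrier G)"
  proof (rule inj_onI)
    fix g g' assume g: "g \<in> carrier G" "g' \<in> carrier G" and "\<theta> g = \<theta> g'"
    then obtain z where z: "z \<in> carrier F" "(g, \<delta> g) = psi z \<cdot> (g', \<delta> g')"
      unfolding \<theta>_def using beta_eqD [OF delta_mem delta_mem] by blast
    from z(1) obtain h w where h: "z = (h, w)" "h \<in> carrier G" "w \<in> M" "q h = Ev w" by (rule F_carrierE)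
    have "g = \<phi> h [^] s \<otimes> g' \<and> \<delta> g = (\<lambda>l. tw e' w l + \<delta> g' l)"
      using z(2) unfolding h(1) psi_def F_mult fst_conv snd_conv prod.inject .
    then have gg: "g = \<phi> h [^] s \<otimes> g'" and dd: "\<delta> g = (\<lambda>l. tw e' w l + \<delta> g' l)"
      by (rule conjunct1, rule conjunct2)
    have "w l = 0" for l
    proof (cases "l < N")
      case True
      show ?thesis
        by (rule digits_unique [OF delta(1) [OF g(1)] delta(1) [OF g(2)] _ True]) (simp add: dd)
    qed (use h(3) in \<open>simp add: M_def\<close>)
    then have "w = (\<lambda>l. 0)" by (intro ext)
    then have "q h = \<one>\<^bsub>Q\<^esub>" using h(4) by (simp only: Q.ev_zero)
    then have "h \<in> D" using q_one_iff [OF h(2)] by simp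
    then show "g = g'" using gg g phi_D by simp
  qed
  show "\<theta> ` carrier G = carrier T"
  proof
    show "\<theta> ` carrier G \<subseteq> carrier T"
      unfolding \<theta>_def using beta.hom_closed [OF delta_mem] by (intro image_subsetI)
    show "carrier T \<subseteq> \<theta> ` carrier G"
    proof
      fix c assume "c \<in> carrier T"
      then obtain x where x: "x \<in> carrier F" "c = \<beta> x" using beta_surj by blast
      from x(1) obtain g m where gm: "x = (g, m)" "g \<in> carrier G" "m \<in> M" "q g = Ev m" by (rule F_carrierE)
      define w where "w = quo e' m"
      have w: "w \<in> M" and d: "digits (\<lambda>l. m l - tw e' w l)" using reduce [OF gm(3)] by (simp_all add: w_def)
      obtain h where h: "h \<in> carrier G" "Ev w = q h" using q_surj [OF Ev_closed] by blast
      have hw: "(h, w) \<in> carrier F" using h w by (simp add: F_carrier)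
      define g0 where "g0 = inv (\<phi> h [^] s) \<otimes> g"
      have eq: "inv\<^bsub>F\<^esub> (psi (h, w)) \<cdot> x = (g0, \<lambda>l. m l - tw e' w l)"
        using F_inv [of "\<phi> h [^] s" "tw e' w"] psi_closed [OF hw] by (simp add: gm(1) psi_def g0_def)
      have y: "(g0, \<lambda>l. m l - tw e' w l) \<in> carrier F"
        unfolding eq [symmetric] using x(1) psi_closed [OF hw] by simp
      have "x = psi (h, w) \<cdot> (g0, \<lambda>l. m l - tw e' w l)"
        unfolding eq [symmetric] using x(1) psi_closed [OF hw] by (simp add: F.r_cancel_inv)
      then have "c = \<beta> (g0, \<lambda>l. m l - tw e' w l)" using beta_psi [OF hw y] x(2) by simp
      also have "\<dots> = \<theta> g0" by (rule theta_eq [OF y d])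
      finally show "c \<in> \<theta> ` carrier G" using y by (simp add: F_carrier)
    qed
  qed
qed

lemma digits_zero: "digits (\<lambda>l. 0)"
  using M_zero p0 by (simp add: digits_def)

lemma delta_D: "c \<in> D \<Longrightarrow> \<delta> c = (\<lambda>l. 0)"
proof (rule delta_eq [OF D_carrier digits_zero])
  assume c: "c \<in> D"
  show "Ev (\<lambda>l. 0) = q c" unfolding Q.ev_zero using q_one_iff [OF D_carrier [OF c]] c by simp
qed

text \<open>A shifted digit vector is again a digit vector, so no carry arises and the compatibility
  is exact.\<close>

lemma theta_phi: assumes g: "g \<in> carrier G" shows "\<theta> (\<phi> g) = phiT (\<theta> g)"
proof -
  have "phiF (g, \<delta> g) \<in> carrier F" by (rule phiF_closed [OF delta_mem [OF g]])
  then have mem: "(\<phi> g, shift Z (\<delta> g)) \<in> carrier F" by (simp add: phiF_def)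
  have "digits (shift Z (\<delta> g))"
    using delta(1) [OF g] p0 M_shift by (auto simp: digits_def shift_def)
  then show ?thesis
    unfolding \<theta>_def phiT_beta [OF delta_mem [OF g]] using theta_eq [OF mem]
    by (simp add: \<theta>_def phiF_def)
qed

lemma theta_one: "\<theta> \<one> = \<one>\<^bsub>T\<^esub>"
  unfolding \<theta>_def delta_D [OF subgroup.one_closed [OF D_subgroup]] F_one [symmetric]
  by (rule beta.hom_one)

text \<open>In the fibre product x^p = psi(x) \<phi>(x)^e', and psi(x) is trivial in
  \<open>T\<close>. Nilpotency and finiteness are transported along the bijection
  \<open>\<theta>\<close>.\<close>

lemma twist_central_endo: "central_endo T p n e' phiT"
proof (intro central_endo.intro central_endo_axioms.intro beta.H.is_group p phiT_hom)
  show "finite (carrier T)" using bij_betw_finite [OF theta_bij] fin by simp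
next
  fix c d assume "c \<in> carrier T" "d \<in> carrier T"
  then obtain x y where x: "x \<in> carrier F" "c = \<beta> x" and y: "y \<in> carrier F" "d = \<beta> y"
    using beta_surj by blast
  have "phiF x \<cdot> y = y \<cdot> phiF x"
    using x(1) y(1) by (elim F_carrierE) (simp add: phiF_def phi_central add.commute)
  then show "phiT c \<otimes>\<^bsub>T\<^esub> d = d \<otimes>\<^bsub>T\<^esub> phiT c"
    unfolding x(2) y(2) phiT_beta [OF x(1)]
    using beta.hom_mult [OF phiF_closed [OF x(1)] y(1)] beta.hom_mult [OF y(1) phiF_closed [OF x(1)]]
    by simp
next
  fix c assume c: "c \<in> carrier T"
  then obtain g where g: "g \<in> carrier G" "c = \<theta> g" using theta_bij by (auto simp: bij_betw_def)
  have "(phiT ^^ j) (\<theta> g) = \<theta> ((\<phi> ^^ j) g)" for j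
    using g(1) by (induction j) (simp_all add: theta_phi)
  then show "(phiT ^^ n) c = \<one>\<^bsub>T\<^esub>" using phi_nil [OF g(1)] g(2) theta_one by simp
  obtain x where x: "x \<in> carrier F" "c = \<beta> x" using beta_surj [OF c] by blast
  from x(1) obtain h m where h: "x = (h, m)" "h \<in> carrier G" by (rule F_carrierE)
  have "x [^]\<^bsub>F\<^esub> p = psi x \<cdot> phiF x [^]\<^bsub>F\<^esub> e'"
  proof -
    have "phiF x \<in> carrier F" by (rule phiF_closed [OF x(1)])
    then have "phiF x [^]\<^bsub>F\<^esub> e' = (\<phi> h [^] e', \<lambda>l. int e' * shift Z m l)"
      using F_nat_pow by (simp add: h(1) phiF_def)
    moreover have "\<phi> h [^] s \<otimes> \<phi> h [^] e' = h [^] p"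
    proof -
      have "\<phi> h [^] s \<otimes> \<phi> h [^] int e' = \<phi> h [^] int e"
        using h(2) by (simp add: int_pow_mult [symmetric] s_def)
      then show ?thesis using phi_pow [OF h(2)] by (simp add: int_pow_int)
    qed
    moreover have "x [^]\<^bsub>F\<^esub> p = (h [^] p, \<lambda>l. int p * m l)" using F_nat_pow x(1) h(1) by simp
    ultimately show ?thesis by (simp add: h(1) psi_def tw_def)
  qed
  then have "\<beta> (x [^]\<^bsub>F\<^esub> p) = \<beta> (phiF x [^]\<^bsub>F\<^esub> e')"
    using beta_psi [OF x(1)] phiF_closed [OF x(1)] by simp
  then show "c [^]\<^bsub>T\<^esub> p = phiT c [^]\<^bsub>T\<^esub> e'"
    unfolding x(2) phiT_beta [OF x(1)] using x(1) phiF_closed [OF x(1)] by (simp add: beta.hom_nat_pow)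
qed

lemma twist_linking: "linking G T p n e e' \<phi> phiT \<theta>"
proof (intro linking.intro linking_axioms.intro central_endo_axioms twist_central_endo theta_bij theta_phi)
  fix x c assume x: "x \<in> carrier G" and c: "c \<in> D"
  have cc: "c \<in> carrier G" by (rule D_carrier [OF c])
  have c0: "(c, \<lambda>l. 0) \<in> carrier F" using delta_mem [OF cc] delta_D [OF c] by simp
  \<comment> \<open>Multiplication by an element of \<open>D\<close> does not change the class in
    \<open>Q\<close>, so the digits of x also serve for x c.\<close>
  have eq: "(x, \<delta> x) \<cdot> (c, \<lambda>l. 0) = (x \<otimes> c, \<delta> x)" by simp
  have "(x \<otimes> c, \<delta> x) \<in> carrier F"
    unfolding eq [symmetric] by (rule F.m_closed [OF delta_mem [OF x] c0])
  then have "\<theta> (x \<otimes> c) = \<beta> (x \<otimes> c, \<delta> x)" using theta_eq delta(1) [OF x] by simp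
  also have "\<dots> = \<theta> x \<otimes>\<^bsub>T\<^esub> \<theta> c"
    unfolding eq [symmetric] \<theta>_def delta_D [OF c] by (rule beta.hom_mult [OF delta_mem [OF x] c0])
  finally show "\<theta> (x \<otimes> c) = \<theta> x \<otimes>\<^bsub>T\<^esub> \<theta> c" .
next
  fix x y assume x: "x \<in> carrier G" and y: "y \<in> carrier G"
  note mx = delta_mem [OF x] and my = delta_mem [OF y]
  show "\<theta> (gcom G x y) = gcom T (\<theta> x) (\<theta> y)"
    using beta_gcom [OF mx my] delta_D [OF gcom_in_derived [OF x y]] by (simp add: \<theta>_def F_gcom mx my)
  have xy: "x \<otimes> y \<in> carrier G" using x y by simp
  \<comment> \<open>The carry of the digit addition. It is a relation in \<open>Q\<close>, hence
    equal to (p - e t)w.\<close>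
  define u where "u = (\<lambda>l. \<delta> x l + \<delta> y l - \<delta> (x \<otimes> y) l)"
  have "u \<in> M"
    using M_add [OF M_add M_minus, of "\<delta> x" "\<delta> y" "\<delta> (x \<otimes> y)"] delta(1) [OF x] delta(1) [OF y] delta(1) [OF xy]
    by (simp add: digits_def u_def)
  moreover have "Ev u = \<one>\<^bsub>Q\<^esub>"
    unfolding u_def Q.ev_diff [OF qb] Q.ev_add [OF qb] delta(2) [OF x] delta(2) [OF y] delta(2) [OF xy]
      q.hom_mult [OF x y] using q.hom_closed [OF x] q.hom_closed [OF y]
    by (simp only: q.H.r_inv q.H.m_closed)
  ultimately obtain w where w: "w \<in> M" "u = tw e w" using Ev_kernel by blast
  obtain h where h: "h \<in> carrier G" "Ev w = q h" using q_surj [OF Ev_closed] by blast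
  have hw: "(h, w) \<in> carrier F" using h w by (simp add: F_carrier)
  define v where "v = (h, w) [^]\<^bsub>F\<^esub> s"
  have v: "v \<in> carrier F" "v = (h [^] s, \<lambda>l. s * w l)"
    unfolding v_def by (rule F.int_pow_closed [OF hw], rule F_int_pow [OF hw])
  have fv: "phiF v = (\<phi> h [^] s, \<lambda>l. s * shift Z w l)"
    using h(1) by (auto simp: v(2) phiF_def phi.hom_int_pow shift_def)
  \<comment> \<open>\<open>psi (h, w)\<close> is trivial in \<open>T\<close>, and its vector (p - e'
    t)w exceeds the carry (p - e t)w by s t w. Together with the first component \<phi>(h)^s this
    excess is \<open>phiF v\<close>, so the defect lies in the image of \<open>phiT\<close>.\<close>
  have "psi (h, w) \<cdot> (x \<otimes> y, \<delta> (x \<otimes> y)) = ((x, \<delta> x) \<cdot> (y, \<delta> y)) \<cdot> phiF v"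
  proof -
    have "\<delta> x l + \<delta> y l = \<delta> (x \<otimes> y) l + tw e w l" for l
      using fun_cong [OF w(2), of l] by (simp add: u_def)
    then show ?thesis
      using phi_int_pow_central [OF h(1) xy, of s] by (simp add: psi_def fv tw_split algebra_simps)
  qed
  then have "\<theta> (x \<otimes> y) = \<beta> (((x, \<delta> x) \<cdot> (y, \<delta> y)) \<cdot> phiF v)"
    using beta_psi [OF hw delta_mem [OF xy]] by (simp add: \<theta>_def)
  also have "\<dots> = \<theta> x \<otimes>\<^bsub>T\<^esub> \<theta> y \<otimes>\<^bsub>T\<^esub> phiT (\<beta> v)"
    unfolding \<theta>_def phiT_beta [OF v(1)]
    using mx my phiF_closed [OF v(1)] by (simp only: beta.hom_mult F.m_closed)
  finally show "\<exists>w \<in> carrier T. \<theta> (x \<otimes> y) = \<theta> x \<otimes>\<^bsub>T\<^esub> \<theta> y \<otimes>\<^bsub>T\<^esub> phiT w"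
    using beta.hom_closed [OF v(1)] by (rule bexI)
qed

end

theorem (in central_endo) twist_exists:
  "\<exists>(T :: ('a \<times> (nat \<Rightarrow> int)) set monoid) \<chi> \<theta>. linking G T p n e e' \<phi> \<chi> \<theta>"
proof -
  obtain N Z b where c: "chains N Z b"
    and surj: "\<forall>x \<in> carrier G. \<exists>m. q x = evq b N m"
    using chains_exist by (elim exE conjE) (rule that; assumption)
  interpret twist G p n e \<phi> N Z b e'
    by (intro twist.intro twist_axioms.intro central_endo_axioms c) (rule surj [rule_format])
  show ?thesis using twist_linking by (intro exI)
qed

section \<open>Counting\<close>

lemma (in group) iso_nat_group:
  assumes fin: "finite (carrier G)"
  shows "\<exists>(H :: nat monoid) f. group H \<and> carrier H = {..<card (carrier G)} \<and> f \<in> iso G H"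
proof -
  obtain f where f: "bij_betw f (carrier G) {..<card (carrier G)}"
    using ex_bij_betw_finite_nat [OF fin] by (auto simp: lessThan_atLeast0)
  define g where "g = inv_into (carrier G) f"
  have gf: "g (f x) = x" if "x \<in> carrier G" for x
    using that f by (simp add: g_def bij_betw_def)
  define H where "H = \<lparr>carrier = {..<card (carrier G)}, mult = \<lambda>i j. f (g i \<otimes> g j), one = f \<one>\<rparr>"
  have Hc: "carrier H = f ` carrier G" using f by (simp add: H_def bij_betw_def)
  have Hm: "f x \<otimes>\<^bsub>H\<^esub> f y = f (x \<otimes> y)" if "x \<in> carrier G" "y \<in> carrier G" for x y
    using that by (simp add: H_def gf)
  have H1: "\<one>\<^bsub>H\<^esub> = f \<one>" by (simp add: H_def)
  have "group H"
  proof (rule groupI)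
    fix u v assume "u \<in> carrier H" "v \<in> carrier H"
    then show "u \<otimes>\<^bsub>H\<^esub> v \<in> carrier H" unfolding Hc by (elim imageE) (simp add: Hm)
  next
    show "\<one>\<^bsub>H\<^esub> \<in> carrier H" unfolding Hc H1 by simp
  next
    fix u v w assume "u \<in> carrier H" "v \<in> carrier H" "w \<in> carrier H"
    then show "u \<otimes>\<^bsub>H\<^esub> v \<otimes>\<^bsub>H\<^esub> w = u \<otimes>\<^bsub>H\<^esub> (v \<otimes>\<^bsub>H\<^esub> w)"
      unfolding Hc by (elim imageE) (simp add: Hm m_assoc)
  next
    fix u assume "u \<in> carrier H"
    then obtain x where x: "x \<in> carrier G" "u = f x" unfolding Hc by blast
    show "\<one>\<^bsub>H\<^esub> \<otimes>\<^bsub>H\<^esub> u = u" using x by (simp add: H1 Hm)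
    have "f (inv x) \<otimes>\<^bsub>H\<^esub> u = \<one>\<^bsub>H\<^esub>" using x by (simp add: H1 Hm)
    then show "\<exists>v \<in> carrier H. v \<otimes>\<^bsub>H\<^esub> u = \<one>\<^bsub>H\<^esub>"
      by (rule bexI) (use x in \<open>simp add: Hc\<close>)
  qed
  moreover have "f \<in> iso G H"
    unfolding iso_def using f Hm Hc by (auto intro: homI simp: H_def)
  moreover have "carrier H = {..<card (carrier G)}" by (simp add: H_def)
  ultimately show ?thesis by blast
qed

text \<open>\<open>\<chi>\<close> has the form of the elements of \<open>aut_orbit\<close>, so this
  serves for changing the carrier as well as for conjugation by automorphisms.\<close>

lemma central_endo_iso:
  assumes "central_endo G p n e \<phi>" and H: "group H" and f: "f \<in> iso G H"
  defines "\<chi> \<equiv> restrict (f \<circ> \<phi> \<circ> inv_into (carrier G) f) (carrier H)"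
  shows "central_endo H p n e \<chi>" and "\<And>x. x \<in> carrier G \<Longrightarrow> f (\<phi> x) = \<chi> (f x)"
proof -
  interpret G: central_endo G p n e \<phi> by fact
  interpret H: group H by fact
  interpret f: group_hom G H f
    using f by (intro group_hom.intro group_hom_axioms.intro G.is_group H.is_group) (simp add: iso_def)
  have bij: "bij_betw f (carrier G) (carrier H)" using f by (simp add: iso_def)
  have surj: "\<exists>x \<in> carrier G. u = f x" if "u \<in> carrier H" for u
    using that bij by (auto simp: bij_betw_def)
  show chi: "f (\<phi> x) = \<chi> (f x)" if "x \<in> carrier G" for x
    using that bij by (simp add: \<chi>_def bij_betw_def)
  have funpow: "(\<chi> ^^ j) (f x) = f ((\<phi> ^^ j) x)" if "x \<in> carrier G" for x j
    using that by (induction j) (simp_all add: chi [symmetric])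
  show "central_endo H p n e \<chi>"
  proof (intro central_endo.intro central_endo_axioms.intro H G.p)
    show "finite (carrier H)" using bij_betw_finite [OF bij] G.fin by simp
    show "\<chi> \<in> hom H H"
    proof (rule homI)
      fix u assume "u \<in> carrier H"
      then obtain x where x: "x \<in> carrier G" "u = f x" using surj by blast
      then show "\<chi> u \<in> carrier H" by (simp add: chi [symmetric])
      fix v assume "v \<in> carrier H"
      then obtain y where y: "y \<in> carrier G" "v = f y" using surj by blast
      have "\<chi> (f (x \<otimes>\<^bsub>G\<^esub> y)) = f (\<phi> x) \<otimes>\<^bsub>H\<^esub> f (\<phi> y)"
        using x(1) y(1) chi [of "x \<otimes>\<^bsub>G\<^esub> y"] by simp
      then show "\<chi> (u \<otimes>\<^bsub>H\<^esub> v) = \<chi> u \<otimes>\<^bsub>H\<^esub> \<chi> v" using x y by (simp add: chi)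
    qed
    fix u assume "u \<in> carrier H"
    then obtain x where x: "x \<in> carrier G" "u = f x" using surj by blast
    show "(\<chi> ^^ n) u = \<one>\<^bsub>H\<^esub>" using x funpow G.phi_nil by simp
    show "u [^]\<^bsub>H\<^esub> p = \<chi> u [^]\<^bsub>H\<^esub> e"
      using x G.phi_pow [OF x(1)] by (simp add: chi [symmetric] f.hom_nat_pow [symmetric])
    fix v assume "v \<in> carrier H"
    then obtain y where y: "y \<in> carrier G" "v = f y" using surj by blast
    show "\<chi> u \<otimes>\<^bsub>H\<^esub> v = v \<otimes>\<^bsub>H\<^esub> \<chi> u"
      using x y G.phi_central [OF x(1) y(1)]
      by (simp add: chi [symmetric] f.hom_mult [symmetric] del: f.hom_mult)
  qed
qed

lemma central_endo_prime_power:
  assumes "group G" and p: "prime p" and card: "card (carrier G) = p ^ n" and "n \<le> p"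
    and ex: "exp_divides G (derived G (carrier G)) p"
  shows "central_endo G p n 1 (\<lambda>x. x [^]\<^bsub>G\<^esub> p)"
proof -
  interpret group G by fact
  have fin: "finite (carrier G)" by (rule finite_prime_power [OF p card])
  show ?thesis
  proof (intro central_endo.intro central_endo_axioms.intro is_group p fin)
    show "(\<lambda>x. x [^]\<^bsub>G\<^esub> p) \<in> hom G G"
      by (rule homI) (simp_all add: prime_pow_hom [OF p card \<open>n \<le> p\<close> ex])
    fix x assume x: "x \<in> carrier G"
    show "x [^]\<^bsub>G\<^esub> p = (x [^]\<^bsub>G\<^esub> p) [^]\<^bsub>G\<^esub> (1::nat)" using x by simp
    have "((\<lambda>x. x [^]\<^bsub>G\<^esub> p) ^^ j) x = x [^]\<^bsub>G\<^esub> (p ^ j)" for j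
      using x by (induction j) (simp_all add: nat_pow_pow mult.commute)
    then show "((\<lambda>x. x [^]\<^bsub>G\<^esub> p) ^^ n) x = \<one>\<^bsub>G\<^esub>"
      using pow_order_eq_1 [OF x] card by (simp add: order_def)
    show "x [^]\<^bsub>G\<^esub> p \<otimes>\<^bsub>G\<^esub> y = y \<otimes>\<^bsub>G\<^esub> x [^]\<^bsub>G\<^esub> p" if "y \<in> carrier G" for y
      by (rule prime_pow_central [OF p card \<open>n \<le> p\<close> ex x that])
  qed
qed

lemma central_endo_derived_exponent:
  assumes "central_endo G p n e \<phi>" shows "exp_divides G (derived G (carrier G)) p"
proof -
  interpret central_endo G p n e \<phi> by fact
  show ?thesis unfolding exp_divides_def using phi_pow phi_D D_carrier by simp
qed

section \<open>Orbits of nilpotent endomorphisms under automorphisms\<close>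

lemma N_set_iff:
  assumes E: "order_exp_p E (p ^ n) p" and p: "prime p"
  shows "\<phi> \<in> N_set E n \<longleftrightarrow> \<phi> \<in> extensional (carrier E) \<and> central_endo E p n 0 \<phi>"
proof
  assume phi: "\<phi> \<in> N_set E n"
  have "\<phi> x \<in> grp_center E" if "x \<in> carrier E" for x using phi that by (auto simp: N_set_def)
  then have "\<phi> x \<otimes>\<^bsub>E\<^esub> y = y \<otimes>\<^bsub>E\<^esub> \<phi> x" if "x \<in> carrier E" "y \<in> carrier E" for x y
    using that by (auto simp: grp_center_def)
  then show "\<phi> \<in> extensional (carrier E) \<and> central_endo E p n 0 \<phi>"
    using phi E p
    by (auto simp: N_set_def order_exp_p_def exp_divides_def intro!: central_endo.intro central_endo_axioms.intro)
next
  assume phi: "\<phi> \<in> extensional (carrier E) \<and> central_endo E p n 0 \<phi>"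
  then interpret central_endo E p n 0 \<phi> by simp
  show "\<phi> \<in> N_set E n"
    using phi phi_hom phi_central phi_nil phi.hom_closed by (auto simp: N_set_def grp_center_def)
qed

text \<open>Conjugacy without inverses. It compares values on the carrier only;
  \<open>extensional\<close> in \<open>N_set\<close> turns this into equality of functions.\<close>

definition conj_endo :: "('a, 'b) monoid_scheme \<Rightarrow> ('a \<Rightarrow> 'a) \<Rightarrow> ('a \<Rightarrow> 'a) \<Rightarrow> bool" where
  "conj_endo E \<phi> \<chi> \<longleftrightarrow> (\<exists>\<alpha> \<in> iso E E. \<forall>x \<in> carrier E. \<alpha> (\<phi> x) = \<chi> (\<alpha> x))"

lemma conj_endo_refl: "conj_endo E \<phi> \<phi>"
  unfolding conj_endo_def by (rule bexI [OF _ iso_set_refl]) simp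

lemma conj_endo_sym:
  assumes "group E" "\<And>x. x \<in> carrier E \<Longrightarrow> \<phi> x \<in> carrier E" "conj_endo E \<phi> \<chi>"
  shows "conj_endo E \<chi> \<phi>"
proof -
  obtain \<alpha> where a: "\<alpha> \<in> iso E E" "\<forall>x \<in> carrier E. \<alpha> (\<phi> x) = \<chi> (\<alpha> x)"
    using assms(3) unfolding conj_endo_def by blast
  have bij: "bij_betw \<alpha> (carrier E) (carrier E)" using a by (simp add: iso_def)
  have "inv_into (carrier E) \<alpha> (\<chi> u) = \<phi> (inv_into (carrier E) \<alpha> u)" if u: "u \<in> carrier E" for u
  proof -
    obtain x where x: "x \<in> carrier E" "u = \<alpha> x" using u bij by (auto simp: bij_betw_def)
    show ?thesis using x a(2) assms(2) bij by (simp add: bij_betw_def flip: a(2) [rule_format])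
  qed
  then show ?thesis unfolding conj_endo_def using group.iso_set_sym [OF assms(1) a(1)] by blast
qed

lemma conj_endo_trans:
  assumes "conj_endo E \<phi> \<chi>" "conj_endo E \<chi> \<psi>"
  shows "conj_endo E \<phi> \<psi>"
proof -
  obtain \<alpha> where a: "\<alpha> \<in> iso E E" "\<forall>x \<in> carrier E. \<alpha> (\<phi> x) = \<chi> (\<alpha> x)"
    using assms(1) unfolding conj_endo_def by blast
  obtain \<beta> where b: "\<beta> \<in> iso E E" "\<forall>x \<in> carrier E. \<beta> (\<chi> x) = \<psi> (\<beta> x)"
    using assms(2) unfolding conj_endo_def by blast
  have "\<alpha> x \<in> carrier E" if "x \<in> carrier E" for x
    using that a(1) by (auto simp: iso_def bij_betw_def)
  then show ?thesis
    unfolding conj_endo_def using a b iso_set_trans [OF a(1) b(1)]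
    by (intro bexI [of _ "\<beta> \<circ> \<alpha>"]) simp_all
qed

lemma aut_orbit_eq:
  assumes E: "order_exp_p E (p ^ n) p" and p: "prime p" and phi: "\<phi> \<in> N_set E n"
  shows "aut_orbit E \<phi> = {\<chi> \<in> N_set E n. conj_endo E \<phi> \<chi>}"
proof -
  have grp: "group E" using E by (simp add: order_exp_p_def)
  have ce: "central_endo E p n 0 \<phi>" using phi N_set_iff [OF E p] by blast
  show ?thesis
  proof (intro equalityI subsetI)
    fix \<chi> assume "\<chi> \<in> aut_orbit E \<phi>"
    then obtain \<alpha> where a: "\<alpha> \<in> iso E E"
      "\<chi> = restrict (\<alpha> \<circ> \<phi> \<circ> inv_into (carrier E) \<alpha>) (carrier E)"
      unfolding aut_orbit_def by blast
    have "central_endo E p n 0 \<chi>" unfolding a(2) by (rule central_endo_iso(1) [OF ce grp a(1)])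
    moreover have "\<chi> \<in> extensional (carrier E)" unfolding a(2) by simp
    moreover have "conj_endo E \<phi> \<chi>"
      unfolding conj_endo_def a(2) using central_endo_iso(2) [OF ce grp a(1)] by (intro bexI [OF _ a(1)]) blast
    ultimately show "\<chi> \<in> {\<chi> \<in> N_set E n. conj_endo E \<phi> \<chi>}" using N_set_iff [OF E p] by blast
  next
    fix \<chi> assume "\<chi> \<in> {\<chi> \<in> N_set E n. conj_endo E \<phi> \<chi>}"
    then obtain \<alpha> where ext: "\<chi> \<in> extensional (carrier E)" and a: "\<alpha> \<in> iso E E"
      "\<forall>x \<in> carrier E. \<alpha> (\<phi> x) = \<chi> (\<alpha> x)"
      unfolding conj_endo_def N_set_def by blast
    have bij: "bij_betw \<alpha> (carrier E) (carrier E)" using a by (simp add: iso_def)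
    have "\<chi> = restrict (\<alpha> \<circ> \<phi> \<circ> inv_into (carrier E) \<alpha>) (carrier E)"
    proof
      fix u
      show "\<chi> u = restrict (\<alpha> \<circ> \<phi> \<circ> inv_into (carrier E) \<alpha>) (carrier E) u"
      proof (cases "u \<in> carrier E")
        case True
        then obtain x where "x \<in> carrier E" "u = \<alpha> x" using bij by (auto simp: bij_betw_def)
        then show ?thesis using True a(2) bij by (simp add: bij_betw_def)
      qed (use ext in \<open>simp add: extensional_def\<close>)
    qed
    then show "\<chi> \<in> aut_orbit E \<phi>" unfolding aut_orbit_def using a(1) by blast
  qed
qed

lemma aut_orbit_eq_iff:
  assumes E: "order_exp_p E (p ^ n) p" and p: "prime p"
    and phi: "\<phi> \<in> N_set E n" and chi: "\<chi> \<in> N_set E n"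
  shows "aut_orbit E \<phi> = aut_orbit E \<chi> \<longleftrightarrow> conj_endo E \<phi> \<chi>"
proof
  assume "aut_orbit E \<phi> = aut_orbit E \<chi>"
  then have "\<chi> \<in> aut_orbit E \<phi>"
    unfolding aut_orbit_eq [OF E p chi] using chi conj_endo_refl by blast
  then show "conj_endo E \<phi> \<chi>" unfolding aut_orbit_eq [OF E p phi] by blast
next
  assume c: "conj_endo E \<phi> \<chi>"
  have "group E" using E by (simp add: order_exp_p_def)
  moreover have "\<phi> x \<in> carrier E" if "x \<in> carrier E" for x
    using phi that by (auto simp: N_set_def hom_def)
  ultimately have "conj_endo E \<chi> \<phi>" using conj_endo_sym c by blast
  then show "aut_orbit E \<phi> = aut_orbit E \<chi>"
    unfolding aut_orbit_eq [OF E p phi] aut_orbit_eq [OF E p chi] using c conj_endo_trans by blast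
qed

text \<open>Here f sends an element to its own fibre. A fibre with c elements contributes c terms
  1/c, so the sum counts the fibres.\<close>

lemma sum_inverse_card_fibres:
  fixes f :: "'a \<Rightarrow> 'a set"
  assumes "finite A" and fib: "\<And>x. x \<in> A \<Longrightarrow> f x = {y \<in> A. f y = f x}"
  shows "(\<Sum>x \<in> A. 1 / real (card (f x))) = real (card (f ` A))"
proof -
  have "(\<Sum>x \<in> A. 1 / real (card (f x))) = (\<Sum>c \<in> f ` A. \<Sum>x | x \<in> A \<and> f x = c. 1 / real (card (f x)))"
    by (rule sum.image_gen [OF assms(1)])
  also have "\<dots> = (\<Sum>c \<in> f ` A. 1)"
  proof (rule sum.cong [OF refl])
    fix c assume "c \<in> f ` A"
    then obtain x where x: "x \<in> A" "c = f x" by blast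
    have c: "c = {y \<in> A. f y = c}" using fib [OF x(1)] x(2) by simp
    then have "c \<subseteq> A" by blast
    then have "finite c" using assms(1) by (rule finite_subset)
    have "c \<noteq> {}" using c x by blast
    have "(\<Sum>y | y \<in> A \<and> f y = c. 1 / real (card (f y))) = (\<Sum>y | y \<in> A \<and> f y = c. 1 / real (card c))"
      by (rule sum.cong) auto
    also have "\<dots> = real (card c) * (1 / real (card c))" using c by simp
    also have "\<dots> = 1" using \<open>finite c\<close> \<open>c \<noteq> {}\<close> by simp
    finally show "(\<Sum>y | y \<in> A \<and> f y = c. 1 / real (card (f y))) = 1" .
  qed
  finally show ?thesis by simp
qed

text \<open>Made for linkage, which determines partners only up to isomorphism: L is a relation, and
  choosing one partner for each a gives a bijection between the f-classes and the g-classes.\<close>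

lemma card_image_correspondence:
  assumes total: "\<And>a. a \<in> A \<Longrightarrow> \<exists>b \<in> B. L a b" and surj: "\<And>b. b \<in> B \<Longrightarrow> \<exists>a \<in> A. L a b"
    and iff: "\<And>a a' b b'. a \<in> A \<Longrightarrow> a' \<in> A \<Longrightarrow> b \<in> B \<Longrightarrow> b' \<in> B \<Longrightarrow> L a b \<Longrightarrow> L a' b' \<Longrightarrow>
      f a = f a' \<longleftrightarrow> g b = g b'"
  shows "card (f ` A) = card (g ` B)"
proof -
  obtain h where h: "\<And>a. a \<in> A \<Longrightarrow> h a \<in> B \<and> L a (h a)" using total by metis
  have "g ` B = g ` h ` A"
  proof (intro equalityI subsetI)
    fix v assume "v \<in> g ` B"
    then obtain b where b: "b \<in> B" "v = g b" by blast
    obtain a where a: "a \<in> A" "L a b" using surj [OF b(1)] by blast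
    have "g (h a) = g b" using iff [OF a(1) a(1) _ b(1) _ a(2)] h [OF a(1)] by blast
    then show "v \<in> g ` h ` A" using a(1) b(2) by (metis imageI)
  qed (use h in blast)
  moreover have "card (f ` A) = card ((\<lambda>a. g (h a)) ` A)"
  proof (rule bij_betw_same_card)
    have eq: "f a = f a' \<longleftrightarrow> g (h a) = g (h a')" if "a \<in> A" "a' \<in> A" for a a'
      using iff [OF that] h that by blast
    define t where "t = (\<lambda>y. g (h (SOME a. a \<in> A \<and> f a = y)))"
    have t: "t (f a) = g (h a)" if a: "a \<in> A" for a
    proof -
      have "(SOME a'. a' \<in> A \<and> f a' = f a) \<in> A \<and> f (SOME a'. a' \<in> A \<and> f a' = f a) = f a"
        by (rule someI [of _ a]) (use a in simp)
      then show ?thesis unfolding t_def using eq a by blast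
    qed
    show "bij_betw t (f ` A) ((\<lambda>a. g (h a)) ` A)"
      unfolding bij_betw_def inj_on_def using t eq by (auto simp: image_image)
  qed
  ultimately show ?thesis by (simp add: image_image)
qed

text \<open>A group of order m is determined up to isomorphism by one of the finitely many
  multiplication tables on \<open>{..<m}\<close>. Finiteness matters because a sum over an infinite
  set of representatives would be 0 by convention.\<close>

lemma finite_nonisomorphic_groups:
  fixes Es :: "('a, 'b) monoid_scheme set"
  assumes "\<And>E. E \<in> Es \<Longrightarrow> group E \<and> finite (carrier E) \<and> card (carrier E) = m"
    and distinct: "\<And>E E'. E \<in> Es \<Longrightarrow> E' \<in> Es \<Longrightarrow> E \<cong> E' \<Longrightarrow> E = E'"
  shows "finite Es"
proof -
  have "\<exists>(H :: nat monoid) f. group H \<and> carrier H = {..<m} \<and> f \<in> iso E H" if "E \<in> Es" for E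
    using group.iso_nat_group [of E] assms(1) [OF that] by simp
  then obtain H f where H: "\<And>E. E \<in> Es \<Longrightarrow> group (H E :: nat monoid) \<and> carrier (H E) = {..<m} \<and> f E \<in> iso E (H E)"
    by metis
  define tab where "tab = (\<lambda>E. \<lambda>x \<in> {..<m} \<times> {..<m}. fst x \<otimes>\<^bsub>H E\<^esub> snd x)"
  have "inj_on tab Es"
  proof (rule inj_onI)
    fix E E' assume E: "E \<in> Es" "E' \<in> Es" and eq: "tab E = tab E'"
    have "i \<otimes>\<^bsub>H E\<^esub> j = i \<otimes>\<^bsub>H E'\<^esub> j" if "i < m" "j < m" for i j
      using fun_cong [OF eq, of "(i, j)"] that by (simp add: tab_def)
    then have "(\<lambda>x. x) \<in> iso (H E) (H E')"
      using H [OF E(1)] H [OF E(2)] by (auto simp: iso_def hom_def bij_betw_def)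
    then have "(\<lambda>x. x) \<circ> f E \<in> iso E (H E')" using H [OF E(1)] iso_set_trans by blast
    moreover have "inv_into (carrier E') (f E') \<in> iso (H E') E'"
      using H [OF E(2)] group.iso_set_sym assms(1) [OF E(2)] by blast
    ultimately have "inv_into (carrier E') (f E') \<circ> ((\<lambda>x. x) \<circ> f E) \<in> iso E E'"
      by (rule iso_set_trans)
    then show "E = E'" using distinct [OF E] is_isoI by blast
  qed
  moreover have "tab ` Es \<subseteq> ({..<m} \<times> {..<m}) \<rightarrow>\<^sub>E {..<m}"
  proof (rule image_subsetI)
    fix E assume E: "E \<in> Es"
    have "i \<otimes>\<^bsub>H E\<^esub> j \<in> {..<m}" if "i < m" "j < m" for i j
      using group.is_monoid [THEN monoid.m_closed, of "H E" i j] H [OF E] that by simp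
    then show "tab E \<in> ({..<m} \<times> {..<m}) \<rightarrow>\<^sub>E {..<m}" by (auto simp: tab_def)
  qed
  then have "finite (tab ` Es)" by (rule finite_subset) (intro finite_PiE finite_cartesian_product finite_lessThan)
  ultimately show ?thesis using finite_imageD by blast
qed

lemma linking_card: "linking G H p n e e' \<phi> \<chi> \<theta> \<Longrightarrow> card (carrier G) = card (carrier H)"
  using bij_betw_same_card [OF linking.bij] .

lemma iso_pow:
  assumes "group G" "group H" "f \<in> iso G H" "x \<in> carrier G"
  shows "f (x [^]\<^bsub>G\<^esub> (k::nat)) = f x [^]\<^bsub>H\<^esub> k"
  using assms hom_nat_pow [of f G H x k] by (simp add: iso_def)

theorem theorem1p2:
  fixes n p :: nat and Es :: "'a monoid set"
  assumes "prime p" and "p \<ge> n"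
    and reps_in: "\<And>E. E \<in> Es \<Longrightarrow> order_exp_p E (p ^ n) p"
    and reps_distinct: "\<And>E E'. E \<in> Es \<Longrightarrow> E' \<in> Es \<Longrightarrow> E \<cong> E' \<Longrightarrow> E = E'"
    and reps_complete: "\<And>G :: nat monoid. order_exp_p G (p ^ n) p \<Longrightarrow> \<exists>E \<in> Es. G \<cong> E"
  shows "real (num_iso_classes (p ^ n) (\<lambda>G. exp_divides G (derived G (carrier G)) p))
         = (\<Sum>E \<in> Es. \<Sum>\<phi> \<in> N_set E n. 1 / real (card (aut_orbit E \<phi>)))"
proof -
  note p = \<open>prime p\<close>
  define P where "P = {G \<in> groups_on (p ^ n). exp_divides G (derived G (carrier G)) p}"
  define R where "R = {(G, H). G \<in> groups_on (p ^ n) \<and> H \<in> groups_on (p ^ n) \<and> G \<cong> H}"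
  define S where "S = Sigma Es (\<lambda>E. N_set E n)"
  define pw where "pw = (\<lambda>(G :: nat monoid) x. x [^]\<^bsub>G\<^esub> p)"
  \<comment> \<open>The operator on the left is the p-th power map, the only one possible for
    \<open>e = 1\<close>.\<close>
  define L where "L = (\<lambda>G (E, \<phi>). \<exists>\<theta>. linking (G :: nat monoid) (E :: 'a monoid) p n 1 0 (pw G) \<phi> \<theta>)"
  have P_grp: "group G" "carrier G = {..<p ^ n}" "central_endo G p n 1 (pw G)" if "G \<in> P" for G
  proof -
    show "group G" "carrier G = {..<p ^ n}" using that by (simp_all add: P_def groups_on_def)
    then show "central_endo G p n 1 (pw G)"
      unfolding pw_def using that \<open>p \<ge> n\<close> by (intro central_endo_prime_power p) (simp_all add: P_def)
  qed
  have E_grp: "group E" "finite (carrier E)" "card (carrier E) = p ^ n" if "E \<in> Es" for E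
    using reps_in [OF that] by (simp_all add: order_exp_p_def)
  have S_ce: "central_endo E p n 0 \<phi>" if "(E, \<phi>) \<in> S" for E \<phi>
    using that N_set_iff [OF reps_in p] by (auto simp: S_def)
  have total: "\<exists>b \<in> S. L G b" if G: "G \<in> P" for G
  proof -
    interpret G: central_endo G p n 1 "pw G" by (rule P_grp(3) [OF G])
    obtain T :: "(nat \<times> (nat \<Rightarrow> int)) set monoid" and \<chi> \<theta> where lk: "linking G T p n 1 0 (pw G) \<chi> \<theta>"
      using G.twist_exists by blast
    interpret lk: linking G T p n 1 0 "pw G" \<chi> \<theta> by (rule lk)
    have cT: "card (carrier T) = p ^ n" using linking_card [OF lk] P_grp(2) [OF G] by simp
    \<comment> \<open>\<open>T\<close> consists of cosets; it is copied to the natural numbers,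
      where \<open>reps_complete\<close> applies, and from there moved to a representative.\<close>
    obtain H :: "nat monoid" and f where H: "group H" "carrier H = {..<p ^ n}" "f \<in> iso T H"
      using lk.H.iso_nat_group [OF lk.H.fin] unfolding cT by blast
    \<comment> \<open>For \<open>e = 0\<close> the power relation reads x^p = 1.\<close>
    have "exp_divides H (carrier H) p"
    proof -
      interpret H: central_endo H p n 0 "restrict (f \<circ> \<chi> \<circ> inv_into (carrier T) f) (carrier H)"
        by (rule central_endo_iso(1) [OF lk.H.central_endo_axioms H(1,3)])
      show ?thesis using H.phi_pow by (simp add: exp_divides_def)
    qed
    then have "order_exp_p H (p ^ n) p" using H by (simp add: order_exp_p_def)
    then obtain E h where E: "E \<in> Es" "h \<in> iso H E"
      using reps_complete unfolding is_iso_def by blast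
    have hf: "h \<circ> f \<in> iso T E" by (rule iso_set_trans [OF H(3) E(2)])
    define \<phi> where "\<phi> = restrict ((h \<circ> f) \<circ> \<chi> \<circ> inv_into (carrier T) (h \<circ> f)) (carrier E)"
    note ce = central_endo_iso [OF lk.H.central_endo_axioms E_grp(1) [OF E(1)] hf, folded \<phi>_def]
    have "\<phi> \<in> N_set E n" using N_set_iff [OF reps_in [OF E(1)] p] ce(1) by (simp add: \<phi>_def)
    then have "(E, \<phi>) \<in> S" using E(1) by (simp add: S_def)
    moreover have "L G (E, \<phi>)"
      unfolding L_def using linking_trans [OF lk linking_iso [OF lk.H.central_endo_axioms ce(1) hf ce(2)]]
      by auto
    ultimately show ?thesis by blast
  qed
  have surj: "\<exists>G \<in> P. L G b" if b: "b \<in> S" for b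
  proof -
    obtain E \<phi> where E: "b = (E, \<phi>)" "E \<in> Es" "(E, \<phi>) \<in> S" using b by (auto simp: S_def)
    interpret E: central_endo E p n 0 \<phi> by (rule S_ce [OF E(3)])
    obtain T :: "('a \<times> (nat \<Rightarrow> int)) set monoid" and \<chi> \<theta> where lk: "linking E T p n 0 1 \<phi> \<chi> \<theta>"
      using E.twist_exists by blast
    interpret lk: linking E T p n 0 1 \<phi> \<chi> \<theta> by (rule lk)
    have cT: "card (carrier T) = p ^ n" using linking_card [OF lk] E_grp(3) [OF E(2)] by simp
    obtain H :: "nat monoid" and f where H: "group H" "carrier H = {..<p ^ n}" "f \<in> iso T H"
      using lk.H.iso_nat_group [OF lk.H.fin] unfolding cT by blast
    have "exp_divides H (derived H (carrier H)) p"
      by (rule central_endo_derived_exponent [OF central_endo_iso(1) [OF lk.H.central_endo_axioms H(1,3)]])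
    then have HP: "H \<in> P" using H by (simp add: P_def groups_on_def)
    \<comment> \<open>For \<open>e = 1\<close> the power relation says that \<open>\<chi>\<close> is
      the p-th power map, which every isomorphism respects.\<close>
    have "f (\<chi> x) = pw H (f x)" if x: "x \<in> carrier T" for x
      using iso_pow [OF lk.H.is_group H(1,3) x, of p] lk.H.phi_pow [OF x] lk.H.phi.hom_closed [OF x]
      by (simp add: pw_def)
    then have "linking T H p n 1 1 \<chi> (pw H) f"
      by (rule linking_iso [OF lk.H.central_endo_axioms P_grp(3) [OF HP] H(3)])
    from linking.linking_sym [OF linking_trans [OF lk this]] have "L H b"
      unfolding L_def E(1) prod.case by blast
    then show ?thesis using HP by blast
  qed
  have R_iff: "R `` {G} = R `` {G'} \<longleftrightarrow> G \<cong> G'" if G: "G \<in> P" "G' \<in> P" for G G'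
  proof -
    have "equiv (groups_on (p ^ n)) R"
    proof (rule equivI)
      show "R \<subseteq> groups_on (p ^ n) \<times> groups_on (p ^ n)" by (auto simp: R_def)
      show "refl_on (groups_on (p ^ n)) R"
        unfolding refl_on_def R_def is_iso_def using iso_set_refl by blast
      show "sym R"
        unfolding sym_def R_def is_iso_def groups_on_def using group.iso_set_sym by blast
      show "trans R"
        unfolding trans_def R_def is_iso_def using iso_set_trans by blast
    qed
    then show ?thesis
      using G eq_equiv_class_iff [of "groups_on (p ^ n)" R G G'] by (auto simp: P_def R_def)
  qed
  \<comment> \<open>\<open>map_prod\<close> yields the group together with the orbit of its
    endomorphism; keeping the group separates orbits over different representatives.\<close>
  have iff: "R `` {G} = R `` {G'} \<longleftrightarrow> map_prod id (aut_orbit (fst b)) b = map_prod id (aut_orbit (fst b')) b'"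
    if G: "G \<in> P" "G' \<in> P" and b: "b \<in> S" "b' \<in> S" and LL: "L G b" "L G' b'" for G G' b b'
  proof -
    obtain E \<phi> E' \<phi>' where E: "b = (E, \<phi>)" "b' = (E', \<phi>')" by (metis surj_pair)
    have EE: "E \<in> Es" "E' \<in> Es" "\<phi> \<in> N_set E n" "\<phi>' \<in> N_set E' n" using b E by (auto simp: S_def)
    obtain \<theta> where th: "linking G E p n 1 0 (pw G) \<phi> \<theta>" using LL(1) unfolding L_def E(1) by auto
    obtain \<eta> where et: "linking G' E' p n 1 0 (pw G') \<phi>' \<eta>" using LL(2) unfolding L_def E(2) by auto
    have "G \<cong> G' \<longleftrightarrow> E = E' \<and> aut_orbit E \<phi> = aut_orbit E' \<phi>'"
    proof
      assume "G \<cong> G'"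
      then obtain f where f: "f \<in> iso G G'" unfolding is_iso_def by blast
      have "linking G G' p n 1 1 (pw G) (pw G') f"
        by (rule linking_iso [OF P_grp(3) [OF G(1)] P_grp(3) [OF G(2)] f])
          (simp add: pw_def iso_pow [OF P_grp(1) [OF G(1)] P_grp(1) [OF G(2)] f])
      \<comment> \<open>The row E, G, G', E' of links has \<open>e = 0\<close> at both ends, so
        rigidity applies.\<close>
      from linking_trans [OF linking.linking_sym [OF th] linking_trans [OF this et]]
      have "rigid_linking E E' p n 0 \<phi> \<phi>' (\<eta> \<circ> f \<circ> inv_into (carrier G) \<theta>)"
        by (simp add: rigid_linking_def comp_assoc)
      from rigid_linking.rigidity [OF this]
      obtain h where h: "h \<in> iso E E'" "\<forall>x \<in> carrier E. h (\<phi> x) = \<phi>' (h x)" by blast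
      have eq: "E = E'" by (rule reps_distinct [OF EE(1,2) is_isoI [OF h(1)]])
      then have "conj_endo E \<phi> \<phi>'" unfolding conj_endo_def using h by blast
      then show "E = E' \<and> aut_orbit E \<phi> = aut_orbit E' \<phi>'"
        using eq aut_orbit_eq_iff [OF reps_in [OF EE(1)] p EE(3)] EE(4) by blast
    next
      assume eq: "E = E' \<and> aut_orbit E \<phi> = aut_orbit E' \<phi>'"
      then have "conj_endo E \<phi> \<phi>'"
        using aut_orbit_eq_iff [OF reps_in [OF EE(1)] p EE(3)] EE(4) by blast
      then obtain h where h: "h \<in> iso E E" "\<forall>x \<in> carrier E. h (\<phi> x) = \<phi>' (h x)"
        unfolding conj_endo_def by blast
      have et': "linking G' E p n 1 0 (pw G') \<phi>' \<eta>" using et eq by simp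
      have "linking E E p n 0 0 \<phi> \<phi>' h"
        by (rule linking_iso [OF linking.axioms(2) [OF th] linking.axioms(2) [OF et'] h(1)])
          (use h(2) in blast)
      \<comment> \<open>The row G, E, E, G' has \<open>e = 1\<close> at both ends.\<close>
      from linking_trans [OF th linking_trans [OF this linking.linking_sym [OF et']]]
      have "rigid_linking G G' p n 1 (pw G) (pw G') (inv_into (carrier G') \<eta> \<circ> h \<circ> \<theta>)"
        by (simp add: rigid_linking_def comp_assoc)
      from rigid_linking.rigidity [OF this] show "G \<cong> G'" using is_isoI by blast
    qed
    then show ?thesis using R_iff [OF G] E by simp
  qed
  have finE: "finite Es"
    by (rule finite_nonisomorphic_groups [of Es "p ^ n"]) (use E_grp reps_distinct in auto)
  have finN: "finite (N_set E n)" if "E \<in> Es" for E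
  proof (rule finite_subset)
    show "N_set E n \<subseteq> carrier E \<rightarrow>\<^sub>E carrier E" by (auto simp: N_set_def hom_def PiE_def)
    show "finite (carrier E \<rightarrow>\<^sub>E carrier E)" using E_grp(2) [OF that] by (intro finite_PiE)
  qed
  have "num_iso_classes (p ^ n) (\<lambda>G. exp_divides G (derived G (carrier G)) p) = card ((\<lambda>G. R `` {G}) ` P)"
    unfolding num_iso_classes_def P_def R_def quotient_def by (rule arg_cong [of _ _ card]) blast
  also have "\<dots> = card ((\<lambda>b. map_prod id (aut_orbit (fst b)) b) ` S)"
    by (rule card_image_correspondence [of P S L, OF total surj iff])
  also have "(\<lambda>b. map_prod id (aut_orbit (fst b)) b) ` S = Sigma Es (\<lambda>E. aut_orbit E ` N_set E n)"
    by (force simp: S_def)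
  also have "card \<dots> = (\<Sum>E \<in> Es. card (aut_orbit E ` N_set E n))"
    using finE finN by (intro card_SigmaI) auto
  finally have "real (num_iso_classes (p ^ n) (\<lambda>G. exp_divides G (derived G (carrier G)) p))
      = (\<Sum>E \<in> Es. real (card (aut_orbit E ` N_set E n)))" by simp
  also have "\<dots> = (\<Sum>E \<in> Es. \<Sum>\<phi> \<in> N_set E n. 1 / real (card (aut_orbit E \<phi>)))"
  proof (rule sum.cong [OF refl], rule sum_inverse_card_fibres [symmetric])
    fix E assume E: "E \<in> Es"
    show "finite (N_set E n)" by (rule finN [OF E])
    fix \<phi> assume phi: "\<phi> \<in> N_set E n"
    show "aut_orbit E \<phi> = {\<chi> \<in> N_set E n. aut_orbit E \<chi> = aut_orbit E \<phi>}"
      using aut_orbit_eq [OF reps_in [OF E] p phi] aut_orbit_eq_iff [OF reps_in [OF E] p phi] by auto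
  qed
  finally show ?thesis .
qed

end
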